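(* Let $\mathbb{S}=\{1,2,\ldots,N\}$ with $N\in\mathbb{N}\cup\{\infty\}$, let $b:\mathbb{R}^d\times\mathbb{S}\to\mathbb{R}^d$, $\sigma:\mathbb{R}^d\times\mathbb{S}\to\mathbb{R}^{d\times m}$, and for each $x\in\mathbb{R}^d$ let $Q(x)=(q_{ij}(x))_{i,j\in\mathbb{S}}$ be a transition rate matrix. Assume: (A1) there are $K_1,K_2>0$ with $|b(x,i)-b(y,i)|+\|\sigma(x,i)-\sigma(y,i)\|\le K_1|x-y|$ and $|b(x,i)|+\|\sigma(x,i)\|\le K_2$ for all $x,y\in\mathbb{R}^d$, $i\in\mathbb{S}$; (A2) for each $x$, $Q(x)$ is conservative and irreducible, and $\sup_{i\in\mathbb{S}}\sum_{j\neq i}\sup_{x\in\mathbb{R}^d}q_{ij}(x)<\infty$; (A3) there is $K_3>0$ with $\sup_{i\in\mathbb{S}}\sum_{j\neq i}|q_{ij}(x)-q_{ij}(y)|\le K_3|x-y|$ for all $x,y$; (A4) for each $x$ the semigroup $P_t^x$ has an invariant probability measure $\pi^x=(\pi^x_i)_{i\in\mathbb{S}}$, and there are $c_1,\lambda_1>0$ with $\sup_{i\in\mathbb{S}}\|P_t^x(i,\cdot)-\pi^x\|_{\mathrm{var}}\le c_1e^{-\lambda_1t}$ for all $t>0$, $x\in\mathbb{R}^d$. Fix $x_0\in\mathbb{R}^d$, $i_0\in\mathbb{S}$. For $\varepsilon,\alpha>0$ let $(X^{\varepsilon,\alpha}_t,Y^{\varepsilon,\alpha}_t)$ be the solution of $$dX_t^{\varepsilon,\alpha}=b(X_t^{\varepsilon,\alpha},Y_t^{\varepsilon,\alpha})dt+\sqrt{\varepsilon}\,\sigma(X_t^{\varepsilon,\alpha},Y_t^{\varepsilon,\alpha})dW_t,\quad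 X_0^{\varepsilon,\alpha}=x_0,\ Y_0^{\varepsilon,\alpha}=i_0,$$ where $W$ is an $m$-dimensional Brownian motion and $Y^{\varepsilon,\alpha}$ is a jump process on $\mathbb{S}$ with $\mathbb{P}(Y^{\varepsilon,\alpha}_{t+\delta}=j\mid Y^{\varepsilon,\alpha}_t=i,X^{\varepsilon,\alpha}_t=x)=\frac1\alpha q_{ij}(x)\delta+o(\delta)$ for $i\ne j$ and $=1+\frac1\alpha q_{ii}(x)\delta+o(\delta)$ for $i=j$, as $\delta\downarrow0$. Let $\bar b(x)=\sum_{i\in\mathbb{S}}b(x,i)\pi_i^x$ and let $(\bar X_t)$ be the solution of the ODE $d\bar X_t=\bar b(\bar X_t)dt$, $\bar X_0=x_0$. Then for every $t>0$, $$\lim_{\varepsilon,\alpha\to0}\mathbb{E}|X_t^{\varepsilon,\alpha}-\bar X_t|=0.$$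
   Context: $P_t^x$ denotes the transition semigroup of the continuous-time Markov chain on $\mathbb{S}$ with transition rate matrix $Q(x)$. Conservative means $q_{ij}(x)\ge0$ for $i\ne j$ and $\sum_j q_{ij}(x)=0$. $\|\mu-\nu\|_{\mathrm{var}}=\sum_i|\mu_i-\nu_i|$ for probability measures on $\mathbb{S}$; $\|\cdot\|$ is a matrix norm. Under (A1)–(A3) the system has a unique strong solution, and under (A1)–(A4) the function $\bar b$ is Lipschitz so the ODE has a unique solution. *)

theory Defs
  imports "HOL-Probability.Probability"
begin

definition state_space :: "enat \<Rightarrow> nat set" where
  "state_space N = {i. 1 \<le> i \<and> enat i \<le> N}"

definition conservative :: "nat set \<Rightarrow> (nat \<Rightarrow> nat \<Rightarrow> real) \<Rightarrow> bool" where
  "conservative S q \<longleftrightarrow>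
     (\<forall>i\<in>S. \<forall>j\<in>S. i \<noteq> j \<longrightarrow> q i j \<ge> 0) \<and> (\<forall>i\<in>S. ((\<lambda>j. q i j) has_sum 0) S)"

definition irreducible_rates :: "nat set \<Rightarrow> (nat \<Rightarrow> nat \<Rightarrow> real) \<Rightarrow> bool" where
  "irreducible_rates S q \<longleftrightarrow>
     (\<forall>i\<in>S. \<forall>j\<in>S. \<exists>p. p \<noteq> [] \<and> hd p = i \<and> last p = j \<and> set p \<subseteq> S \<and>
        (\<forall>k. Suc k < length p \<longrightarrow> q (p ! k) (p ! Suc k) > 0))"

definition mat_mult :: "nat set \<Rightarrow> (nat \<Rightarrow> nat \<Rightarrow> real) \<Rightarrow> (nat \<Rightarrow> nat \<Rightarrow> real) \<Rightarrow> nat \<Rightarrow> nat \<Rightarrow> real" where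
  "mat_mult S A B i j = (\<Sum>\<^sub>\<infinity>k\<in>S. A i k * B k j)"

fun mat_pow :: "nat set \<Rightarrow> (nat \<Rightarrow> nat \<Rightarrow> real) \<Rightarrow> nat \<Rightarrow> nat \<Rightarrow> nat \<Rightarrow> real" where
  "mat_pow S A 0 = (\<lambda>i j. if i = j then 1 else 0)"
| "mat_pow S A (Suc n) = mat_mult S A (mat_pow S A n)"

definition ctmc_semigroup :: "nat set \<Rightarrow> (nat \<Rightarrow> nat \<Rightarrow> real) \<Rightarrow> real \<Rightarrow> nat \<Rightarrow> nat \<Rightarrow> real" where
  "ctmc_semigroup S q t i j = (\<Sum>n. t ^ n / fact n * mat_pow S q n i j)"

definition invariant_prob :: "nat set \<Rightarrow> (nat \<Rightarrow> nat \<Rightarrow> real) \<Rightarrow> (nat \<Rightarrow> real) \<Rightarrow> bool" where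
  "invariant_prob S q p \<longleftrightarrow>
     (\<forall>i\<in>S. p i \<ge> 0) \<and> (p has_sum 1) S \<and>
     (\<forall>t\<ge>0. \<forall>j\<in>S. (\<Sum>\<^sub>\<infinity>i\<in>S. p i * ctmc_semigroup S q t i j) = p j)"

definition filtration_of :: "'a measure \<Rightarrow> (real \<Rightarrow> 'a measure) \<Rightarrow> bool" where
  "filtration_of M F \<longleftrightarrow> (\<forall>t\<ge>0. subalgebra M (F t)) \<and>
     (\<forall>s t. 0 \<le> s \<and> s \<le> t \<longrightarrow> sets (F s) \<subseteq> sets (F t))"

definition gauss_measure :: "real \<Rightarrow> ('b::euclidean_space) measure" where
  "gauss_measure s = density lborel
     (\<lambda>v. ennreal ((2 * pi * s) powr (- real DIM('b) / 2) * exp (- (norm v)\<^sup>2 / (2 * s))))"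

definition brownian_motion :: "'a measure \<Rightarrow> (real \<Rightarrow> 'a measure) \<Rightarrow> (real \<Rightarrow> 'a \<Rightarrow> 'b::euclidean_space) \<Rightarrow> bool" where
  "brownian_motion M F W \<longleftrightarrow>
     (\<forall>t\<ge>0. W t \<in> borel_measurable (F t)) \<and>
     (\<forall>\<omega>\<in>space M. W 0 \<omega> = 0 \<and> continuous_on {0..} (\<lambda>t. W t \<omega>)) \<and>
     (\<forall>s t. 0 \<le> s \<and> s < t \<longrightarrow>
        (\<forall>A\<in>sets (F s). \<forall>B\<in>sets borel.
           measure M (A \<inter> {\<omega>\<in>space M. W t \<omega> - W s \<omega> \<in> B})
             = measure M A * measure (gauss_measure (t - s)) B))"

definition martingale_wrt :: "'a measure \<Rightarrow> (real \<Rightarrow> 'a measure) \<Rightarrow> (real \<Rightarrow> 'a \<Rightarrow> real) \<Rightarrow> bool" where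
  "martingale_wrt M F Z \<longleftrightarrow>
     (\<forall>t\<ge>0. integrable M (Z t) \<and> Z t \<in> borel_measurable (F t)) \<and>
     (\<forall>s t. 0 \<le> s \<and> s \<le> t \<longrightarrow>
        (\<forall>A\<in>sets (F s). set_lebesgue_integral M A (Z t) = set_lebesgue_integral M A (Z s)))"

definition converges_in_prob :: "'a measure \<Rightarrow> (nat \<Rightarrow> 'a \<Rightarrow> 'b::metric_space) \<Rightarrow> ('a \<Rightarrow> 'b) \<Rightarrow> bool" where
  "converges_in_prob M Sn I \<longleftrightarrow>
     (\<forall>e>0. (\<lambda>n. measure M {\<omega>\<in>space M. dist (Sn n \<omega>) (I \<omega>) > e}) \<longlonglongrightarrow> 0)"

text \<open>Stochastic (Ito) integral of the adapted cadlag integrand H against W over [0,t]: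
  limit in probability of left-point Riemann sums over uniform partitions.\<close>
definition ito_integral_is ::
  "'a measure \<Rightarrow> (real \<Rightarrow> 'a \<Rightarrow> real^'m^'d) \<Rightarrow> (real \<Rightarrow> 'a \<Rightarrow> real^'m) \<Rightarrow> real \<Rightarrow> ('a \<Rightarrow> real^'d) \<Rightarrow> bool" where
  "ito_integral_is M H W t I \<longleftrightarrow> I \<in> borel_measurable M \<and>
     converges_in_prob M
       (\<lambda>n \<omega>. \<Sum>k<n. H (real k * t / real n) \<omega> *v
                     (W (real (Suc k) * t / real n) \<omega> - W (real k * t / real n) \<omega>)) I"

definition cadlag_discrete :: "(real \<Rightarrow> 'c) \<Rightarrow> bool" where
  "cadlag_discrete y \<longleftrightarrow>
     (\<forall>s\<ge>0. \<exists>d>0. \<forall>u. s \<le> u \<and> u < s + d \<longrightarrow> y u = y s) \<and>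
     (\<forall>s>0. \<exists>d>0. \<exists>c. \<forall>u. s - d < u \<and> u < s \<longrightarrow> y u = c)"

text \<open>(X,Y) solves the regime-switching SDE with parameters eps, alpha on the filtered
  probability space (M,F) driven by the Brownian motion W:
  dX = b(X,Y) dt + sqrt eps sigma(X,Y) dW, X_0 = x0, Y_0 = i0, and Y jumps from i to j
  at rate q_ij(X)/alpha (martingale formulation of the infinitesimal transition probabilities).\<close>
definition sde_solution ::
  "'a measure \<Rightarrow> (real \<Rightarrow> 'a measure) \<Rightarrow> (real \<Rightarrow> 'a \<Rightarrow> real^'m) \<Rightarrow>
   (real \<Rightarrow> 'a \<Rightarrow> real^'d) \<Rightarrow> (real \<Rightarrow> 'a \<Rightarrow> nat) \<Rightarrow>
   nat set \<Rightarrow> (real^'d \<Rightarrow> nat \<Rightarrow> real^'d) \<Rightarrow> (real^'d \<Rightarrow> nat \<Rightarrow> real^'m^'d) \<Rightarrow>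
   (real^'d \<Rightarrow> nat \<Rightarrow> nat \<Rightarrow> real) \<Rightarrow> real^'d \<Rightarrow> nat \<Rightarrow> real \<Rightarrow> real \<Rightarrow> bool" where
  "sde_solution M F W X Y S b \<sigma> Q x0 i0 \<epsilon> \<alpha> \<longleftrightarrow>
     prob_space M \<and> filtration_of M F \<and> brownian_motion M F W \<and>
     (\<forall>t\<ge>0. X t \<in> borel_measurable (F t) \<and> Y t \<in> measurable (F t) (count_space UNIV)) \<and>
     (\<forall>\<omega>\<in>space M. X 0 \<omega> = x0 \<and> Y 0 \<omega> = i0 \<and> continuous_on {0..} (\<lambda>t. X t \<omega>) \<and>
        (\<forall>t\<ge>0. Y t \<omega> \<in> S) \<and> cadlag_discrete (\<lambda>t. Y t \<omega>)) \<and>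
     (\<forall>t\<ge>0. \<exists>I. ito_integral_is M (\<lambda>s \<omega>. \<sigma> (X s \<omega>) (Y s \<omega>)) W t I \<and>
        (AE \<omega> in M. X t \<omega> = x0 + integral {0..t} (\<lambda>s. b (X s \<omega>) (Y s \<omega>)) + sqrt \<epsilon> *\<^sub>R I \<omega>)) \<and>
     (\<forall>j\<in>S. martingale_wrt M F
        (\<lambda>t \<omega>. (if Y t \<omega> = j then 1 else 0) - integral {0..t} (\<lambda>s. Q (X s \<omega>) (Y s \<omega>) j / \<alpha>)))"

end

theory Submission
  imports Defs
begin

text \<open>Freezing the slow variable at \<open>x\<close>, the corrector \<open>g = \<integral>\<^sub>0\<^sup>T exp (s Q(x)) b(x, \<cdot>) ds\<close> satisfies
  \<open>Q(x) g = exp (T Q(x)) b(x, \<cdot>) - b(x, \<cdot>)\<close>, and by (A4) the right-hand side is within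
  \<open>O(exp (- \<lambda> T))\<close> of \<open>mean_drift(x) - b(x, \<cdot>)\<close>, uniformly in the state. The martingale problem for
  \<open>Y\<close>, applied to \<open>g\<close> with the slow variable frozen on intervals of length about \<open>\<alpha>\<close>, therefore
  turns \<open>\<integral> (b(X, Y) - mean_drift(X)) dt\<close> into \<open>\<alpha>\<close> times telescoping boundary terms, plus \<open>\<alpha>\<close> times
  a sum of \<open>O(1/\<alpha>)\<close> bounded orthogonal martingale increments, plus freezing errors. For fixed \<open>T\<close> these are
  \<open>O(sqrt \<alpha> + sqrt \<epsilon>)\<close>, with no relation required between \<open>\<epsilon>\<close> and \<open>\<alpha>\<close>. The same perturbation estimates
  make the averaged drift Lipschitz, so Gronwall's inequality applies, and finally \<open>T \<rightarrow> \<infinity>\<close>.\<close>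

text \<open>The \<open>abs_summable_on\<close> of \<open>Infinite_Sum\<close>, not the one of \<open>Infinite_Set_Sum\<close>, is meant throughout.\<close>

no_notation Infinite_Set_Sum.abs_summable_on (infix \<open>abs'_summable'_on\<close> 50)

text \<open>An Ito formula for the corrector along the moving pair (X, Y) is not at hand: the
  corrector is only known to be Lipschitz in x, and the solution concept supplies martingales only
  for indicators of single states. Since S may be infinite, all bounds are uniform in the state:
  Q(x) acts as a bounded operator on bounded functions, so semigroup and corrector are
  norm-convergent power series. The interval length \<alpha> is the time scale of the jumps, on
  which a martingale increment has a deterministic bound free of \<alpha>. The constants grow
  exponentially in T, hence T stays fixed until \<epsilon> and \<alpha> have become small. The
  stochastic integral is given only as a limit in probability of Riemann sums, so its first moment
  is reached by truncation from their second moments. Each pair (\<epsilon>, \<alpha>) comes with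
  its own probability space, so the final constant has to be expressed without reference to any of
  them.\<close>

lemma infsum_minus:
  fixes f g :: "'a \<Rightarrow> 'b::{topological_ab_group_add, t2_space}"
  assumes "f summable_on A" "g summable_on A"
  shows "(\<Sum>\<^sub>\<infinity>x\<in>A. f x - g x) = infsum f A - infsum g A"
  using infsum_add[OF assms(1) summable_on_uminus[THEN iffD2, OF assms(2)]] by (simp add: infsum_uminus)

section \<open>Kernels with bounded rows\<close>

text \<open>The summable majorant \<open>u\<close> of the row norms makes the family absolutely
  summable on the product \<open>A \<times> B\<close>, and everything follows by exchanging the
  factors. The third and fourth conclusions give row bounds for composed kernels, the fifth every
  interchange of sums below.\<close>

lemma double_infsum_swap:
  fixes F :: "'a \<Rightarrow> 'b \<Rightarrow> real"
  assumes F: "\<And>x. x \<in> A \<Longrightarrow> F x abs_summable_on B"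
    and le: "\<And>x. x \<in> A \<Longrightarrow> (\<Sum>\<^sub>\<infinity>y\<in>B. \<bar>F x y\<bar>) \<le> u x"
    and u: "u summable_on A"
  shows "(\<lambda>x. \<Sum>\<^sub>\<infinity>y\<in>B. F x y) abs_summable_on A"
    and "y \<in> B \<Longrightarrow> (\<lambda>x. F x y) abs_summable_on A"
    and "(\<lambda>y. \<Sum>\<^sub>\<infinity>x\<in>A. F x y) abs_summable_on B"
    and "(\<Sum>\<^sub>\<infinity>y\<in>B. \<bar>\<Sum>\<^sub>\<infinity>x\<in>A. F x y\<bar>) \<le> infsum u A"
    and "(\<Sum>\<^sub>\<infinity>x\<in>A. \<Sum>\<^sub>\<infinity>y\<in>B. F x y) = (\<Sum>\<^sub>\<infinity>y\<in>B. \<Sum>\<^sub>\<infinity>x\<in>A. F x y)"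
proof -
  have n: "norm (\<Sum>\<^sub>\<infinity>y\<in>B. norm (F x y)) \<le> u x" if "x \<in> A" for x
    using le[OF that] by (simp add: infsum_nonneg)
  have sx: "(\<lambda>x. \<Sum>\<^sub>\<infinity>y\<in>B. norm (F x y)) abs_summable_on A"
    by (rule Infinite_Sum.abs_summable_on_comparison_test'[OF u n])
  have AB: "(\<lambda>(x,y). F x y) abs_summable_on A \<times> B"
    using F sx by (subst Infinite_Sum.abs_summable_on_Sigma_iff) auto
  have BA: "(\<lambda>(y,x). F x y) abs_summable_on B \<times> A"
  proof -
    have "(\<lambda>p. norm (case p of (x,y) \<Rightarrow> F x y)) summable_on A \<times> B" using AB .
    then have "((\<lambda>p. norm (case p of (x,y) \<Rightarrow> F x y)) \<circ> prod.swap) summable_on B \<times> A"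
      by (subst summable_on_reindex[symmetric]) (auto simp: product_swap)
    then show ?thesis by (simp add: o_def case_prod_unfold)
  qed
  show sumx: "(\<lambda>x. \<Sum>\<^sub>\<infinity>y\<in>B. F x y) abs_summable_on A"
  proof (rule Infinite_Sum.abs_summable_on_comparison_test'[OF u])
    fix x assume "x \<in> A"
    then show "norm (\<Sum>\<^sub>\<infinity>y\<in>B. F x y) \<le> u x"
      using norm_infsum_bound[of "F x" B] F le by force
  qed
  have By: "\<And>y. y \<in> B \<Longrightarrow> (\<lambda>x. F x y) abs_summable_on A"
    and sy: "(\<lambda>y. \<Sum>\<^sub>\<infinity>x\<in>A. norm (F x y)) abs_summable_on B"
    using BA unfolding Infinite_Sum.abs_summable_on_Sigma_iff by (simp_all only: prod.case)
  show "y \<in> B \<Longrightarrow> (\<lambda>x. F x y) abs_summable_on A" by (rule By)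
  have sy': "(\<lambda>y. \<Sum>\<^sub>\<infinity>x\<in>A. norm (F x y)) summable_on B"
    using sy by (rule abs_summable_summable)
  show sB: "(\<lambda>y. \<Sum>\<^sub>\<infinity>x\<in>A. F x y) abs_summable_on B"
    by (rule Infinite_Sum.abs_summable_on_comparison_test'[OF sy']) (rule norm_infsum_bound[OF By])
  have "(\<Sum>\<^sub>\<infinity>y\<in>B. \<bar>\<Sum>\<^sub>\<infinity>x\<in>A. F x y\<bar>) \<le> (\<Sum>\<^sub>\<infinity>y\<in>B. \<Sum>\<^sub>\<infinity>x\<in>A. norm (F x y))"
    using sB sy' norm_infsum_bound[OF By] by (intro infsum_mono) auto
  also have "\<dots> = (\<Sum>\<^sub>\<infinity>x\<in>A. \<Sum>\<^sub>\<infinity>y\<in>B. norm (F x y))"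
    using AB by (intro infsum_swap_banach[symmetric]) (simp add: case_prod_unfold)
  also have "\<dots> \<le> infsum u A"
    using abs_summable_summable[OF sx] u le by (intro infsum_mono) auto
  finally show "(\<Sum>\<^sub>\<infinity>y\<in>B. \<bar>\<Sum>\<^sub>\<infinity>x\<in>A. F x y\<bar>) \<le> infsum u A" .
  show "(\<Sum>\<^sub>\<infinity>x\<in>A. \<Sum>\<^sub>\<infinity>y\<in>B. F x y) = (\<Sum>\<^sub>\<infinity>y\<in>B. \<Sum>\<^sub>\<infinity>x\<in>A. F x y)"
    by (rule infsum_swap_banach[OF abs_summable_summable[OF AB]])
qed

text \<open>\<open>C\<close> bounds the norm of the kernel as an operator on bounded functions with
  the supremum norm. There is no sign condition, so that differences of rate matrices qualify as
  well.\<close>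

definition row_bounded :: "nat set \<Rightarrow> (nat \<Rightarrow> nat \<Rightarrow> real) \<Rightarrow> real \<Rightarrow> bool" where
  "row_bounded S q C \<longleftrightarrow> (\<forall>i\<in>S. q i abs_summable_on S \<and> (\<Sum>\<^sub>\<infinity>j\<in>S. \<bar>q i j\<bar>) \<le> C)"

definition kapply :: "nat set \<Rightarrow> (nat \<Rightarrow> nat \<Rightarrow> real) \<Rightarrow> (nat \<Rightarrow> real) \<Rightarrow> nat \<Rightarrow> real" where
  "kapply S q f i = (\<Sum>\<^sub>\<infinity>j\<in>S. q i j * f j)"

text \<open>The pairing of a summable weight with a bounded function. It is applied both to rows of
  kernels and to differences of probability vectors.\<close>

lemma wsum_bound:
  fixes w f :: "nat \<Rightarrow> real"
  assumes w: "w abs_summable_on S" and f: "\<And>j. j \<in> S \<Longrightarrow> \<bar>f j\<bar> \<le> B"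
  shows "(\<lambda>j. w j * f j) abs_summable_on S"
    and "(\<Sum>\<^sub>\<infinity>j\<in>S. \<bar>w j * f j\<bar>) \<le> (\<Sum>\<^sub>\<infinity>j\<in>S. \<bar>w j\<bar>) * B"
    and "\<bar>\<Sum>\<^sub>\<infinity>j\<in>S. w j * f j\<bar> \<le> (\<Sum>\<^sub>\<infinity>j\<in>S. \<bar>w j\<bar>) * B"
proof -
  have wB: "(\<lambda>j. \<bar>w j\<bar> * B) summable_on S"
    using w by (intro summable_on_cmult_left) simp
  show s: "(\<lambda>j. w j * f j) abs_summable_on S"
    by (rule Infinite_Sum.abs_summable_on_comparison_test'[OF wB]) (use f in \<open>auto simp: abs_mult intro: mult_left_mono\<close>)
  have "(\<Sum>\<^sub>\<infinity>j\<in>S. \<bar>w j * f j\<bar>) \<le> (\<Sum>\<^sub>\<infinity>j\<in>S. \<bar>w j\<bar> * B)"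
    using s wB f by (intro infsum_mono) (auto simp: abs_mult intro: mult_left_mono)
  also have "\<dots> = (\<Sum>\<^sub>\<infinity>j\<in>S. \<bar>w j\<bar>) * B"
    using w by (intro infsum_cmult_left) simp
  finally show *: "(\<Sum>\<^sub>\<infinity>j\<in>S. \<bar>w j * f j\<bar>) \<le> (\<Sum>\<^sub>\<infinity>j\<in>S. \<bar>w j\<bar>) * B" .
  show "\<bar>\<Sum>\<^sub>\<infinity>j\<in>S. w j * f j\<bar> \<le> (\<Sum>\<^sub>\<infinity>j\<in>S. \<bar>w j\<bar>) * B"
    using norm_infsum_bound[OF s] * by simp
qed

lemma row_boundedD:
  assumes "row_bounded S q C" "i \<in> S"
  shows "q i abs_summable_on S" "(\<Sum>\<^sub>\<infinity>j\<in>S. \<bar>q i j\<bar>) \<le> C" "0 \<le> C"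
  using assms infsum_nonneg[of S "\<lambda>j. \<bar>q i j\<bar>"] by (auto simp: row_bounded_def)

lemma kapply_summable:
  assumes "row_bounded S q C" "i \<in> S" "\<And>j. j \<in> S \<Longrightarrow> \<bar>f j\<bar> \<le> B"
  shows "(\<lambda>j. q i j * f j) abs_summable_on S"
  using wsum_bound(1)[OF row_boundedD(1)[OF assms(1,2)] assms(3)] by simp

lemma kapply_bound:
  assumes q: "row_bounded S q C" and i: "i \<in> S" and f: "\<And>j. j \<in> S \<Longrightarrow> \<bar>f j\<bar> \<le> B"
  shows "\<bar>kapply S q f i\<bar> \<le> C * B"
proof -
  have "0 \<le> B" using f[OF i] by linarith
  then show ?thesis
    unfolding kapply_def
    using wsum_bound(3)[OF row_boundedD(1)[OF q i] f] row_boundedD(2)[OF q i]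
    by (meson mult_right_mono order_trans)
qed

lemma kapply_cong: "(\<And>j. j \<in> S \<Longrightarrow> f j = g j) \<Longrightarrow> kapply S q f i = kapply S q g i"
  by (auto simp: kapply_def intro: infsum_cong)

lemma kapply_diff:
  assumes "row_bounded S q C" "i \<in> S" "\<And>j. j \<in> S \<Longrightarrow> \<bar>f j\<bar> \<le> B" "\<And>j. j \<in> S \<Longrightarrow> \<bar>g j\<bar> \<le> B'"
  shows "kapply S q (\<lambda>j. f j - g j) i = kapply S q f i - kapply S q g i"
  unfolding kapply_def right_diff_distrib
  using kapply_summable[OF assms(1-3)] kapply_summable[OF assms(1,2,4)]
  by (subst infsum_minus) (auto intro: abs_summable_summable)

lemma kapply_diff_kernel:
  assumes "row_bounded S q C" "row_bounded S q' C'" "i \<in> S" "\<And>j. j \<in> S \<Longrightarrow> \<bar>f j\<bar> \<le> B"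
  shows "kapply S (\<lambda>i j. q i j - q' i j) f i = kapply S q f i - kapply S q' f i"
  unfolding kapply_def left_diff_distrib
  using kapply_summable[OF assms(1,3,4)] kapply_summable[OF assms(2,3,4)]
  by (subst infsum_minus) (auto intro: abs_summable_summable)

lemma kapply_iter_bound:
  assumes q: "row_bounded S q C" and f: "\<And>j. j \<in> S \<Longrightarrow> \<bar>f j\<bar> \<le> B" and "i \<in> S"
  shows "\<bar>(kapply S q ^^ n) f i\<bar> \<le> C ^ n * B"
  using \<open>i \<in> S\<close>
proof (induction n arbitrary: i)
  case (Suc n)
  show ?case using kapply_bound[OF q Suc.prems Suc.IH] by (simp add: mult.assoc)
qed (use f in simp)

lemma row_bounded_mat_mult:
  assumes A: "row_bounded S A a" and B: "row_bounded S B b"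
  shows "row_bounded S (mat_mult S A B) (a * b)"
  unfolding row_bounded_def
proof
  fix i assume i: "i \<in> S"
  have "0 \<le> b" using row_boundedD(3)[OF B i] .
  let ?F = "\<lambda>k j. A i k * B k j"
  have F: "?F k abs_summable_on S" "(\<Sum>\<^sub>\<infinity>j\<in>S. \<bar>?F k j\<bar>) \<le> \<bar>A i k\<bar> * b" if "k \<in> S" for k
    using row_boundedD[OF B that]
    by (auto simp: abs_mult infsum_cmult_right' intro!: summable_on_cmult_right mult_left_mono)
  have u: "(\<lambda>k. \<bar>A i k\<bar> * b) summable_on S"
    using row_boundedD(1)[OF A i] by (intro summable_on_cmult_left) simp
  have "infsum (\<lambda>k. \<bar>A i k\<bar> * b) S \<le> a * b"
    using row_boundedD(2)[OF A i] \<open>0 \<le> b\<close> by (simp add: infsum_cmult_left' mult_right_mono)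
  then show "mat_mult S A B i abs_summable_on S \<and> (\<Sum>\<^sub>\<infinity>j\<in>S. \<bar>mat_mult S A B i j\<bar>) \<le> a * b"
    using double_infsum_swap(3,4)[OF F u] unfolding mat_mult_def by force
qed

text \<open>Associativity of infinite matrix products is a Fubini statement; the row bounds and the
  bound on \<open>f\<close> supply the absolute convergence.\<close>

lemma kapply_mat_mult:
  assumes A: "row_bounded S A a" and B: "row_bounded S B b" and i: "i \<in> S"
    and f: "\<And>j. j \<in> S \<Longrightarrow> \<bar>f j\<bar> \<le> c"
  shows "kapply S (mat_mult S A B) f i = kapply S A (kapply S B f) i"
proof -
  have c: "0 \<le> c" using f[OF i] by linarith
  let ?F = "\<lambda>k j. A i k * (B k j * f j)"
  have F: "?F k abs_summable_on S" "(\<Sum>\<^sub>\<infinity>j\<in>S. \<bar>?F k j\<bar>) \<le> \<bar>A i k\<bar> * (b * c)" if "k \<in> S" for k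
  proof -
    have "(\<lambda>j. norm (A i k) * norm (B k j * f j)) summable_on S"
      by (intro summable_on_cmult_right kapply_summable[OF B that f])
    then show "?F k abs_summable_on S" by (simp only: norm_mult)
    have "(\<Sum>\<^sub>\<infinity>j\<in>S. \<bar>B k j * f j\<bar>) \<le> b * c"
      using wsum_bound(2)[OF row_boundedD(1)[OF B that] f] row_boundedD(2)[OF B that] c
      by (meson mult_right_mono order_trans)
    then show "(\<Sum>\<^sub>\<infinity>j\<in>S. \<bar>?F k j\<bar>) \<le> \<bar>A i k\<bar> * (b * c)"
      by (subst abs_mult) (simp add: infsum_cmult_right' mult_left_mono)
  qed
  have u: "(\<lambda>k. \<bar>A i k\<bar> * (b * c)) summable_on S"
    using row_boundedD(1)[OF A i] by (intro summable_on_cmult_left) simp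
  have "kapply S A (kapply S B f) i = (\<Sum>\<^sub>\<infinity>k\<in>S. \<Sum>\<^sub>\<infinity>j\<in>S. ?F k j)"
    by (simp add: kapply_def infsum_cmult_right')
  also have "\<dots> = (\<Sum>\<^sub>\<infinity>j\<in>S. \<Sum>\<^sub>\<infinity>k\<in>S. ?F k j)"
    by (rule double_infsum_swap(5)[OF F u])
  also have "\<dots> = kapply S (mat_mult S A B) f i"
    unfolding kapply_def mat_mult_def
    by (intro infsum_cong) (simp only: infsum_cmult_left' flip: mult.assoc)
  finally show ?thesis by simp
qed

lemma row_bounded_mat_pow:
  assumes q: "row_bounded S q C"
  shows "row_bounded S (mat_pow S q n) (C ^ n)"
proof (induction n)
  case 0
  have "((\<lambda>j. \<bar>if i = j then 1 else 0 :: real\<bar>) has_sum 1) S" if "i \<in> S" for i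
    using that by (intro has_sum_finite_neutralI[of "{i}"]) auto
  then show ?case
    by (auto simp: row_bounded_def has_sum_iff)
next
  case (Suc n)
  then show ?case using row_bounded_mat_mult[OF q Suc] by simp
qed

lemma kapply_mat_pow:
  assumes q: "row_bounded S q C" and f: "\<And>j. j \<in> S \<Longrightarrow> \<bar>f j\<bar> \<le> B" and i: "i \<in> S"
  shows "kapply S (mat_pow S q n) f i = (kapply S q ^^ n) f i"
  using i
proof (induction n arbitrary: i)
  case 0
  have "((\<lambda>j. (if i = j then 1 else 0) * f j) has_sum f i) S"
    using 0 by (intro has_sum_finite_neutralI[of "{i}"]) auto
  then show ?case by (simp add: kapply_def has_sum_iff)
next
  case (Suc n)
  have "kapply S (mat_pow S q (Suc n)) f i = kapply S q (kapply S (mat_pow S q n) f) i"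
    using kapply_mat_mult[OF q row_bounded_mat_pow[OF q] Suc.prems f] by simp
  also have "\<dots> = kapply S q ((kapply S q ^^ n) f) i"
    by (intro kapply_cong Suc.IH)
  finally show ?case by simp
qed

section \<open>Exponential series of a kernel, the semigroup and the Poisson equation\<close>

lemma suminf_eq_infsum:
  fixes f :: "nat \<Rightarrow> real"
  assumes "summable (\<lambda>n. \<bar>f n\<bar>)"
  shows "(\<Sum>n. f n) = (\<Sum>\<^sub>\<infinity>n. f n)"
  using norm_summable_imp_has_sum[of f, OF _ summable_sums[OF summable_rabs_cancel[OF assms]]] assms
  by (simp add: infsumI)

lemma exp_sums: "(\<lambda>n. t ^ n / fact n * D ^ n :: real) sums exp (D * t)"
  using exp_converges[of "D * t"] by (simp add: power_mult_distrib field_simps)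

text \<open>\<open>ctmc_semigroup\<close> is defined entry by entry. The lemma promotes it to the
  operator exponential: the terms have norms at most \<open>t ^ n / fact n * C ^ n\<close>, so the
  sums over time powers and over states may be exchanged.\<close>

lemma semigroup_kernel:
  assumes q: "row_bounded S q C" and t: "0 \<le> t"
  shows "row_bounded S (ctmc_semigroup S q t) (exp (C * t))"
    and "\<lbrakk>\<And>j. j \<in> S \<Longrightarrow> \<bar>f j\<bar> \<le> B; i \<in> S\<rbrakk> \<Longrightarrow>
      kapply S (ctmc_semigroup S q t) f i = (\<Sum>n. t ^ n / fact n * (kapply S q ^^ n) f i)"
proof -
  define c :: "nat \<Rightarrow> real" where "c = (\<lambda>n. t ^ n / fact n)"
  have c0: "0 \<le> c n" for n using t by (simp add: c_def)
  let ?F = "\<lambda>i n j. c n * mat_pow S q n i j"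
  have sm: "?F i n abs_summable_on S"
    and le: "(\<Sum>\<^sub>\<infinity>j\<in>S. \<bar>?F i n j\<bar>) \<le> c n * C ^ n" if "i \<in> S" for i n
    using row_boundedD[OF row_bounded_mat_pow[OF q] that, of n] c0
    by (auto simp: abs_mult infsum_cmult_right' intro!: summable_on_cmult_right mult_left_mono)
  have c: "t ^ n / fact n = c n" for n by (simp add: c_def)
  have sums: "(\<lambda>n. c n * C ^ n) sums exp (C * t)"
    using exp_sums[of t C] by (simp add: c_def)
  have has: "((\<lambda>n. c n * C ^ n) has_sum exp (C * t)) UNIV" if "i \<in> S" for i
    by (rule sums_nonneg_imp_has_sum[OF sums]) (intro mult_nonneg_nonneg c0 zero_le_power row_boundedD(3)[OF q that])
  have dbl: "(\<lambda>n. ?F i n j) abs_summable_on UNIV" "(\<lambda>j. \<Sum>\<^sub>\<infinity>n. ?F i n j) abs_summable_on S"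
      "(\<Sum>\<^sub>\<infinity>j\<in>S. \<bar>\<Sum>\<^sub>\<infinity>n. ?F i n j\<bar>) \<le> exp (C * t)"
    if i: "i \<in> S" and j: "j \<in> S" for i j
    using double_infsum_swap(2,3,4)[of UNIV "?F i" S, OF sm[OF i] le[OF i] has_sum_imp_summable[OF has[OF i]]]
      infsumI[OF has[OF i]] j
    by simp_all
  have ctmc: "ctmc_semigroup S q t i j = (\<Sum>\<^sub>\<infinity>n. ?F i n j)" if "i \<in> S" "j \<in> S" for i j
    unfolding ctmc_semigroup_def c
    using summable_on_imp_summable[OF dbl(1)[OF that]] by (intro suminf_eq_infsum) simp
  show rb: "row_bounded S (ctmc_semigroup S q t) (exp (C * t))"
    unfolding row_bounded_def
  proof
    fix i assume i: "i \<in> S"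
    show "ctmc_semigroup S q t i abs_summable_on S \<and>
       (\<Sum>\<^sub>\<infinity>j\<in>S. \<bar>ctmc_semigroup S q t i j\<bar>) \<le> exp (C * t)"
      using dbl(2,3)[OF i i] ctmc[OF i]
      by (simp cong: infsum_cong summable_on_cong)
  qed
  assume f: "\<And>j. j \<in> S \<Longrightarrow> \<bar>f j\<bar> \<le> B" and i: "i \<in> S"
  have B: "0 \<le> B" using f[OF i] by linarith
  have sm': "(\<lambda>j. ?F i n j * f j) abs_summable_on S" for n
    using wsum_bound(1)[OF sm[OF i] f] .
  have le': "(\<Sum>\<^sub>\<infinity>j\<in>S. \<bar>?F i n j * f j\<bar>) \<le> c n * C ^ n * B" for n
    using wsum_bound(2)[OF sm[OF i, of n] f] le[OF i, of n] B
    by (meson mult_right_mono order_trans)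
  have has': "(\<lambda>n. c n * C ^ n * B) summable_on UNIV"
    using has[OF i] by (intro summable_on_cmult_left has_sum_imp_summable)
  note ** = double_infsum_swap[of UNIV "\<lambda>n j. ?F i n j * f j" S, OF sm' le' has']
  have "kapply S (ctmc_semigroup S q t) f i = (\<Sum>\<^sub>\<infinity>j\<in>S. (\<Sum>\<^sub>\<infinity>n. ?F i n j * f j))"
    unfolding kapply_def
    by (intro infsum_cong) (simp add: ctmc[OF i] infsum_cmult_left')
  also have "\<dots> = (\<Sum>\<^sub>\<infinity>n. \<Sum>\<^sub>\<infinity>j\<in>S. ?F i n j * f j)" using **(5) by simp
  also have "\<dots> = (\<Sum>n. \<Sum>\<^sub>\<infinity>j\<in>S. ?F i n j * f j)"
    using summable_on_imp_summable[OF **(1)] by (intro suminf_eq_infsum[symmetric]) simp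
  also have "(\<lambda>n. \<Sum>\<^sub>\<infinity>j\<in>S. ?F i n j * f j) = (\<lambda>n. c n * (kapply S q ^^ n) f i)"
    using kapply_mat_pow[OF q f i]
    by (simp add: kapply_def mult.assoc infsum_cmult_right' del: times_divide_eq_left)
  finally show "kapply S (ctmc_semigroup S q t) f i = (\<Sum>n. c n * (kapply S q ^^ n) f i)"
    by (simp add: c_def)
qed

text \<open>Written for \<open>h n\<close>, the n-th iterate of a kernel (or a difference of two
  such) at a fixed state. The shifted series in the last three conclusions is the one integrated
  over [0, T]; since \<open>1 \<le> D\<close>, its factor \<open>D ^ n\<close> may be raised to
  \<open>D ^ Suc n\<close>, which turns the majorant into the exponential series without its first
  term.\<close>

lemma exp_series_bound:
  fixes h :: "nat \<Rightarrow> real"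
  assumes h: "\<And>n. \<bar>h n\<bar> \<le> D ^ n * B" and D: "1 \<le> D" and T: "0 \<le> T"
  shows "summable (\<lambda>n. \<bar>T ^ n / fact n * h n\<bar>)"
    and "\<bar>\<Sum>n. T ^ n / fact n * h n\<bar> \<le> exp (D * T) * B"
    and "summable (\<lambda>n. \<bar>T ^ Suc n / fact (Suc n) * h n\<bar>)"
    and "(\<Sum>n. \<bar>T ^ Suc n / fact (Suc n) * h n\<bar>) \<le> exp (D * T) * B"
    and "\<bar>\<Sum>n. T ^ Suc n / fact (Suc n) * h n\<bar> \<le> exp (D * T) * B"
proof -
  have B: "0 \<le> B" using h[of 0] by simp
  define c :: "nat \<Rightarrow> real" where "c = (\<lambda>n. T ^ n / fact n)"
  have c0: "0 \<le> c n" for n using T by (simp add: c_def)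
  have c: "T ^ n / fact n = c n" for n by (simp add: c_def)
  have S: "(\<lambda>n. c n * D ^ n * B) sums (exp (D * T) * B)"
    using exp_sums[of T D] by (intro sums_mult2) (simp add: c_def)
  then have S': "(\<lambda>n. c (Suc n) * D ^ Suc n * B) sums (exp (D * T) * B - B)"
    by (subst sums_Suc_iff) (simp add: c_def)
  have 1: "\<bar>c n * h n\<bar> \<le> c n * D ^ n * B" for n
    using h[of n] c0[of n] by (simp add: abs_mult mult.assoc mult_left_mono)
  have 2: "\<bar>c (Suc n) * h n\<bar> \<le> c (Suc n) * D ^ Suc n * B" for n
  proof -
    have "\<bar>c (Suc n) * h n\<bar> = c (Suc n) * \<bar>h n\<bar>"
      using c0[of "Suc n"] by (simp add: abs_mult)
    also have "\<dots> \<le> c (Suc n) * (D ^ Suc n * B)"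
    proof (intro mult_left_mono c0)
      have "D ^ n \<le> D ^ Suc n" using D by simp
      then show "\<bar>h n\<bar> \<le> D ^ Suc n * B"
        using h[of n] B by (meson mult_right_mono order_trans)
    qed
    finally show ?thesis by simp
  qed
  show s1: "summable (\<lambda>n. \<bar>T ^ n / fact n * h n\<bar>)"
    unfolding c by (rule summable_comparison_test'[OF sums_summable[OF S]]) (use 1 in simp)
  show s2: "summable (\<lambda>n. \<bar>T ^ Suc n / fact (Suc n) * h n\<bar>)"
    unfolding c by (rule summable_comparison_test'[OF sums_summable[OF S']]) (use 2 in simp)
  show "\<bar>\<Sum>n. T ^ n / fact n * h n\<bar> \<le> exp (D * T) * B"
    using summable_rabs[OF s1] suminf_le[OF 1 s1[unfolded c] sums_summable[OF S]] sums_unique[OF S]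
    unfolding c by linarith
  show 3: "(\<Sum>n. \<bar>T ^ Suc n / fact (Suc n) * h n\<bar>) \<le> exp (D * T) * B"
    using suminf_le[OF 2 s2[unfolded c] sums_summable[OF S']] sums_unique[OF S'] B
    unfolding c by linarith
  show "\<bar>\<Sum>n. T ^ Suc n / fact (Suc n) * h n\<bar> \<le> exp (D * T) * B"
    using summable_rabs[OF s2] 3 by linarith
qed

text \<open>An approximate solution of the Poisson equation: formally
  \<open>\<integral>\<^sub>0\<^sup>T exp (s q) f ds\<close>, so that applying \<open>q\<close> gives \<open>exp (T q) f - f\<close>. Writing it as a power
  series makes this identity a shift of the summation index.\<close>

definition poisson :: "nat set \<Rightarrow> (nat \<Rightarrow> nat \<Rightarrow> real) \<Rightarrow> real \<Rightarrow> (nat \<Rightarrow> real) \<Rightarrow> nat \<Rightarrow> real" where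
  "poisson S q T f i = (\<Sum>n. T ^ Suc n / fact (Suc n) * (kapply S q ^^ n) f i)"

lemma poisson_bound:
  assumes "row_bounded S q C" "1 \<le> C" "0 \<le> T" "\<And>j. j \<in> S \<Longrightarrow> \<bar>f j\<bar> \<le> B" "i \<in> S"
  shows "\<bar>poisson S q T f i\<bar> \<le> exp (C * T) * B"
  unfolding poisson_def
  using kapply_iter_bound[OF assms(1,4,5)] assms(2,3) by (intro exp_series_bound(5))

lemma kapply_poisson:
  assumes q: "row_bounded S q C" and C: "1 \<le> C" and T: "0 \<le> T"
    and f: "\<And>j. j \<in> S \<Longrightarrow> \<bar>f j\<bar> \<le> B" and i: "i \<in> S"
  shows "kapply S q (poisson S q T f) i = kapply S (ctmc_semigroup S q T) f i - f i"
proof -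
  define c :: "nat \<Rightarrow> real" where "c = (\<lambda>n. T ^ n / fact n)"
  have c: "T ^ n / fact n = c n" for n by (simp add: c_def)
  let ?h = "\<lambda>n. (kapply S q ^^ n) f"
  have hb: "\<bar>?h n j\<bar> \<le> C ^ n * B" if "j \<in> S" for n j
    using kapply_iter_bound[OF q f that] .
  note bd = exp_series_bound[OF hb C T, unfolded c]
  let ?F = "\<lambda>j n. q i j * (c (Suc n) * ?h n j)"
  have F: "?F j abs_summable_on UNIV" "(\<Sum>\<^sub>\<infinity>n. \<bar>?F j n\<bar>) \<le> \<bar>q i j\<bar> * (exp (C * T) * B)" if j: "j \<in> S" for j
  proof -
    have 1: "(\<lambda>n. norm (c (Suc n) * ?h n j)) summable_on UNIV"
      using bd(3)[OF j] by (simp add: summable_on_UNIV_nonneg_real_iff)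
    then have "(\<lambda>n. norm (q i j) * norm (c (Suc n) * ?h n j)) summable_on UNIV"
      by (rule summable_on_cmult_right)
    then show "?F j abs_summable_on UNIV" by (simp only: norm_mult)
    have "(\<Sum>\<^sub>\<infinity>n. \<bar>?F j n\<bar>) = \<bar>q i j\<bar> * (\<Sum>\<^sub>\<infinity>n. \<bar>c (Suc n) * ?h n j\<bar>)"
      by (subst abs_mult) (rule infsum_cmult_right')
    also have "(\<Sum>\<^sub>\<infinity>n. \<bar>c (Suc n) * ?h n j\<bar>) = (\<Sum>n. \<bar>c (Suc n) * ?h n j\<bar>)"
      using bd(3)[OF j] by (intro suminf_eq_infsum[symmetric]) simp
    finally show "(\<Sum>\<^sub>\<infinity>n. \<bar>?F j n\<bar>) \<le> \<bar>q i j\<bar> * (exp (C * T) * B)"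
      using bd(4)[OF j] by (simp add: mult_left_mono)
  qed
  have u: "(\<lambda>j. \<bar>q i j\<bar> * (exp (C * T) * B)) summable_on S"
    using row_boundedD(1)[OF q i] by (intro summable_on_cmult_left) simp
  note dbl = double_infsum_swap[of S ?F UNIV, OF F u]
  have "kapply S q (poisson S q T f) i = (\<Sum>\<^sub>\<infinity>j\<in>S. \<Sum>\<^sub>\<infinity>n. ?F j n)"
    unfolding kapply_def[of S q "poisson S q T f"] poisson_def c
  proof (intro infsum_cong)
    fix j assume j: "j \<in> S"
    show "q i j * (\<Sum>n. c (Suc n) * ?h n j) = (\<Sum>\<^sub>\<infinity>n. ?F j n)"
      using bd(3)[OF j] by (simp add: infsum_cmult_right' suminf_eq_infsum)
  qed
  also have "\<dots> = (\<Sum>\<^sub>\<infinity>n. \<Sum>\<^sub>\<infinity>j\<in>S. ?F j n)" by (rule dbl(5))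
  also have "\<dots> = (\<Sum>n. \<Sum>\<^sub>\<infinity>j\<in>S. ?F j n)"
    using summable_on_imp_summable[OF dbl(3)] by (intro suminf_eq_infsum[symmetric]) simp
  also have "(\<lambda>n. \<Sum>\<^sub>\<infinity>j\<in>S. ?F j n) = (\<lambda>n. c (Suc n) * ?h (Suc n) i)"
  proof
    fix n
    have "(\<Sum>\<^sub>\<infinity>j\<in>S. ?F j n) = (\<Sum>\<^sub>\<infinity>j\<in>S. c (Suc n) * (q i j * ?h n j))"
      by (intro infsum_cong) simp
    then show "(\<Sum>\<^sub>\<infinity>j\<in>S. ?F j n) = c (Suc n) * ?h (Suc n) i"
      by (simp add: infsum_cmult_right' kapply_def)
  qed
  \<comment> \<open>Only the term with n = 0 separates this sum from the exponential series, and
    that term is \<open>f i\<close>.\<close>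
  also have "(\<Sum>n. c (Suc n) * ?h (Suc n) i) = (\<Sum>n. c n * ?h n i) - f i"
    using suminf_split_head[OF summable_rabs_cancel[OF bd(1)[OF i]]] by (simp add: c_def)
  also have "(\<Sum>n. c n * ?h n i) = kapply S (ctmc_semigroup S q T) f i"
    using semigroup_kernel(2)[OF q T f i] by (simp add: c_def)
  finally show ?thesis .
qed

text \<open>One step splits as \<open>q\<close> applied to the previous difference plus
  \<open>q - q'\<close> applied to the iterate of \<open>q'\<close>. The exact recursion would yield
  a term of the form n C^(n-1) K B; the base 2 C absorbs the factor n and keeps the bound geometric,
  and it is the source of \<open>exp (2 * C * T)\<close> in all later constants.\<close>

lemma kapply_iter_perturb:
  assumes q: "row_bounded S q C" and q': "row_bounded S q' C" and C: "1 \<le> C"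
    and f: "\<And>j. j \<in> S \<Longrightarrow> \<bar>f j\<bar> \<le> B" and f': "\<And>j. j \<in> S \<Longrightarrow> \<bar>f' j\<bar> \<le> B"
    and dq: "row_bounded S (\<lambda>i j. q i j - q' i j) K"
    and df: "\<And>j. j \<in> S \<Longrightarrow> \<bar>f j - f' j\<bar> \<le> L" and "i \<in> S"
  shows "\<bar>(kapply S q ^^ n) f i - (kapply S q' ^^ n) f' i\<bar> \<le> (2 * C) ^ n * (L + K * B)"
  using \<open>i \<in> S\<close>
proof (induction n arbitrary: i)
  case 0
  have "0 \<le> K" "0 \<le> B" using row_boundedD(3)[OF dq 0] f[OF 0] by auto
  then have "0 \<le> K * B" by simp
  then show ?case using df[OF 0] by simp
next
  case (Suc n)
  note i = Suc.prems
  have K: "0 \<le> K" "0 \<le> B" "0 \<le> L" using row_boundedD(3)[OF dq i] f[OF i] df[OF i] by auto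
  let ?h = "(kapply S q ^^ n) f" and ?h' = "(kapply S q' ^^ n) f'"
  have hb: "\<bar>?h j\<bar> \<le> C ^ n * B" if "j \<in> S" for j by (rule kapply_iter_bound[OF q f that])
  have hb': "\<bar>?h' j\<bar> \<le> C ^ n * B" if "j \<in> S" for j by (rule kapply_iter_bound[OF q' f' that])
  have "kapply S q ?h i - kapply S q' ?h' i
      = kapply S q (\<lambda>j. ?h j - ?h' j) i + kapply S (\<lambda>i j. q i j - q' i j) ?h' i"
    using kapply_diff[OF q i hb hb'] kapply_diff_kernel[OF q q' i hb'] by simp
  also have "\<bar>\<dots>\<bar> \<le> C * ((2 * C) ^ n * (L + K * B)) + K * (C ^ n * B)"
    by (intro order_trans[OF abs_triangle_ineq] add_mono kapply_bound[OF q i Suc.IH] kapply_bound[OF dq i hb'])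
  \<comment> \<open>The new perturbation is dominated by a second copy of the inherited one, which
    doubles the base.\<close>
  also have "K * (C ^ n * B) \<le> C * ((2 * C) ^ n * (L + K * B))"
  proof -
    have "C ^ n \<le> C * (2 * C) ^ n"
    proof -
      have "C ^ n \<le> (2 * C) ^ n" using C by (intro power_mono) auto
      also have "\<dots> \<le> C * (2 * C) ^ n" using C mult_right_mono[of 1 C "(2 * C) ^ n"] by simp
      finally show ?thesis .
    qed
    then have "C ^ n * (K * B) \<le> C * (2 * C) ^ n * (L + K * B)"
      using K C by (intro mult_mono) auto
    then show ?thesis by (simp add: mult_ac)
  qed
  finally show ?case by (simp add: algebra_simps)
qed

lemma poisson_perturb:
  assumes "row_bounded S q C" "row_bounded S q' C" "1 \<le> C" "0 \<le> T"
    and "\<And>j. j \<in> S \<Longrightarrow> \<bar>f j\<bar> \<le> B" "\<And>j. j \<in> S \<Longrightarrow> \<bar>f' j\<bar> \<le> B"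
    and "row_bounded S (\<lambda>i j. q i j - q' i j) K"
    and "\<And>j. j \<in> S \<Longrightarrow> \<bar>f j - f' j\<bar> \<le> L" and i: "i \<in> S"
  shows "\<bar>poisson S q T f i - poisson S q' T f' i\<bar> \<le> exp (2 * C * T) * (L + K * B)"
proof -
  have hb: "\<bar>(kapply S q ^^ n) f i\<bar> \<le> C ^ n * B" for n by (rule kapply_iter_bound[OF assms(1,5) i])
  have hb': "\<bar>(kapply S q' ^^ n) f' i\<bar> \<le> C ^ n * B" for n by (rule kapply_iter_bound[OF assms(2,6) i])
  have "poisson S q T f i - poisson S q' T f' i =
      (\<Sum>n. T ^ Suc n / fact (Suc n) * ((kapply S q ^^ n) f i - (kapply S q' ^^ n) f' i))"
    unfolding poisson_def right_diff_distrib
    by (intro suminf_diff summable_rabs_cancel[OF exp_series_bound(3)[OF hb assms(3,4)]]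
        summable_rabs_cancel[OF exp_series_bound(3)[OF hb' assms(3,4)]])
  also have "\<bar>\<dots>\<bar> \<le> exp (2 * C * T) * (L + K * B)"
    using kapply_iter_perturb[OF assms(1,2,3,5-8) i] assms(3,4)
    by (intro exp_series_bound(5)) auto
  finally show ?thesis .
qed

lemma semigroup_perturb:
  assumes "row_bounded S q C" "row_bounded S q' C" "1 \<le> C" "0 \<le> T"
    and f: "\<And>j. j \<in> S \<Longrightarrow> \<bar>f j\<bar> \<le> B"
    and "row_bounded S (\<lambda>i j. q i j - q' i j) K" and i: "i \<in> S"
  shows "\<bar>kapply S (ctmc_semigroup S q T) f i - kapply S (ctmc_semigroup S q' T) f i\<bar>
    \<le> exp (2 * C * T) * (K * B)"
proof -
  have hb: "\<bar>(kapply S q ^^ n) f i\<bar> \<le> C ^ n * B" for n by (rule kapply_iter_bound[OF assms(1) f i])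
  have hb': "\<bar>(kapply S q' ^^ n) f i\<bar> \<le> C ^ n * B" for n by (rule kapply_iter_bound[OF assms(2) f i])
  have e: "kapply S (ctmc_semigroup S q T) f i = (\<Sum>n. T ^ n / fact n * (kapply S q ^^ n) f i)"
    by (rule semigroup_kernel(2)[OF assms(1,4) f i])
  have e': "kapply S (ctmc_semigroup S q' T) f i = (\<Sum>n. T ^ n / fact n * (kapply S q' ^^ n) f i)"
    by (rule semigroup_kernel(2)[OF assms(2,4) f i])
  have "kapply S (ctmc_semigroup S q T) f i - kapply S (ctmc_semigroup S q' T) f i =
      (\<Sum>n. T ^ n / fact n * ((kapply S q ^^ n) f i - (kapply S q' ^^ n) f i))"
    unfolding right_diff_distrib e e'
    by (intro suminf_diff summable_rabs_cancel[OF exp_series_bound(1)[OF hb assms(3,4)]]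
        summable_rabs_cancel[OF exp_series_bound(1)[OF hb' assms(3,4)]])
  also have "\<bar>\<dots>\<bar> \<le> exp (2 * C * T) * (0 + K * B)"
    using kapply_iter_perturb[OF assms(1,2,3) f f assms(6) _ i, where L = 0] assms(3,4)
    by (intro exp_series_bound(2)) auto
  finally show ?thesis by simp
qed

text \<open>Invariance is assumed for single states; integrating it against a bounded
  \<open>f\<close> requires exchanging the sums over the initial and the final state.\<close>

lemma invariant_prob_kapply:
  assumes q: "row_bounded S q C" and T: "0 \<le> T" and p: "invariant_prob S q p"
    and f: "\<And>j. j \<in> S \<Longrightarrow> \<bar>f j\<bar> \<le> B"
  shows "(\<Sum>\<^sub>\<infinity>i\<in>S. p i * kapply S (ctmc_semigroup S q T) f i) = (\<Sum>\<^sub>\<infinity>j\<in>S. p j * f j)"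
proof -
  note P = semigroup_kernel(1)[OF q T]
  let ?P = "ctmc_semigroup S q T"
  let ?F = "\<lambda>i j. p i * (?P i j * f j)"
  have p0: "\<bar>p i\<bar> = p i" if "i \<in> S" for i using p that by (simp add: invariant_prob_def)
  have F: "?F i abs_summable_on S" "(\<Sum>\<^sub>\<infinity>j\<in>S. \<bar>?F i j\<bar>) \<le> p i * (exp (C * T) * B)" if i: "i \<in> S" for i
  proof -
    have "(\<lambda>j. norm (p i) * norm (?P i j * f j)) summable_on S"
      by (intro summable_on_cmult_right kapply_summable[OF P i f])
    then show "?F i abs_summable_on S" by (simp only: norm_mult)
    have "0 \<le> B" using f[OF i] by linarith
    then have "(\<Sum>\<^sub>\<infinity>j\<in>S. \<bar>?P i j * f j\<bar>) \<le> exp (C * T) * B"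
      using wsum_bound(2)[OF row_boundedD(1)[OF P i] f] row_boundedD(2)[OF P i]
      by (meson mult_right_mono order_trans)
    then have "p i * (\<Sum>\<^sub>\<infinity>j\<in>S. \<bar>?P i j * f j\<bar>) \<le> p i * (exp (C * T) * B)"
      using p i by (intro mult_left_mono) (auto simp: invariant_prob_def)
    then show "(\<Sum>\<^sub>\<infinity>j\<in>S. \<bar>?F i j\<bar>) \<le> p i * (exp (C * T) * B)"
      by (subst abs_mult) (simp only: infsum_cmult_right' p0[OF i])
  qed
  have u: "(\<lambda>i. p i * (exp (C * T) * B)) summable_on S"
    using p by (intro summable_on_cmult_left) (auto simp: invariant_prob_def has_sum_iff)
  have "(\<Sum>\<^sub>\<infinity>i\<in>S. p i * kapply S ?P f i) = (\<Sum>\<^sub>\<infinity>i\<in>S. \<Sum>\<^sub>\<infinity>j\<in>S. ?F i j)"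
    by (simp only: kapply_def infsum_cmult_right')
  also have "\<dots> = (\<Sum>\<^sub>\<infinity>j\<in>S. \<Sum>\<^sub>\<infinity>i\<in>S. ?F i j)" by (rule double_infsum_swap(5)[OF F u])
  also have "\<dots> = (\<Sum>\<^sub>\<infinity>j\<in>S. p j * f j)"
  proof (intro infsum_cong)
    fix j assume j: "j \<in> S"
    have "(\<Sum>\<^sub>\<infinity>i\<in>S. ?F i j) = (\<Sum>\<^sub>\<infinity>i\<in>S. p i * ?P i j) * f j"
      by (simp only: infsum_cmult_left' flip: mult.assoc)
    then show "(\<Sum>\<^sub>\<infinity>i\<in>S. ?F i j) = p j * f j"
      using p T j by (simp add: invariant_prob_def)
  qed
  finally show ?thesis .
qed

lemma wsum_diff:
  fixes w v f g :: "nat \<Rightarrow> real"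
  assumes "w abs_summable_on S" "v abs_summable_on S"
    and "\<And>j. j \<in> S \<Longrightarrow> \<bar>f j\<bar> \<le> B" "\<And>j. j \<in> S \<Longrightarrow> \<bar>g j\<bar> \<le> B'"
  shows "(\<Sum>\<^sub>\<infinity>j\<in>S. w j * f j) - (\<Sum>\<^sub>\<infinity>j\<in>S. v j * g j) =
    (\<Sum>\<^sub>\<infinity>j\<in>S. w j * (f j - g j)) + (\<Sum>\<^sub>\<infinity>j\<in>S. (w j - v j) * g j)"
proof -
  note s = wsum_bound(1)[THEN abs_summable_summable]
  have 1: "(\<Sum>\<^sub>\<infinity>j\<in>S. w j * (f j - g j)) = (\<Sum>\<^sub>\<infinity>j\<in>S. w j * f j) - (\<Sum>\<^sub>\<infinity>j\<in>S. w j * g j)"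
    unfolding right_diff_distrib by (intro infsum_minus s[OF assms(1,3)] s[OF assms(1,4)])
  have 2: "(\<Sum>\<^sub>\<infinity>j\<in>S. (w j - v j) * g j) = (\<Sum>\<^sub>\<infinity>j\<in>S. w j * g j) - (\<Sum>\<^sub>\<infinity>j\<in>S. v j * g j)"
    unfolding left_diff_distrib by (intro infsum_minus s[OF assms(1,4)] s[OF assms(2,4)])
  show ?thesis unfolding 1 2 by simp
qed

lemma abs_summable_diff:
  fixes w v :: "nat \<Rightarrow> real"
  assumes "w abs_summable_on S" "v abs_summable_on S"
  shows "(\<lambda>j. w j - v j) abs_summable_on S"
proof (rule Infinite_Sum.abs_summable_on_comparison_test')
  show "(\<lambda>j. norm (w j) + norm (v j)) summable_on S" using assms by (intro summable_on_add)
qed (rule norm_triangle_ineq4)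

text \<open>With R the variation distance and \<open>f\<close> the sign of \<open>p - p'\<close>,
  invariance gives R = p P f - p' P' f = p (P f - P' f) + (p - p') P' f. The first term is a
  perturbation of the semigroup. In the second, \<open>p - p'\<close> has mass zero, so P' f may be
  recentred at its mean m under \<open>p'\<close>, from which it differs by at most 1/2. Hence R is
  at most \<open>exp (2 * C * T) * K\<close> plus R/2, and solving for R produces the factor
  2.\<close>

lemma invariant_prob_perturb:
  assumes q: "row_bounded S q C" and q': "row_bounded S q' C" and C: "1 \<le> C" and T: "0 \<le> T"
    and dq: "row_bounded S (\<lambda>i j. q i j - q' i j) K"
    and p: "invariant_prob S q p" and p': "invariant_prob S q' p'"
    and erg: "\<And>i. i \<in> S \<Longrightarrow> (\<Sum>\<^sub>\<infinity>j\<in>S. \<bar>ctmc_semigroup S q' T i j - p' j\<bar>) \<le> 1/2"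
    and ne: "S \<noteq> {}"
  shows "(\<Sum>\<^sub>\<infinity>j\<in>S. \<bar>p j - p' j\<bar>) \<le> 2 * exp (2 * C * T) * K"
proof -
  let ?P = "ctmc_semigroup S q T" and ?P' = "ctmc_semigroup S q' T"
  define f where "f j = sgn (p j - p' j)" for j
  have f: "\<bar>f j\<bar> \<le> 1" for j by (simp add: f_def sgn_if)
  have ps: "p summable_on S" "p' summable_on S" "infsum p S = 1" "infsum p' S = 1"
    using p p' by (auto simp: invariant_prob_def has_sum_iff)
  have pn: "\<And>j. j \<in> S \<Longrightarrow> norm (p j) = p j" "\<And>j. j \<in> S \<Longrightarrow> norm (p' j) = p' j"
    using p p' by (auto simp: invariant_prob_def)
  have pa: "p abs_summable_on S" "p' abs_summable_on S"
    using ps pn by (auto cong: summable_on_cong)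
  note dpa = abs_summable_diff[OF pa]
  note P = semigroup_kernel(1)[OF q T] and P' = semigroup_kernel(1)[OF q' T]
  define R where "R = (\<Sum>\<^sub>\<infinity>j\<in>S. \<bar>p j - p' j\<bar>)"
  define m where "m = (\<Sum>\<^sub>\<infinity>j\<in>S. p' j * f j)"
  define g where "g i = kapply S ?P' f i" for i
  have gb: "\<bar>g i\<bar> \<le> exp (C * T) * 1" if "i \<in> S" for i
    unfolding g_def by (rule kapply_bound[OF P' that f])
  have gm: "\<bar>g i - m\<bar> \<le> 1/2" if i: "i \<in> S" for i
  proof -
    have a: "(\<lambda>j. ?P' i j - p' j) abs_summable_on S"
      by (rule abs_summable_diff[OF row_boundedD(1)[OF P' i] pa(2)])
    have "g i - m = (\<Sum>\<^sub>\<infinity>j\<in>S. (?P' i j - p' j) * f j)"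
      unfolding g_def m_def kapply_def
      using wsum_diff[OF row_boundedD(1)[OF P' i] pa(2) f f] by simp
    also have "\<bar>\<dots>\<bar> \<le> 1/2"
      using wsum_bound(3)[of _ S f 1, OF a f] erg[OF i] by simp
    finally show ?thesis .
  qed
  have R: "R = (\<Sum>\<^sub>\<infinity>j\<in>S. p j * f j) - (\<Sum>\<^sub>\<infinity>j\<in>S. p' j * f j)"
  proof -
    have "\<bar>p j - p' j\<bar> = (p j - p' j) * f j" for j
      by (simp add: f_def abs_sgn)
    then show ?thesis
      unfolding R_def using wsum_diff[OF pa f f] by simp
  qed
  also have "\<dots> = (\<Sum>\<^sub>\<infinity>j\<in>S. p j * kapply S ?P f j) - (\<Sum>\<^sub>\<infinity>j\<in>S. p' j * g j)"
    unfolding g_def invariant_prob_kapply[OF q T p f] invariant_prob_kapply[OF q' T p' f] ..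
  also have "\<dots> = (\<Sum>\<^sub>\<infinity>j\<in>S. p j * (kapply S ?P f j - g j)) + (\<Sum>\<^sub>\<infinity>j\<in>S. (p j - p' j) * g j)"
    by (rule wsum_diff[OF pa kapply_bound[OF P _ f] gb])
  \<comment> \<open>Both vectors have total mass one, so subtracting the constant \<open>m\<close>
    from \<open>g\<close> changes nothing.\<close>
  also have "(\<Sum>\<^sub>\<infinity>j\<in>S. (p j - p' j) * g j) = (\<Sum>\<^sub>\<infinity>j\<in>S. (p j - p' j) * (g j - m))"
  proof -
    have s: "(\<lambda>j. (p j - p' j) * g j) summable_on S"
      by (rule abs_summable_summable[OF wsum_bound(1)[OF dpa gb]])
    have s': "(\<lambda>j. (p j - p' j) * m) summable_on S"
      by (rule abs_summable_summable[OF wsum_bound(1)[OF dpa order_refl]])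
    have "(\<Sum>\<^sub>\<infinity>j\<in>S. (p j - p' j) * m) = 0"
      using infsum_minus[OF ps(1,2)] ps(3,4) by (simp add: infsum_cmult_left')
    then show ?thesis
      using infsum_minus[OF s s'] by (simp add: right_diff_distrib)
  qed
  also have "\<dots> \<le> R * (1/2)"
    unfolding R_def by (rule order_trans[OF abs_ge_self wsum_bound(3)[OF dpa gm]])
  also have "(\<Sum>\<^sub>\<infinity>j\<in>S. p j * (kapply S ?P f j - g j)) \<le> exp (2 * C * T) * K"
  proof -
    have "\<bar>kapply S ?P f j - g j\<bar> \<le> exp (2 * C * T) * (K * 1)" if "j \<in> S" for j
      unfolding g_def by (rule semigroup_perturb[OF q q' C T f dq that])
    from wsum_bound(3)[OF pa(1) this]
    have "\<bar>\<Sum>\<^sub>\<infinity>j\<in>S. p j * (kapply S ?P f j - g j)\<bar> \<le> (\<Sum>\<^sub>\<infinity>j\<in>S. \<bar>p j\<bar>) * (exp (2 * C * T) * (K * 1))" .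
    moreover have "(\<Sum>\<^sub>\<infinity>j\<in>S. \<bar>p j\<bar>) = 1"
      using ps pn by (auto cong: infsum_cong)
    ultimately show ?thesis by simp
  qed
  finally show ?thesis unfolding R_def by simp
qed

section \<open>Time integrals of bounded processes\<close>

text \<open>Processes are controlled at nonnegative times only. Clamping the time by
  \<open>max 0\<close> extends them to the whole line, so that the ordinary product with the Borel
  sigma-algebra can be used.\<close>

definition jointly_measurable :: "'a measure \<Rightarrow> (real \<Rightarrow> 'a \<Rightarrow> 'b::topological_space) \<Rightarrow> bool" where
  "jointly_measurable M h \<longleftrightarrow> (\<lambda>(r, \<omega>). h (max 0 r) \<omega>) \<in> borel_measurable (borel \<Otimes>\<^sub>M M)"

text \<open>The process is the pointwise limit of processes that are constant in time on each cell
  of a grid of width \<open>1 / Suc n\<close>, each evaluated at the right end of its cell.\<close>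

lemma jointly_measurable_right_continuous:
  fixes h :: "real \<Rightarrow> 'a \<Rightarrow> 'b::metric_space"
  assumes h: "\<And>r. 0 \<le> r \<Longrightarrow> h r \<in> borel_measurable M"
    and lim: "\<And>r \<omega>. 0 \<le> r \<Longrightarrow> \<omega> \<in> space M \<Longrightarrow> ((\<lambda>u. h u \<omega>) \<longlongrightarrow> h r \<omega>) (at_right r)"
  shows "jointly_measurable M h"
  unfolding jointly_measurable_def
proof (rule borel_measurable_LIMSEQ_metric)
  fix n :: nat
  \<comment> \<open>The value is taken at \<open>Suc (?g p) / Suc n\<close>, strictly to the right
    of the current time, because only a limit along \<open>at_right\<close> is assumed.\<close>
  let ?g = "\<lambda>p. nat \<lfloor>real (Suc n) * max 0 (fst p)\<rfloor>"
  have "(\<lambda>p. h (real (Suc (?g p)) / real (Suc n)) (snd p)) \<in> borel_measurable (borel \<Otimes>\<^sub>M M)"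
  proof (rule measurable_compose_countable[where g="?g"])
    fix i :: nat
    have [measurable]: "h (real (Suc i) / real (Suc n)) \<in> borel_measurable M" by (rule h) simp
    show "(\<lambda>p. h (real (Suc i) / real (Suc n)) (snd p)) \<in> borel_measurable (borel \<Otimes>\<^sub>M M)"
      by measurable
  qed measurable
  then show "(\<lambda>p. h (real (Suc (?g p)) / real (Suc n)) (snd p)) \<in> borel_measurable (borel \<Otimes>\<^sub>M M)" .
next
  fix p assume p: "p \<in> space ((borel :: real measure) \<Otimes>\<^sub>M M)"
  obtain r \<omega> where p': "p = (r, \<omega>)" by (cases p)
  then have \<omega>: "\<omega> \<in> space M" using p by (simp add: space_pair_measure)
  define s where "s = max 0 r"
  have s: "0 \<le> s" by (simp add: s_def)
  define a where "a n = real (Suc (nat \<lfloor>real (Suc n) * s\<rfloor>)) / real (Suc n)" for n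
  have a: "s < a n" "a n \<le> s + 1 / real (Suc n)" for n
  proof -
    have *: "real (nat \<lfloor>real (Suc n) * s\<rfloor>) = of_int \<lfloor>real (Suc n) * s\<rfloor>"
      using s by (simp add: of_nat_nat)
    have "real (Suc n) * s < real (Suc (nat \<lfloor>real (Suc n) * s\<rfloor>))"
      using * by linarith
    then show "s < a n" unfolding a_def by (simp add: field_simps)
    have "real (Suc (nat \<lfloor>real (Suc n) * s\<rfloor>)) \<le> real (Suc n) * s + 1"
      using * by linarith
    then have "a n \<le> (real (Suc n) * s + 1) / real (Suc n)"
      unfolding a_def by (intro divide_right_mono) auto
    also have "\<dots> = s + 1 / real (Suc n)" by (simp add: field_simps)
    finally show "a n \<le> s + 1 / real (Suc n)" .
  qed
  have "a \<longlonglongrightarrow> s"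
  proof (rule tendsto_sandwich[of "\<lambda>_. s" _ _ "\<lambda>n. s + 1 / real (Suc n)"])
    show "(\<lambda>n. s + 1 / real (Suc n)) \<longlonglongrightarrow> s"
      using tendsto_add[OF tendsto_const LIMSEQ_inverse_real_of_nat, of s] by (simp add: inverse_eq_divide)
  qed (use a in \<open>auto intro!: always_eventually less_imp_le\<close>)
  then have "filterlim a (at_right s) sequentially"
    using a by (auto simp: filterlim_at less_imp_neq[THEN not_sym] intro!: always_eventually)
  from filterlim_compose[OF lim[OF s \<omega>] this]
  show "(\<lambda>n. h (real (Suc (nat \<lfloor>real (Suc n) * max 0 (fst p)\<rfloor>)) / real (Suc n)) (snd p))
      \<longlonglongrightarrow> (case p of (r, \<omega>) \<Rightarrow> h (max 0 r) \<omega>)"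
    by (simp add: p' s_def a_def)
qed

lemma set_integrable_path:
  fixes h :: "real \<Rightarrow> 'a \<Rightarrow> 'b::euclidean_space"
  assumes jm: "jointly_measurable M h"
    and B: "\<And>r. 0 \<le> r \<Longrightarrow> norm (h r \<omega>) \<le> B" and \<omega>: "\<omega> \<in> space M" and u: "0 \<le> u"
  shows "set_integrable lborel {u..s} (\<lambda>r. h r \<omega>)"
proof -
  have [measurable]: "(\<lambda>r. h (max 0 r) \<omega>) \<in> borel_measurable borel"
    using measurable_compose[OF measurable_Pair2'[OF \<omega>] jm[unfolded jointly_measurable_def]]
    by (simp add: comp_def)
  have "set_integrable lborel {u..s} (\<lambda>r. h (max 0 r) \<omega>)"
    unfolding set_integrable_def
    by (rule integrableI_bounded_set_indicator[where B=B]) (use B u in \<open>auto simp: emeasure_lborel_Icc_eq\<close>)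
  then show ?thesis
    unfolding set_integrable_def using u
    by (subst Bochner_Integration.integrable_cong[OF refl, of _ _ "\<lambda>r. indicator {u..s} r *\<^sub>R h (max 0 r) \<omega>"])
      (auto simp: indicator_def)
qed

text \<open>The bridge between the gauge integral in the equation of the solution and the Lebesgue
  integral that Fubini's theorem handles; bounded measurable paths make the two agree.\<close>

lemma path_integral:
  fixes h :: "real \<Rightarrow> 'a \<Rightarrow> 'b::euclidean_space"
  assumes "jointly_measurable M h"
    and "\<And>r. 0 \<le> r \<Longrightarrow> norm (h r \<omega>) \<le> B" and "\<omega> \<in> space M" and u: "0 \<le> u"
  shows "(\<lambda>r. h r \<omega>) integrable_on {u..s}"
    and "integral {u..s} (\<lambda>r. h r \<omega>) = (\<integral>r. indicator {u..s} r *\<^sub>R h (max 0 r) \<omega> \<partial>lborel)"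
    and "u \<le> s \<Longrightarrow> norm (integral {u..s} (\<lambda>r. h r \<omega>)) \<le> B * (s - u)"
proof -
  note si = set_borel_integral_eq_integral[OF set_integrable_path[OF assms, of s]]
  show 1: "(\<lambda>r. h r \<omega>) integrable_on {u..s}" by (rule si(1))
  show "integral {u..s} (\<lambda>r. h r \<omega>) = (\<integral>r. indicator {u..s} r *\<^sub>R h (max 0 r) \<omega> \<partial>lborel)"
    using si(2) u unfolding set_lebesgue_integral_def
    by (subst Bochner_Integration.integral_cong[OF refl, of _ _ "\<lambda>r. indicator {u..s} r *\<^sub>R h r \<omega>"])
      (auto simp: indicator_def)
  show "norm (integral {u..s} (\<lambda>r. h r \<omega>)) \<le> B * (s - u)" if "u \<le> s"
    using has_integral_bound[OF _ integrable_integral[OF 1[unfolded cbox_interval[symmetric]]], of B]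
      assms(2) u that order_trans[OF norm_ge_zero assms(2)[of 0]]
    by simp
qed

context prob_space begin

lemma expectation_path:
  fixes h :: "real \<Rightarrow> 'a \<Rightarrow> real"
  assumes jm: "jointly_measurable M h"
    and B: "\<And>r \<omega>. 0 \<le> r \<Longrightarrow> \<omega> \<in> space M \<Longrightarrow> \<bar>h r \<omega>\<bar> \<le> B" and u: "0 \<le> u" and "u \<le> s"
  shows "integrable M (\<lambda>\<omega>. integral {u..s} (\<lambda>r. h r \<omega>))"
    and "(\<lambda>r. expectation (h r)) integrable_on {u..s}"
    and "expectation (\<lambda>\<omega>. integral {u..s} (\<lambda>r. h r \<omega>)) = integral {u..s} (\<lambda>r. expectation (h r))"
proof -
  interpret P: pair_sigma_finite lborel M ..
  let ?f = "\<lambda>r \<omega>. indicator {u..s} r *\<^sub>R h (max 0 r) \<omega>"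
  have [measurable]: "(\<lambda>(r, \<omega>). h (max 0 r) \<omega>) \<in> borel_measurable (lborel \<Otimes>\<^sub>M M)"
    using jm unfolding jointly_measurable_def by (simp cong: measurable_cong_sets sets_pair_measure_cong)
  have fm: "case_prod ?f \<in> borel_measurable (lborel \<Otimes>\<^sub>M M)"
    by measurable
  have B0: "0 \<le> B"
    using B[of 0] not_empty by (meson abs_ge_zero all_not_in_conv order_refl order_trans)
  have int: "integrable (lborel \<Otimes>\<^sub>M M) (case_prod ?f)"
  proof (rule integrableI_bounded_set[where A="{u..s} \<times> space M" and B=B])
    have "emeasure (lborel \<Otimes>\<^sub>M M) ({u..s} \<times> space M) = emeasure lborel {u..s} * emeasure M (space M)"
      by (rule emeasure_pair_measure_Times) auto
    then show "emeasure (lborel \<Otimes>\<^sub>M M) ({u..s} \<times> space M) < \<infinity>"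
      using \<open>u \<le> s\<close> by (simp add: emeasure_space_1 emeasure_lborel_Icc_eq)
    show "AE x in lborel \<Otimes>\<^sub>M M. x \<in> {u..s} \<times> space M \<longrightarrow> norm (case_prod ?f x) \<le> B"
      using B B0 by (auto simp: indicator_def)
  qed (auto intro!: fm simp: space_pair_measure indicator_def)
  have eq: "integral {u..s} (\<lambda>r. h r \<omega>) = (\<integral>r. ?f r \<omega> \<partial>lborel)" if "\<omega> \<in> space M" for \<omega>
    using path_integral(2)[OF jm _ that u, of B] B[OF _ that] by simp
  show "integrable M (\<lambda>\<omega>. integral {u..s} (\<lambda>r. h r \<omega>))"
    using P.integrable_snd[OF int] by (subst Bochner_Integration.integrable_cong[OF refl eq])
  have E: "indicator {u..s} r *\<^sub>R expectation (h r) = (\<integral>\<omega>. ?f r \<omega> \<partial>M)" for r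
    using u by (auto simp: indicator_def)
  have si: "set_integrable lborel {u..s} (\<lambda>r. expectation (h r))"
    unfolding set_integrable_def E using P.integrable_fst[OF int] .
  show "(\<lambda>r. expectation (h r)) integrable_on {u..s}"
    using set_borel_integral_eq_integral(1)[OF si] .
  have "expectation (\<lambda>\<omega>. integral {u..s} (\<lambda>r. h r \<omega>)) = (\<integral>\<omega>. \<integral>r. ?f r \<omega> \<partial>lborel \<partial>M)"
    using eq by (simp cong: Bochner_Integration.integral_cong)
  also have "\<dots> = (\<integral>r. \<integral>\<omega>. ?f r \<omega> \<partial>M \<partial>lborel)"
    by (rule P.Fubini_integral[OF int])
  also have "\<dots> = (LINT r:{u..s}|lborel. expectation (h r))"
    unfolding set_lebesgue_integral_def E ..
  also have "\<dots> = integral {u..s} (\<lambda>r. expectation (h r))"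
    by (rule set_borel_integral_eq_integral(2)[OF si])
  finally show "expectation (\<lambda>\<omega>. integral {u..s} (\<lambda>r. h r \<omega>)) = integral {u..s} (\<lambda>r. expectation (h r))" .
qed

lemma jointly_measurable_section:
  fixes h :: "real \<Rightarrow> 'a \<Rightarrow> 'b::topological_space"
  assumes "jointly_measurable M h" "0 \<le> r"
  shows "h r \<in> borel_measurable M"
  using measurable_compose[OF measurable_Pair1'[of r borel M] assms(1)[unfolded jointly_measurable_def]] assms(2)
  by (simp add: comp_def)

lemma expectation_abs_path_integral_le:
  fixes h :: "real \<Rightarrow> 'a \<Rightarrow> real"
  assumes jm: "jointly_measurable M h"
    and B: "\<And>r \<omega>. 0 \<le> r \<Longrightarrow> \<omega> \<in> space M \<Longrightarrow> \<bar>h r \<omega>\<bar> \<le> B" and u: "0 \<le> u" and us: "u \<le> s"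
    and c: "\<And>r. u \<le> r \<Longrightarrow> r \<le> s \<Longrightarrow> expectation (\<lambda>\<omega>. \<bar>h r \<omega>\<bar>) \<le> c"
  shows "expectation (\<lambda>\<omega>. \<bar>integral {u..s} (\<lambda>r. h r \<omega>)\<bar>) \<le> c * (s - u)"
proof -
  have jma: "jointly_measurable M (\<lambda>r \<omega>. \<bar>h r \<omega>\<bar>)"
    using jm unfolding jointly_measurable_def case_prod_unfold by measurable
  note a = expectation_path[OF jm B u us]
  note b = expectation_path[OF jma, of B, simplified, OF B u us]
  have "expectation (\<lambda>\<omega>. \<bar>integral {u..s} (\<lambda>r. h r \<omega>)\<bar>) \<le> expectation (\<lambda>\<omega>. integral {u..s} (\<lambda>r. \<bar>h r \<omega>\<bar>))"
  proof (rule integral_mono)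
    fix \<omega> assume \<omega>: "\<omega> \<in> space M"
    have "norm (h r \<omega>) \<le> B" if "0 \<le> r" for r using B[OF that \<omega>] by simp
    note 1 = path_integral(1)[OF jm this \<omega> u, of s] and 2 = path_integral(1)[OF jma _ \<omega> u, of B s]
    show "\<bar>integral {u..s} (\<lambda>r. h r \<omega>)\<bar> \<le> integral {u..s} (\<lambda>r. \<bar>h r \<omega>\<bar>)"
      using integral_norm_bound_integral[OF 1 2] B \<omega> by simp
  qed (use a(1) b(1) in auto)
  also have "\<dots> = integral {u..s} (\<lambda>r. expectation (\<lambda>\<omega>. \<bar>h r \<omega>\<bar>))" by (rule b(3))
  also have "\<dots> \<le> integral {u..s} (\<lambda>r. c)"
    by (rule integral_le[OF b(2)]) (use c in auto)
  also have "\<dots> = c * (s - u)" using us by simp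
  finally show ?thesis .
qed

end

section \<open>Orthogonal increments and stochastic integrals\<close>

context prob_space begin

lemma integrable_mult_square:
  fixes f g :: "'a \<Rightarrow> real"
  assumes [measurable]: "f \<in> borel_measurable M" "g \<in> borel_measurable M"
    and "integrable M (\<lambda>x. (f x)\<^sup>2)" "integrable M (\<lambda>x. (g x)\<^sup>2)"
  shows "integrable M (\<lambda>x. f x * g x)"
proof (rule Bochner_Integration.integrable_bound)
  show "integrable M (\<lambda>x. (f x)\<^sup>2 + (g x)\<^sup>2)" using assms by simp
  have "\<bar>a * b\<bar> \<le> a\<^sup>2 + b\<^sup>2" for a b :: real
  proof -
    have "2 * (\<bar>a\<bar> * \<bar>b\<bar>) \<le> a\<^sup>2 + b\<^sup>2"
      using zero_le_power2[of "\<bar>a\<bar> - \<bar>b\<bar>"] by (simp add: power2_diff mult.assoc)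
    then show ?thesis unfolding abs_mult using mult_nonneg_nonneg[of "\<bar>a\<bar>" "\<bar>b\<bar>"] by linarith
  qed
  then show "AE x in M. norm (f x * g x) \<le> norm ((f x)\<^sup>2 + (g x)\<^sup>2)" by auto
qed measurable

lemma orthogonal_sum_square:
  fixes D :: "nat \<Rightarrow> 'a \<Rightarrow> real"
  assumes meas: "\<And>k. k < n \<Longrightarrow> D k \<in> borel_measurable M"
    and sq: "\<And>k. k < n \<Longrightarrow> integrable M (\<lambda>\<omega>. (D k \<omega>)\<^sup>2)"
    and orth: "\<And>k l. k < l \<Longrightarrow> l < n \<Longrightarrow> expectation (\<lambda>\<omega>. D k \<omega> * D l \<omega>) = 0"
  shows "integrable M (\<lambda>\<omega>. (\<Sum>k<n. D k \<omega>)\<^sup>2)"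
    and "expectation (\<lambda>\<omega>. (\<Sum>k<n. D k \<omega>)\<^sup>2) = (\<Sum>k<n. expectation (\<lambda>\<omega>. (D k \<omega>)\<^sup>2))"
proof -
  have "integrable M (\<lambda>\<omega>. (\<Sum>k<n. D k \<omega>)\<^sup>2) \<and>
    expectation (\<lambda>\<omega>. (\<Sum>k<n. D k \<omega>)\<^sup>2) = (\<Sum>k<n. expectation (\<lambda>\<omega>. (D k \<omega>)\<^sup>2))"
    using assms
  proof (induction n)
    case (Suc n)
    have IH: "integrable M (\<lambda>\<omega>. (\<Sum>k<n. D k \<omega>)\<^sup>2)"
      "expectation (\<lambda>\<omega>. (\<Sum>k<n. D k \<omega>)\<^sup>2) = (\<Sum>k<n. expectation (\<lambda>\<omega>. (D k \<omega>)\<^sup>2))"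
      using Suc.IH Suc.prems by (meson less_SucI)+
    have int: "integrable M (\<lambda>\<omega>. D k \<omega> * D n \<omega>)" if "k < n" for k
      using Suc.prems(1,2) that by (intro integrable_mult_square) auto
    have cross: "expectation (\<lambda>\<omega>. (\<Sum>k<n. D k \<omega>) * D n \<omega>) = 0"
      "integrable M (\<lambda>\<omega>. (\<Sum>k<n. D k \<omega>) * D n \<omega>)"
      using int Suc.prems(3)
      by (auto simp: sum_distrib_right Bochner_Integration.integral_sum intro!: Bochner_Integration.integrable_sum)
    have eq: "(\<Sum>k<Suc n. D k \<omega>)\<^sup>2 =
        (\<Sum>k<n. D k \<omega>)\<^sup>2 + 2 * ((\<Sum>k<n. D k \<omega>) * D n \<omega>) + (D n \<omega>)\<^sup>2" for \<omega>
      by (simp add: power2_sum)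
    show ?case
      unfolding eq using IH cross Suc.prems(2)[of n] by simp
  qed simp
  then show "integrable M (\<lambda>\<omega>. (\<Sum>k<n. D k \<omega>)\<^sup>2)"
    and "expectation (\<lambda>\<omega>. (\<Sum>k<n. D k \<omega>)\<^sup>2) = (\<Sum>k<n. expectation (\<lambda>\<omega>. (D k \<omega>)\<^sup>2))"
    by auto
qed

text \<open>Assumption \<open>0\<close> says that the conditional expectation of \<open>f\<close>
  given \<open>G\<close> vanishes, and \<open>V\<close> is pulled out of it. Only the product has to
  be integrable; \<open>V\<close> may be unbounded, as it is for Brownian increments.\<close>

lemma expectation_mult_eq_0:
  fixes f V :: "'a \<Rightarrow> real"
  assumes G: "subalgebra M G" and f: "integrable M f"
    and 0: "\<And>A. A \<in> sets G \<Longrightarrow> set_lebesgue_integral M A f = 0"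
    and V: "V \<in> borel_measurable G" and Vf: "integrable M (\<lambda>\<omega>. V \<omega> * f \<omega>)"
  shows "expectation (\<lambda>\<omega>. V \<omega> * f \<omega>) = 0"
proof -
  interpret finite_measure_subalgebra M G using G by unfold_locales
  have "AE \<omega> in M. real_cond_exp M G f \<omega> = 0"
    by (rule real_cond_exp_charact) (use f 0 in auto)
  then have "expectation (\<lambda>\<omega>. V \<omega> * real_cond_exp M G f \<omega>) = 0"
    by (intro integral_eq_zero_AE) auto
  then show ?thesis using real_cond_exp_intg(2)[OF Vf V] f by simp
qed

text \<open>Fatou's lemma for convergence in probability. After truncation at R, the event that
  \<open>Z n\<close> and \<open>I\<close> differ by more than \<open>e\<close> costs at most R times
  its probability, which vanishes; then \<open>e\<close> tends to 0, and monotone convergence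
  removes R. The index 0 is left out because the Riemann sums below have a degenerate partition
  there.\<close>

lemma expectation_norm_converges_in_prob_le:
  fixes Z :: "nat \<Rightarrow> 'a \<Rightarrow> 'b::euclidean_space"
  assumes Z: "\<And>n. 0 < n \<Longrightarrow> integrable M (\<lambda>\<omega>. norm (Z n \<omega>))" "\<And>n. 0 < n \<Longrightarrow> expectation (\<lambda>\<omega>. norm (Z n \<omega>)) \<le> C"
    and Zm [measurable]: "\<And>n. Z n \<in> borel_measurable M"
    and conv: "converges_in_prob M Z I" and I [measurable]: "I \<in> borel_measurable M"
  shows "integrable M (\<lambda>\<omega>. norm (I \<omega>))" and "expectation (\<lambda>\<omega>. norm (I \<omega>)) \<le> C"
proof -
  define T where "T R \<omega> = min (norm (I \<omega>)) (real R)" for R \<omega>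
  have [measurable]: "T R \<in> borel_measurable M" for R unfolding T_def by measurable
  have intT: "integrable M (T R)" for R
    by (rule integrable_const_bound[where B="real R"]) (auto simp: T_def)
  have T_le: "expectation (T R) \<le> C" for R
  proof (rule field_le_epsilon)
    fix e :: real assume e: "0 < e"
    let ?A = "\<lambda>n. {\<omega> \<in> space M. dist (Z n \<omega>) (I \<omega>) > e}"
    have le: "expectation (T R) \<le> C + e + real R * measure M (?A n)" if n: "0 < n" for n
    proof -
      have "T R \<omega> \<le> norm (Z n \<omega>) + e + real R * indicator (?A n) \<omega>" if "\<omega> \<in> space M" for \<omega>
      proof (cases "dist (Z n \<omega>) (I \<omega>) > e")
        case True
        have "T R \<omega> \<le> real R" by (simp add: T_def)
        also have "real R = real R * indicator (?A n) \<omega>" using True that by simp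
        also have "\<dots> \<le> norm (Z n \<omega>) + e + real R * indicator (?A n) \<omega>" using e by simp
        finally show ?thesis .
      next
        case False
        then have "norm (I \<omega>) \<le> norm (Z n \<omega>) + e"
          using norm_triangle_ineq2[of "I \<omega>" "Z n \<omega>"] by (simp add: dist_norm norm_minus_commute)
        then show ?thesis using False by (simp add: T_def min_def)
      qed
      then have "expectation (T R) \<le> expectation (\<lambda>\<omega>. norm (Z n \<omega>) + e + real R * indicator (?A n) \<omega>)"
        using Z(1)[OF n] intT by (intro integral_mono) (auto simp: emeasure_eq_measure)
      also have "\<dots> = expectation (\<lambda>\<omega>. norm (Z n \<omega>)) + e + real R * measure M (?A n)"
        using Z(1)[OF n] by (simp add: prob_space emeasure_eq_measure)
      finally show ?thesis using Z(2)[OF n] by linarith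
    qed
    have "(\<lambda>n. C + e + real R * measure M (?A n)) \<longlonglongrightarrow> C + e + real R * 0"
      using conv e unfolding converges_in_prob_def by (intro tendsto_intros) auto
    then show "expectation (T R) \<le> C + e"
      using le by (intro LIMSEQ_le_const[of _ "C + e"]) (auto intro!: exI[of _ 1])
  qed
  have mono: "incseq (\<lambda>R. expectation (T R))"
    by (intro incseq_SucI integral_mono intT) (simp add: T_def)
  obtain L where L: "(\<lambda>R. expectation (T R)) \<longlonglongrightarrow> L" "\<And>R. expectation (T R) \<le> L"
    using incseq_convergent[OF mono, of C] T_le by blast
  have conv: "(\<lambda>R. T R \<omega>) \<longlonglongrightarrow> norm (I \<omega>)" for \<omega>
  proof (rule tendsto_eventually, rule eventually_sequentiallyI)
    fix R assume "nat \<lceil>norm (I \<omega>)\<rceil> \<le> R"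
    then show "T R \<omega> = norm (I \<omega>)" unfolding T_def by linarith
  qed
  have mono': "AE \<omega> in M. mono (\<lambda>R. T R \<omega>)"
    unfolding T_def by (intro AE_I2 monoI min.mono) auto
  have 1: "integrable M (\<lambda>\<omega>. norm (I \<omega>)) \<and> expectation (\<lambda>\<omega>. norm (I \<omega>)) = L"
    using integrable_monotone_convergence[of M T "\<lambda>\<omega>. norm (I \<omega>)" L, OF intT mono' _ L(1)]
      integral_monotone_convergence[of M T "\<lambda>\<omega>. norm (I \<omega>)" L, OF intT mono' _ L(1)] conv
    by auto
  then show "integrable M (\<lambda>\<omega>. norm (I \<omega>))" by simp
  show "expectation (\<lambda>\<omega>. norm (I \<omega>)) \<le> C"
    using 1 LIMSEQ_le_const2[OF L(1), of C] T_le by auto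
qed

end

section \<open>The Gaussian measure and the law of Brownian increments\<close>

definition gauss_density :: "real \<Rightarrow> 'b::euclidean_space \<Rightarrow> real" where
  "gauss_density s v = (2 * pi * s) powr (- real DIM('b) / 2) * exp (- (norm v)\<^sup>2 / (2 * s))"

lemma gauss_density_nonneg: "0 \<le> gauss_density s v"
  by (simp add: gauss_density_def)

lemma gauss_density_measurable [measurable]: "gauss_density s \<in> borel_measurable borel"
  unfolding gauss_density_def by measurable

lemma gauss_measure_eq: "gauss_measure s = density lborel (\<lambda>v. ennreal (gauss_density s v))"
  by (simp add: gauss_measure_def gauss_density_def)

lemma sets_gauss_measure [simp, measurable_cong]: "sets (gauss_measure s) = sets borel"
  by (simp add: gauss_measure_def)

text \<open>Substitute \<open>sqrt s *\<^sub>R v\<close> for \<open>v\<close>. The second moment of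
  the standard Gaussian is carried along as an unevaluated constant, since the estimates use only
  proportionality to \<open>s\<close>.\<close>

lemma gauss_second_moment:
  assumes s: "0 < s"
  shows "(\<integral>v. (norm (v::'b::euclidean_space))\<^sup>2 \<partial>gauss_measure s) = s * (\<integral>v. (norm (v::'b))\<^sup>2 \<partial>gauss_measure 1)"
proof -
  have eq: "(\<integral>v. (norm (v::'b))\<^sup>2 \<partial>gauss_measure s) = (\<integral>v. gauss_density s v * (norm (v::'b))\<^sup>2 \<partial>lborel)" for s
    unfolding gauss_measure_eq
    by (subst integral_density) (auto simp: gauss_density_nonneg)
  let ?d = "DIM('b)"
  have "(\<integral>v. gauss_density s v * (norm (v::'b))\<^sup>2 \<partial>lborel) =
    (\<integral>v. gauss_density s v * (norm (v::'b))\<^sup>2 \<partial>density (distr lborel borel (\<lambda>x. 0 + sqrt s *\<^sub>R x)) (\<lambda>_. ennreal (\<bar>sqrt s\<bar> ^ ?d)))"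
    using lborel_affine[of "sqrt s" "0::'b"] s by simp
  also have "\<dots> = (\<integral>v. \<bar>sqrt s\<bar> ^ ?d * (gauss_density s (sqrt s *\<^sub>R v) * (norm (sqrt s *\<^sub>R (v::'b)))\<^sup>2) \<partial>lborel)"
    by (subst integral_density) (auto simp: integral_distr)
  also have "\<dots> = (\<integral>v. s * (gauss_density 1 v * (norm (v::'b))\<^sup>2) \<partial>lborel)"
  proof (rule Bochner_Integration.integral_cong[OF refl])
    fix v :: 'b
    have "sqrt s ^ ?d = s powr (real ?d / 2)"
      using s by (simp add: powr_half_sqrt[symmetric] powr_powr flip: powr_realpow)
    then have "sqrt s ^ ?d * (2 * pi * s) powr (- real ?d / 2) = (2 * pi) powr (- real ?d / 2)"
      using s by (simp add: powr_mult powr_minus field_simps)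
    moreover have "(norm (sqrt s *\<^sub>R v))\<^sup>2 = s * (norm v)\<^sup>2"
      using s by (simp add: power_mult_distrib)
    ultimately show "\<bar>sqrt s\<bar> ^ ?d * (gauss_density s (sqrt s *\<^sub>R v) * (norm (sqrt s *\<^sub>R v))\<^sup>2) =
        s * (gauss_density 1 v * (norm v)\<^sup>2)"
      using s unfolding gauss_density_def by (simp add: mult_ac)
  qed
  also have "\<dots> = s * (\<integral>v. gauss_density 1 v * (norm (v::'b))\<^sup>2 \<partial>lborel)" by simp
  finally show ?thesis unfolding eq .
qed

text \<open>The reflection of \<open>v\<close> to \<open>- v\<close> preserves Lebesgue measure and
  the density, so the integral equals its own negative.\<close>

lemma gauss_mean_zero:
  "(\<integral>v. v \<bullet> (w::'b::euclidean_space) \<partial>gauss_measure s) = 0"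
proof -
  have eq: "(\<integral>v. v \<bullet> w \<partial>gauss_measure s) = (\<integral>v. gauss_density s v * (v \<bullet> w) \<partial>lborel)"
    unfolding gauss_measure_eq by (subst integral_density) (auto simp: gauss_density_nonneg)
  also have "\<dots> = (\<integral>v. gauss_density s v * (v \<bullet> w) \<partial>density (distr lborel borel (\<lambda>x. 0 + (-1) *\<^sub>R x)) (\<lambda>_. ennreal (\<bar>-1\<bar> ^ DIM('b))))"
    using arg_cong[OF lborel_affine[of "-1" "0::'b"], of "\<lambda>N. \<integral>v. gauss_density s v * (v \<bullet> w) \<partial>N"] by simp
  also have "\<dots> = (\<integral>v. gauss_density s (- v) * (- v \<bullet> w) \<partial>lborel)"
    by (subst integral_density) (auto simp: integral_distr)
  also have "\<dots> = - (\<integral>v. gauss_density s v * (v \<bullet> w) \<partial>lborel)"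
    by (simp add: gauss_density_def)
  finally show ?thesis using eq by simp
qed

locale filtered_brownian_motion = prob_space M for M :: "'a measure" +
  fixes F :: "real \<Rightarrow> 'a measure" and W :: "real \<Rightarrow> 'a \<Rightarrow> real^'m"
  assumes filtration: "filtration_of M F" and bm: "brownian_motion M F W"
begin

lemma subalg: "0 \<le> t \<Longrightarrow> subalgebra M (F t)"
  using filtration by (simp add: filtration_of_def)

lemma space_F: "0 \<le> t \<Longrightarrow> space (F t) = space M"
  using subalg by (simp add: subalgebra_def)

lemma measurable_F_mono:
  assumes "f \<in> measurable (F s) N" "0 \<le> s" "s \<le> t"
  shows "f \<in> measurable (F t) N"
proof (rule measurableI)
  have sp: "space (F s) = space M" "space (F t) = space M" using assms by (simp_all add: space_F)
  show "f x \<in> space N" if "x \<in> space (F t)" for x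
    using measurable_space[OF assms(1)] that sp by simp
  have "sets (F s) \<subseteq> sets (F t)" using assms filtration unfolding filtration_of_def by blast
  then show "f -` B \<inter> space (F t) \<in> sets (F t)" if "B \<in> sets N" for B
    using measurable_sets[OF assms(1) that] sp by auto
qed

lemma measurable_F_M: "f \<in> measurable (F s) N \<Longrightarrow> 0 \<le> s \<Longrightarrow> f \<in> measurable M N"
  by (rule measurable_from_subalg[OF subalg])

lemma W_measurable: "0 \<le> t \<Longrightarrow> W t \<in> borel_measurable (F t)"
  using bm by (simp add: brownian_motion_def)

lemma increment_measurable:
  assumes "0 \<le> s" "s \<le> t"
  shows "(\<lambda>\<omega>. W t \<omega> - W s \<omega>) \<in> borel_measurable (F t)"
  by (intro borel_measurable_diff W_measurable measurable_F_mono[OF W_measurable]) (use assms in auto)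

lemma increment_law:
  assumes s: "0 \<le> s" "s < t" and A: "A \<in> sets (F s)" and B: "B \<in> sets borel"
  shows "measure M (A \<inter> {\<omega>\<in>space M. W t \<omega> - W s \<omega> \<in> B}) = measure M A * measure (gauss_measure (t - s) :: (real^'m) measure) B"
  using bm s A B by (simp add: brownian_motion_def)

text \<open>The Gaussian density integrates to one because the law of a Brownian increment is a
  probability measure.\<close>

lemma prob_space_gauss_measure:
  assumes s: "0 < s"
  shows "prob_space (gauss_measure s :: (real^'m) measure)"
proof
  have "space M \<in> sets (F 0)" using space_F[of 0] sets.top[of "F 0"] by simp
  from increment_law[of 0 s, OF _ s this, of UNIV]
  have "measure (gauss_measure s :: (real^'m) measure) UNIV = 1"
    by (simp add: prob_space)
  \<comment> \<open>\<open>measure\<close> takes the default value 0 on sets of infinite measure, so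
    the value 1 excludes infinite total mass.\<close>
  then have "emeasure (gauss_measure s :: (real^'m) measure) UNIV = 1"
    using emeasure_eq_ennreal_measure[of "gauss_measure s :: (real^'m) measure" UNIV]
    by (cases "emeasure (gauss_measure s :: (real^'m) measure) UNIV = \<infinity>") (auto simp: measure_def)
  then show "emeasure (gauss_measure s) (space (gauss_measure s :: (real^'m) measure)) = 1"
    by (simp add: gauss_measure_def)
qed

text \<open>Half of the exponent pays for the square: with y = |v|^2 / (4 s), the bound y exp(-y)
  \<le> 1 leaves exp(-y), which is up to a constant the density with variance \<open>2 * s\<close>.
  That density is integrable because a Brownian increment of length \<open>2 * s\<close> has it as
  its law.\<close>

lemma integrable_gauss_square:
  assumes s: "0 < s"
  shows "integrable (gauss_measure s) (\<lambda>v. (norm (v::real^'m))\<^sup>2)"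
proof -
  interpret G: prob_space "gauss_measure (2 * s) :: (real^'m) measure"
    by (rule prob_space_gauss_measure) (use s in simp)
  have "integrable (gauss_measure (2 * s) :: (real^'m) measure) (\<lambda>_. 1 :: real)" by simp
  then have 1: "integrable lborel (\<lambda>v::real^'m. gauss_density (2 * s) v)"
    unfolding gauss_measure_eq
    by (subst (asm) integrable_density) (auto simp: gauss_density_nonneg)
  define c where "c = (2 * pi * s) powr (- real DIM(real^'m) / 2) / (2 * pi * (2 * s)) powr (- real DIM(real^'m) / 2)"
  have c: "0 \<le> c" "c * (2 * pi * (2 * s)) powr (- real DIM(real^'m) / 2) = (2 * pi * s) powr (- real DIM(real^'m) / 2)"
    using s by (auto simp: c_def)
  have le: "gauss_density s v * (norm v)\<^sup>2 \<le> (4 * s * c) * gauss_density (2 * s) v" for v :: "real^'m"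
  proof -
    let ?y = "(norm v)\<^sup>2 / (4 * s)"
    have y: "- (norm v)\<^sup>2 / (2 * s) = - ?y + - ?y" using s by (simp add: field_simps)
    have "?y \<le> exp ?y" using exp_ge_add_one_self[of ?y] by linarith
    then have "exp (- ?y) * ?y \<le> 1"
      using mult_left_mono[of ?y "exp ?y" "exp (- ?y)"] by (simp flip: exp_add)
    then have "exp (- ?y) * (exp (- ?y) * ?y) \<le> exp (- ?y) * 1"
      by (intro mult_left_mono) auto
    then have "exp (- (norm v)\<^sup>2 / (2 * s)) * ?y \<le> exp (- ?y)"
      unfolding y exp_add by (simp add: mult.assoc)
    then have "exp (- (norm v)\<^sup>2 / (2 * s)) * (norm v)\<^sup>2 \<le> 4 * s * exp (- ?y)"
      using s by (simp add: field_simps)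
    then have "(2 * pi * s) powr (- real DIM(real^'m) / 2) * (exp (- (norm v)\<^sup>2 / (2 * s)) * (norm v)\<^sup>2)
       \<le> (2 * pi * s) powr (- real DIM(real^'m) / 2) * (4 * s * exp (- ?y))"
      by (intro mult_left_mono) auto
    then show ?thesis unfolding gauss_density_def c(2)[symmetric] by (simp add: mult_ac)
  qed
  have "integrable lborel (\<lambda>v::real^'m. gauss_density s v * (norm v)\<^sup>2)"
    by (rule Bochner_Integration.integrable_bound[OF integrable_mult_right[OF 1, of "4 * s * c"]])
       (use le c s in \<open>auto simp: gauss_density_nonneg abs_mult\<close>)
  then show ?thesis
    unfolding gauss_measure_eq
    by (subst integrable_density) (auto simp: gauss_density_nonneg)
qed

text \<open>Weighting \<open>M\<close> by the indicator of \<open>A\<close> turns the independence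
  in the definition of Brownian motion into an equality of two measures, the image under the
  increment and a multiple of the Gaussian measure. A change of variables then treats all integrable
  \<open>h\<close> at once.\<close>

lemma increment_integral:
  fixes h :: "real^'m \<Rightarrow> real"
  assumes s: "0 \<le> s" "s < t" and A: "A \<in> sets (F s)"
    and h: "integrable (gauss_measure (t - s)) h"
  shows "integrable M (\<lambda>\<omega>. indicator A \<omega> * h (W t \<omega> - W s \<omega>))"
    and "expectation (\<lambda>\<omega>. indicator A \<omega> * h (W t \<omega> - W s \<omega>)) = measure M A * (\<integral>v. h v \<partial>gauss_measure (t - s))"
proof -
  let ?D = "\<lambda>\<omega>. W t \<omega> - W s \<omega>" and ?\<gamma> = "gauss_measure (t - s) :: (real^'m) measure"
  interpret G: prob_space ?\<gamma> by (rule prob_space_gauss_measure) (use s in simp)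
  have [measurable]: "?D \<in> borel_measurable M"
    by (rule measurable_F_M[OF increment_measurable, of s t]) (use s in auto)
  have [measurable]: "A \<in> sets M" using subalg[of s] s A by (auto simp: subalgebra_def)
  have [measurable]: "h \<in> borel_measurable borel"
    using borel_measurable_integrable[OF h] measurable_cong_sets[OF sets_gauss_measure refl] by blast
  have eq: "distr (density M (\<lambda>\<omega>. ennreal (indicator A \<omega>))) borel ?D = density ?\<gamma> (\<lambda>_. ennreal (measure M A))"
  proof (rule measure_eqI)
    fix B assume "B \<in> sets (distr (density M (\<lambda>\<omega>. ennreal (indicator A \<omega>))) borel ?D)"
    then have B [measurable]: "B \<in> sets borel" by simp
    have "emeasure (distr (density M (\<lambda>\<omega>. ennreal (indicator A \<omega>))) borel ?D) B
        = emeasure (density M (\<lambda>\<omega>. ennreal (indicator A \<omega>))) (?D -` B \<inter> space M)"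
      by (subst emeasure_distr) auto
    also have "\<dots> = emeasure M (A \<inter> (?D -` B \<inter> space M))"
      by (subst emeasure_density)
        (auto simp: ennreal_indicator simp flip: indicator_inter_arith intro!: nn_integral_indicator)
    also have "A \<inter> (?D -` B \<inter> space M) = A \<inter> {\<omega>\<in>space M. ?D \<omega> \<in> B}" by auto
    also have "emeasure M \<dots> = ennreal (measure M A * measure ?\<gamma> B)"
      unfolding emeasure_eq_measure increment_law[OF s A B] ..
    also have "\<dots> = emeasure (density ?\<gamma> (\<lambda>_. ennreal (measure M A))) B"
      by (simp add: emeasure_density nn_integral_cmult_indicator G.emeasure_eq_measure ennreal_mult')
    finally show "emeasure (distr (density M (\<lambda>\<omega>. ennreal (indicator A \<omega>))) borel ?D) B
        = emeasure (density ?\<gamma> (\<lambda>_. ennreal (measure M A))) B" .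
  qed simp
  have hm: "h \<in> borel_measurable ?\<gamma>" by measurable
  let ?N = "density M (\<lambda>\<omega>. ennreal (indicator A \<omega>))"
  have D: "?D \<in> ?N \<rightarrow>\<^sub>M borel" by measurable
  have hD: "(\<lambda>\<omega>. h (?D \<omega>)) \<in> borel_measurable M" by measurable
  have Am: "indicat_real A \<in> borel_measurable M" by measurable
  have "integrable (density ?\<gamma> (\<lambda>_. ennreal (measure M A))) h = integrable ?\<gamma> (\<lambda>v. measure M A *\<^sub>R h v)"
    by (rule integrable_density[OF hm]) simp_all
  then have "integrable (distr ?N borel ?D) h" using h unfolding eq by simp
  then have "integrable ?N (\<lambda>\<omega>. h (?D \<omega>))" by (rule integrable_distr[OF D])
  then show "integrable M (\<lambda>\<omega>. indicator A \<omega> * h (?D \<omega>))"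
    using integrable_density[OF hD Am] by simp
  have "measure M A * (\<integral>v. h v \<partial>?\<gamma>) = (\<integral>v. h v \<partial>distr ?N borel ?D)"
    unfolding eq using integral_density[OF hm, of "\<lambda>_. measure M A"] by simp
  also have "\<dots> = (\<integral>\<omega>. h (?D \<omega>) \<partial>?N)" by (rule integral_distr[OF D]) measurable
  also have "\<dots> = expectation (\<lambda>\<omega>. indicator A \<omega> * h (?D \<omega>))"
    using integral_density[OF hD Am] by simp
  finally show "expectation (\<lambda>\<omega>. indicator A \<omega> * h (?D \<omega>)) = measure M A * (\<integral>v. h v \<partial>?\<gamma>)" by simp
qed

end

lemma borel_measurable_vec_nth [measurable (raw)]:
  fixes f :: "'a \<Rightarrow> 'b::real_normed_vector ^ 'n"
  assumes "f \<in> borel_measurable M"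
  shows "(\<lambda>x. f x $ i) \<in> borel_measurable M"
  using measurable_compose[OF assms borel_measurable_continuous_onI[OF linear_continuous_on[OF bounded_linear_vec_nth]]]
  by simp

section \<open>Second moments of discrete stochastic integrals and the first moment of the Ito
  integral\<close>

context filtered_brownian_motion begin

definition var_rate :: real where
  "var_rate = (\<integral>v. (norm (v::real^'m))\<^sup>2 \<partial>gauss_measure 1)"

lemma var_rate_nonneg: "0 \<le> var_rate"
  by (simp add: var_rate_def)

lemma increment_borel: "0 \<le> s \<Longrightarrow> s \<le> t \<Longrightarrow> (\<lambda>\<omega>. W t \<omega> - W s \<omega>) \<in> borel_measurable M"
  by (rule measurable_F_M[OF increment_measurable]) auto

lemma increment_square:
  assumes s: "0 \<le> s" "s < t"
  shows "integrable M (\<lambda>\<omega>. (norm (W t \<omega> - W s \<omega>))\<^sup>2)"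
    and "expectation (\<lambda>\<omega>. (norm (W t \<omega> - W s \<omega>))\<^sup>2) = (t - s) * var_rate"
proof -
  have A: "space M \<in> sets (F s)" using sets.top[of "F s"] space_F[OF s(1)] by simp
  have h: "integrable (gauss_measure (t - s)) (\<lambda>v. (norm (v::real^'m))\<^sup>2)"
    by (rule integrable_gauss_square) (use s in simp)
  note i = increment_integral[OF s A h]
  show "integrable M (\<lambda>\<omega>. (norm (W t \<omega> - W s \<omega>))\<^sup>2)"
    by (rule Bochner_Integration.integrable_cong[THEN iffD1, OF refl _ i(1)]) simp
  have "expectation (\<lambda>\<omega>. (norm (W t \<omega> - W s \<omega>))\<^sup>2) =
      expectation (\<lambda>\<omega>. indicator (space M) \<omega> * (norm (W t \<omega> - W s \<omega>))\<^sup>2)"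
    by (rule Bochner_Integration.integral_cong) auto
  then show "expectation (\<lambda>\<omega>. (norm (W t \<omega> - W s \<omega>))\<^sup>2) = (t - s) * var_rate"
    unfolding i(2) var_rate_def using gauss_second_moment[of "t - s", where 'b="real^'m"] s
    by (simp add: prob_space)
qed

text \<open>\<open>V\<close> is only square integrable because it will contain an earlier Brownian
  increment as a factor.\<close>

lemma increment_orthogonal:
  fixes V :: "'a \<Rightarrow> real"
  assumes s: "0 \<le> s" "s < t" and V: "V \<in> borel_measurable (F s)" and V2: "integrable M (\<lambda>\<omega>. (V \<omega>)\<^sup>2)"
  shows "integrable M (\<lambda>\<omega>. V \<omega> * (W t \<omega> - W s \<omega>) $ c)"
    and "expectation (\<lambda>\<omega>. V \<omega> * (W t \<omega> - W s \<omega>) $ c) = 0"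
proof -
  let ?D = "\<lambda>\<omega>. (W t \<omega> - W s \<omega>) $ c"
  have Dm: "?D \<in> borel_measurable M"
    by (rule borel_measurable_vec_nth[OF increment_borel]) (use s in auto)
  have Vm: "V \<in> borel_measurable M" by (rule measurable_F_M[OF V s(1)])
  have D2: "integrable M (\<lambda>\<omega>. (?D \<omega>)\<^sup>2)"
  proof (rule Bochner_Integration.integrable_bound[OF increment_square(1)[OF s]])
    show "AE \<omega> in M. norm ((?D \<omega>)\<^sup>2) \<le> norm ((norm (W t \<omega> - W s \<omega>))\<^sup>2)"
      using component_le_norm_cart[of "W t \<omega> - W s \<omega>" c for \<omega>]
      by (auto intro!: AE_I2 simp: abs_le_square_iff[symmetric] simp del: vector_minus_component)
  qed (use Dm in measurable)
  show VD: "integrable M (\<lambda>\<omega>. V \<omega> * ?D \<omega>)"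
    by (rule integrable_mult_square[OF Vm Dm V2 D2])
  have D1: "integrable M ?D"
  proof -
    have "integrable M (\<lambda>\<omega>. 1 * ?D \<omega>)"
      by (rule integrable_mult_square[OF _ Dm _ D2]) simp_all
    then show ?thesis by (simp only: mult_1_left)
  qed
  show "expectation (\<lambda>\<omega>. V \<omega> * ?D \<omega>) = 0"
  proof (rule expectation_mult_eq_0[OF subalg[OF s(1)] D1 _ V VD])
    fix A assume A: "A \<in> sets (F s)"
    have G: "prob_space (gauss_measure (t - s) :: (real^'m) measure)"
      by (rule prob_space_gauss_measure) (use s in simp)
    then interpret G: prob_space "gauss_measure (t - s) :: (real^'m) measure" .
    have "integrable (gauss_measure (t - s)) (\<lambda>v::real^'m. 1 + (norm v)\<^sup>2)"
      using integrable_gauss_square[of "t - s"] s by simp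
    then have h: "integrable (gauss_measure (t - s)) (\<lambda>v::real^'m. v \<bullet> axis c 1)"
    proof (rule Bochner_Integration.integrable_bound)
      have "\<bar>v \<bullet> axis c 1\<bar> \<le> 1 + (norm v)\<^sup>2" for v :: "real^'m"
      proof -
        have "\<bar>v \<bullet> axis c 1\<bar> \<le> norm v"
          using component_le_norm_cart[of v c] by (simp add: inner_axis)
        also have "norm v \<le> 1 + (norm v)\<^sup>2"
          using sum_power2_ge_zero[of "norm v - 1/2" 0] by (simp add: power2_eq_square algebra_simps)
        finally show ?thesis .
      qed
      then show "AE v in gauss_measure (t - s). norm ((v::real^'m) \<bullet> axis c 1) \<le> norm (1 + (norm v)\<^sup>2)"
        by (intro AE_I2) auto
    qed measurable
    show "set_lebesgue_integral M A ?D = 0"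
      using increment_integral(2)[OF s A h] gauss_mean_zero[where w="axis c 1 :: real^'m" and s="t - s"]
      by (simp add: set_lebesgue_integral_def inner_axis)
  qed
qed

text \<open>The Ito isometry for simple integrands, as an inequality: the cross terms vanish, and
  every diagonal term is at most \<open>K\<^sup>2\<close> times the second moment of the increment.
  The partition is strictly increasing because the law of an increment is given for
  \<open>s < t\<close> only.\<close>

lemma integral_sum_square_le:
  assumes \<tau>: "0 \<le> \<tau> 0" "\<And>k. \<tau> k < \<tau> (Suc k)"
    and \<xi>: "\<And>k. \<xi> k \<in> borel_measurable (F (\<tau> k))" "\<And>k \<omega>. \<omega> \<in> space M \<Longrightarrow> norm (\<xi> k \<omega>) \<le> K"
  shows "integrable M (\<lambda>\<omega>. (\<Sum>k<n. \<xi> k \<omega> \<bullet> (W (\<tau> (Suc k)) \<omega> - W (\<tau> k) \<omega>))\<^sup>2)"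
    and "expectation (\<lambda>\<omega>. (\<Sum>k<n. \<xi> k \<omega> \<bullet> (W (\<tau> (Suc k)) \<omega> - W (\<tau> k) \<omega>))\<^sup>2)
      \<le> K\<^sup>2 * var_rate * (\<tau> n - \<tau> 0)"
proof -
  define \<Delta> where "\<Delta> k \<omega> = W (\<tau> (Suc k)) \<omega> - W (\<tau> k) \<omega>" for k \<omega>
  define D where "D k \<omega> = \<xi> k \<omega> \<bullet> \<Delta> k \<omega>" for k \<omega>
  have \<tau>_mono: "\<tau> k \<le> \<tau> l" if "k \<le> l" for k l
    by (rule lift_Suc_mono_le[of \<tau>, OF less_imp_le[OF \<tau>(2)] that])
  have \<tau>0: "0 \<le> \<tau> k" for k using \<tau>(1) \<tau>_mono[of 0 k] by simp
  have \<Delta>F: "\<Delta> k \<in> borel_measurable (F (\<tau> (Suc k)))" for k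
    unfolding \<Delta>_def by (rule increment_measurable) (use \<tau>0 \<tau>(2)[of k] in auto)
  have DF: "D k \<in> borel_measurable (F (\<tau> (Suc k)))" for k
    unfolding D_def
    by (intro borel_measurable_inner \<Delta>F measurable_F_mono[OF \<xi>(1)] \<tau>0 \<tau>_mono) simp
  have DM: "D k \<in> borel_measurable M" for k by (rule measurable_F_M[OF DF \<tau>0])
  have D_le: "(D k \<omega>)\<^sup>2 \<le> K\<^sup>2 * (norm (\<Delta> k \<omega>))\<^sup>2" if "\<omega> \<in> space M" for k \<omega>
  proof -
    have "\<bar>D k \<omega>\<bar> \<le> norm (\<xi> k \<omega>) * norm (\<Delta> k \<omega>)"
      unfolding D_def by (rule Cauchy_Schwarz_ineq2)
    also have "\<dots> \<le> K * norm (\<Delta> k \<omega>)" by (intro mult_right_mono \<xi>(2) that) simp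
    finally have "\<bar>D k \<omega>\<bar>\<^sup>2 \<le> (K * norm (\<Delta> k \<omega>))\<^sup>2" by (intro power_mono) auto
    then show ?thesis by (simp add: power_mult_distrib)
  qed
  have \<Delta>2: "integrable M (\<lambda>\<omega>. (norm (\<Delta> k \<omega>))\<^sup>2)"
     "expectation (\<lambda>\<omega>. (norm (\<Delta> k \<omega>))\<^sup>2) = (\<tau> (Suc k) - \<tau> k) * var_rate" for k
    using increment_square[OF \<tau>0 \<tau>(2)] unfolding \<Delta>_def by auto
  have D2: "integrable M (\<lambda>\<omega>. (D k \<omega>)\<^sup>2)" for k
  proof (rule Bochner_Integration.integrable_bound)
    show "integrable M (\<lambda>\<omega>. K\<^sup>2 * (norm (\<Delta> k \<omega>))\<^sup>2)" using \<Delta>2(1) by simp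
    show "AE \<omega> in M. norm ((D k \<omega>)\<^sup>2) \<le> norm (K\<^sup>2 * (norm (\<Delta> k \<omega>))\<^sup>2)"
      using D_le by (intro AE_I2) simp
  qed (use DM in measurable)
  have orth: "expectation (\<lambda>\<omega>. D k \<omega> * D l \<omega>) = 0" if kl: "k < l" for k l
  proof -
    \<comment> \<open>Expanding the later inner product in coordinates leaves the earlier term times
      a coordinate of \<open>\<xi> l\<close>, which is known at time
      \<open>\<tau> l\<close>.\<close>
    have V: "(\<lambda>\<omega>. D k \<omega> * \<xi> l \<omega> $ c) \<in> borel_measurable (F (\<tau> l))" for c
      by (intro borel_measurable_times borel_measurable_vec_nth \<xi>(1) measurable_F_mono[OF DF] \<tau>0 \<tau>_mono)
        (use kl in simp)
    have VM: "(\<lambda>\<omega>. D k \<omega> * \<xi> l \<omega> $ c) \<in> borel_measurable M" for c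
      by (rule measurable_F_M[OF V \<tau>0])
    have V2: "integrable M (\<lambda>\<omega>. (D k \<omega> * \<xi> l \<omega> $ c)\<^sup>2)" for c
    proof (rule Bochner_Integration.integrable_bound)
      show "integrable M (\<lambda>\<omega>. K\<^sup>2 * (D k \<omega>)\<^sup>2)" using D2 by simp
      have "(D k \<omega> * \<xi> l \<omega> $ c)\<^sup>2 \<le> K\<^sup>2 * (D k \<omega>)\<^sup>2" if "\<omega> \<in> space M" for \<omega>
      proof -
        have "\<bar>\<xi> l \<omega> $ c\<bar> \<le> K" using component_le_norm_cart \<xi>(2)[OF that] order_trans by blast
        then have "(\<xi> l \<omega> $ c)\<^sup>2 \<le> K\<^sup>2" using power_mono[of "\<bar>\<xi> l \<omega> $ c\<bar>" K 2] by simp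
        then show ?thesis by (simp add: power_mult_distrib mult.commute[of "K\<^sup>2"] mult_left_mono)
      qed
      then show "AE \<omega> in M. norm ((D k \<omega> * \<xi> l \<omega> $ c)\<^sup>2) \<le> norm (K\<^sup>2 * (D k \<omega>)\<^sup>2)"
        by (intro AE_I2) simp
    qed (use VM in measurable)
    note o = increment_orthogonal[OF \<tau>0 \<tau>(2) V V2, folded \<Delta>_def]
    have "expectation (\<lambda>\<omega>. D k \<omega> * D l \<omega>) =
        expectation (\<lambda>\<omega>. \<Sum>c\<in>UNIV. D k \<omega> * \<xi> l \<omega> $ c * \<Delta> l \<omega> $ c)"
      unfolding D_def[of l] inner_vec_def by (simp add: sum_distrib_left mult.assoc)
    also have "\<dots> = 0" using o by (simp add: Bochner_Integration.integral_sum)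
    finally show ?thesis .
  qed
  note sq = orthogonal_sum_square[of n D, OF DM D2 orth]
  show "integrable M (\<lambda>\<omega>. (\<Sum>k<n. \<xi> k \<omega> \<bullet> (W (\<tau> (Suc k)) \<omega> - W (\<tau> k) \<omega>))\<^sup>2)"
    using sq(1) unfolding D_def \<Delta>_def .
  have "(\<Sum>k<n. expectation (\<lambda>\<omega>. (D k \<omega>)\<^sup>2)) \<le> (\<Sum>k<n. K\<^sup>2 * ((\<tau> (Suc k) - \<tau> k) * var_rate))"
  proof (rule sum_mono)
    fix k
    have "expectation (\<lambda>\<omega>. (D k \<omega>)\<^sup>2) \<le> expectation (\<lambda>\<omega>. K\<^sup>2 * (norm (\<Delta> k \<omega>))\<^sup>2)"
      using D_le D2 \<Delta>2 by (intro integral_mono) auto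
    also have "\<dots> = K\<^sup>2 * ((\<tau> (Suc k) - \<tau> k) * var_rate)" by (simp add: \<Delta>2(2))
    finally show "expectation (\<lambda>\<omega>. (D k \<omega>)\<^sup>2) \<le> K\<^sup>2 * ((\<tau> (Suc k) - \<tau> k) * var_rate)" .
  qed
  also have "\<dots> = K\<^sup>2 * var_rate * (\<Sum>k<n. \<tau> (Suc k) - \<tau> k)"
    by (simp add: sum_distrib_left mult_ac)
  also have "(\<Sum>k<n. \<tau> (Suc k) - \<tau> k) = \<tau> n - \<tau> 0" by (rule sum_lessThan_telescope)
  finally show "expectation (\<lambda>\<omega>. (\<Sum>k<n. \<xi> k \<omega> \<bullet> (W (\<tau> (Suc k)) \<omega> - W (\<tau> k) \<omega>))\<^sup>2)
      \<le> K\<^sup>2 * var_rate * (\<tau> n - \<tau> 0)"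
    using sq(2) unfolding D_def \<Delta>_def by simp
qed

text \<open>Each row of the integrand gives a scalar sum with bounded second moment. The inequality
  |z| \<le> 1 + z^2 passes from second to first moments and accounts for the summand 1 and the
  factor \<open>CARD('d)\<close>. The bound does not vanish as \<open>t\<close> tends to 0, which is
  harmless since it is only ever multiplied by \<open>sqrt \<epsilon>\<close>.\<close>

lemma ito_integral_bound:
  fixes H :: "real \<Rightarrow> 'a \<Rightarrow> real^'m^'d"
  assumes H: "\<And>s. 0 \<le> s \<Longrightarrow> H s \<in> borel_measurable (F s)"
      "\<And>s \<omega>. 0 \<le> s \<Longrightarrow> \<omega> \<in> space M \<Longrightarrow> norm (H s \<omega>) \<le> K"
    and I: "ito_integral_is M H W t I" and t: "0 \<le> t"
  shows "integrable M (\<lambda>\<omega>. norm (I \<omega>))"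
    and "expectation (\<lambda>\<omega>. norm (I \<omega>)) \<le> real CARD('d) * (1 + K\<^sup>2 * var_rate * t)"
proof -
  let ?Z = "\<lambda>n \<omega>. \<Sum>k<n. H (real k * t / real n) \<omega> *v (W (real (Suc k) * t / real n) \<omega> - W (real k * t / real n) \<omega>)"
  have Im: "I \<in> borel_measurable M" and conv: "converges_in_prob M ?Z I"
    using I by (auto simp: ito_integral_is_def)
  have comp: "?Z n \<omega> $ a = (\<Sum>k<n. H (real k * t / real n) \<omega> $ a \<bullet> (W (real (Suc k) * t / real n) \<omega> - W (real k * t / real n) \<omega>))"
    for n \<omega> a
    by (simp add: matrix_vector_mul_component)
  have HM: "H s \<in> borel_measurable M" if "0 \<le> s" for s by (rule measurable_F_M[OF H(1)[OF that] that])
  have Zam: "(\<lambda>\<omega>. ?Z n \<omega> $ a) \<in> borel_measurable M" for n a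
    unfolding comp using t
    by (intro borel_measurable_sum borel_measurable_inner borel_measurable_vec_nth HM increment_borel)
      (auto intro!: divide_right_mono mult_right_mono)
  have Zm: "?Z n \<in> borel_measurable M" for n
  proof (subst borel_measurable_euclidean_space, intro ballI)
    fix i :: "real^'d" assume "i \<in> Basis"
    then obtain a where "i = axis a 1" by (auto simp: Basis_vec_def)
    then show "(\<lambda>\<omega>. ?Z n \<omega> \<bullet> i) \<in> borel_measurable M"
      using Zam[of n a] by (simp add: inner_axis)
  qed
  have sq: "integrable M (\<lambda>\<omega>. (?Z n \<omega> $ a)\<^sup>2) \<and> expectation (\<lambda>\<omega>. (?Z n \<omega> $ a)\<^sup>2) \<le> K\<^sup>2 * var_rate * t"
    if n: "0 < n" for n a
  proof (cases "t = 0")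
    \<comment> \<open>All partition points coincide, so the strict monotonicity required above
      fails; the sums are zero.\<close>
    case True
    then show ?thesis by simp
  next
    case False
    have Ha: "norm (H s \<omega> $ a) \<le> K" if "0 \<le> s" "\<omega> \<in> space M" for s \<omega>
      using H(2)[OF that] Finite_Cartesian_Product.norm_nth_le[of "H s \<omega>" a] by simp
    have lt: "real k * t / real n < real (Suc k) * t / real n" for k
      using False t n by (intro divide_strict_right_mono mult_strict_right_mono) auto
    show ?thesis
      unfolding comp
      using integral_sum_square_le[of "\<lambda>k. real k * t / real n" "\<lambda>k \<omega>. H (real k * t / real n) \<omega> $ a" K n,
          OF _ lt borel_measurable_vec_nth[OF H(1)] Ha] t n
      by simp
  qed
  have le: "norm (?Z n \<omega>) \<le> (\<Sum>a\<in>UNIV. 1 + (?Z n \<omega> $ a)\<^sup>2)" for n \<omega>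
  proof -
    have "norm (?Z n \<omega>) \<le> (\<Sum>a\<in>UNIV. \<bar>?Z n \<omega> $ a\<bar>)" by (rule norm_le_l1_cart)
    also have "\<dots> \<le> (\<Sum>a\<in>UNIV. 1 + (?Z n \<omega> $ a)\<^sup>2)"
    proof (rule sum_mono)
      fix a
      have "0 \<le> (\<bar>?Z n \<omega> $ a\<bar> - 1/2)\<^sup>2" by simp
      then show "\<bar>?Z n \<omega> $ a\<bar> \<le> 1 + (?Z n \<omega> $ a)\<^sup>2" by (simp add: power2_diff field_simps del: sum_component)
    qed
    finally show ?thesis .
  qed
  have Zn: "integrable M (\<lambda>\<omega>. norm (?Z n \<omega>))" if "0 < n" for n
  proof (rule Bochner_Integration.integrable_bound)
    show "integrable M (\<lambda>\<omega>. \<Sum>a\<in>UNIV. 1 + (?Z n \<omega> $ a)\<^sup>2)"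
      using sq[OF that] by (intro Bochner_Integration.integrable_sum Bochner_Integration.integrable_add) auto
    show "AE \<omega> in M. norm (norm (?Z n \<omega>)) \<le> norm (\<Sum>a\<in>UNIV. 1 + (?Z n \<omega> $ a)\<^sup>2)"
      using le[of n] by (intro AE_I2) (simp add: order_trans[OF _ abs_ge_self] del: sum_component)
  qed (use Zm in measurable)
  have ZC: "expectation (\<lambda>\<omega>. norm (?Z n \<omega>)) \<le> real CARD('d) * (1 + K\<^sup>2 * var_rate * t)" if n: "0 < n" for n
  proof -
    have "expectation (\<lambda>\<omega>. norm (?Z n \<omega>)) \<le> expectation (\<lambda>\<omega>. \<Sum>a\<in>UNIV. 1 + (?Z n \<omega> $ a)\<^sup>2)"
      using sq[OF n] le[of n] Zn[OF n]
      by (intro integral_mono Bochner_Integration.integrable_sum Bochner_Integration.integrable_add) auto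
    also have "\<dots> = (\<Sum>a\<in>UNIV. 1 + expectation (\<lambda>\<omega>. (?Z n \<omega> $ a)\<^sup>2))"
    proof (subst Bochner_Integration.integral_sum)
      show "(\<Sum>a\<in>UNIV. expectation (\<lambda>\<omega>. 1 + (?Z n \<omega> $ a)\<^sup>2)) = (\<Sum>a\<in>UNIV. 1 + expectation (\<lambda>\<omega>. (?Z n \<omega> $ a)\<^sup>2))"
        using sq[OF n] by (intro sum.cong refl, subst Bochner_Integration.integral_add) (auto simp: prob_space)
    qed (use sq[OF n] in \<open>intro Bochner_Integration.integrable_add, auto\<close>)
    also have "\<dots> \<le> (\<Sum>a\<in>(UNIV::'d set). 1 + K\<^sup>2 * var_rate * t)"
      using sq[OF n] by (intro sum_mono add_left_mono) auto
    finally show ?thesis by simp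
  qed
  show "integrable M (\<lambda>\<omega>. norm (I \<omega>))"
    and "expectation (\<lambda>\<omega>. norm (I \<omega>)) \<le> real CARD('d) * (1 + K\<^sup>2 * var_rate * t)"
    using expectation_norm_converges_in_prob_le[of ?Z, OF Zn ZC Zm conv Im] by auto
qed

end

section \<open>The averaged drift and the corrector\<close>

text \<open>A quantitative form of (A1)-(A4). \<open>C\<close> and \<open>K3\<close> refer to full
  rows including the diagonal, so they bound operator norms; \<open>1 \<le> C\<close> is a
  normalization that the power series estimates rely on.\<close>

locale averaging_coefficients =
  fixes S :: "nat set" and b :: "real^'d \<Rightarrow> nat \<Rightarrow> real^'d" and \<sigma> :: "real^'d \<Rightarrow> nat \<Rightarrow> real^'m^'d"
    and Q :: "real^'d \<Rightarrow> nat \<Rightarrow> nat \<Rightarrow> real" and \<pi> :: "real^'d \<Rightarrow> nat \<Rightarrow> real"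
    and K1 K2 K3 C c1 lam :: real
  assumes S_nonempty: "S \<noteq> {}"
    and constants: "0 \<le> K1" "0 \<le> K2" "0 \<le> K3" "1 \<le> C" "0 < c1" "0 < lam"
    and b_lipschitz: "i \<in> S \<Longrightarrow> norm (b x i - b y i) \<le> K1 * norm (x - y)"
    and b_bounded: "i \<in> S \<Longrightarrow> norm (b x i) \<le> K2"
    and \<sigma>_lipschitz: "i \<in> S \<Longrightarrow> norm (\<sigma> x i - \<sigma> y i) \<le> K1 * norm (x - y)"
    and \<sigma>_bounded: "i \<in> S \<Longrightarrow> norm (\<sigma> x i) \<le> K2"
    and Q_bounded: "row_bounded S (Q x) C"
    and Q_lipschitz: "row_bounded S (\<lambda>i j. Q x i j - Q y i j) (K3 * norm (x - y))"
    and invariant: "invariant_prob S (Q x) (\<pi> x)"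
    and ergodic: "0 < s \<Longrightarrow> i \<in> S \<Longrightarrow>
      (\<Sum>\<^sub>\<infinity>j\<in>S. \<bar>ctmc_semigroup S (Q x) s i j - \<pi> x j\<bar>) \<le> c1 * exp (- lam * s)"
begin

definition mean_drift :: "real^'d \<Rightarrow> real^'d" where
  "mean_drift x = (\<Sum>\<^sub>\<infinity>i\<in>S. \<pi> x i *\<^sub>R b x i)"

lemma inv_summable: "\<pi> x abs_summable_on S" "(\<Sum>\<^sub>\<infinity>i\<in>S. \<bar>\<pi> x i\<bar>) = 1"
proof -
  have "\<bar>\<pi> x i\<bar> = \<pi> x i" if "i \<in> S" for i
    using invariant[of x] that by (simp add: invariant_prob_def)
  moreover have "(\<pi> x has_sum 1) S" using invariant[of x] by (simp add: invariant_prob_def)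
  ultimately show "\<pi> x abs_summable_on S" "(\<Sum>\<^sub>\<infinity>i\<in>S. \<bar>\<pi> x i\<bar>) = 1"
    by (auto simp: has_sum_iff cong: summable_on_cong infsum_cong)
qed

lemma b_comp_bounded: "i \<in> S \<Longrightarrow> \<bar>b x i $ a\<bar> \<le> K2"
  using b_bounded[of i x] component_le_norm_cart[of "b x i" a] by linarith

lemma b_comp_lipschitz: "i \<in> S \<Longrightarrow> \<bar>b x i $ a - b y i $ a\<bar> \<le> K1 * norm (x - y)"
  using b_lipschitz[of i x y] component_le_norm_cart[of "b x i - b y i" a] by simp

lemma mean_drift_summable: "(\<lambda>i. \<pi> x i *\<^sub>R b x i) abs_summable_on S"
proof (rule Infinite_Sum.abs_summable_on_comparison_test')
  show "(\<lambda>i. norm (\<pi> x i) * K2) summable_on S"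
    using inv_summable(1) by (rule summable_on_cmult_left)
qed (use b_bounded in \<open>auto intro: mult_left_mono\<close>)

lemma mean_drift_comp: "mean_drift x $ a = (\<Sum>\<^sub>\<infinity>i\<in>S. \<pi> x i * b x i $ a)"
proof -
  have "((\<lambda>i. \<pi> x i *\<^sub>R b x i) has_sum mean_drift x) S"
    unfolding mean_drift_def by (rule has_sum_infsum[OF abs_summable_summable[OF mean_drift_summable]])
  from has_sum_bounded_linear[OF bounded_linear_vec_nth[of a] this]
  show ?thesis by (simp add: infsumI o_def)
qed

lemma mean_drift_bounded: "norm (mean_drift x) \<le> K2"
proof -
  have "norm (mean_drift x) \<le> (\<Sum>\<^sub>\<infinity>i\<in>S. norm (\<pi> x i *\<^sub>R b x i))"
    unfolding mean_drift_def by (rule norm_infsum_bound[OF mean_drift_summable])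
  also have "\<dots> \<le> (\<Sum>\<^sub>\<infinity>i\<in>S. \<bar>\<pi> x i\<bar> * K2)"
    using mean_drift_summable inv_summable(1) b_bounded
    by (intro infsum_mono summable_on_cmult_left) (auto intro: mult_left_mono)
  also have "\<dots> = K2" by (simp add: infsum_cmult_left' inv_summable(2))
  finally show ?thesis .
qed

text \<open>Moving x changes the averaged function, at rate \<open>K1\<close>, and the averaging
  measure, whose variation is controlled by \<open>invariant_prob_perturb\<close>.\<close>

lemma mean_drift_lipschitz: "\<exists>L\<ge>0. \<forall>x y. norm (mean_drift x - mean_drift y) \<le> L * norm (x - y)"
proof -
  \<comment> \<open>The time after which every semigroup is within 1/2 of equilibrium, as the
    perturbation lemma demands; \<open>max 1\<close> keeps it positive when \<open>c1\<close> is
    small.\<close>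
  define T where "T = max 1 (ln (2 * c1) / lam)"
  have T: "0 < T" by (simp add: T_def)
  have "ln (2 * c1) \<le> lam * T"
    using constants by (simp add: T_def field_simps max_def)
  then have "2 * c1 \<le> exp (lam * T)"
    using constants exp_le_cancel_iff[of "ln (2 * c1)" "lam * T"] by simp
  then have half: "c1 * exp (- lam * T) \<le> 1/2"
    by (simp add: exp_minus field_simps)
  define R where "R = 2 * exp (2 * C * T) * K3 * K2 + K1"
  have R: "0 \<le> R" using constants by (simp add: R_def)
  have comp: "\<bar>mean_drift x $ a - mean_drift y $ a\<bar> \<le> R * norm (x - y)" for x y a
  proof -
    have "(\<Sum>\<^sub>\<infinity>j\<in>S. \<bar>\<pi> x j - \<pi> y j\<bar>) \<le> 2 * exp (2 * C * T) * (K3 * norm (x - y))"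
      by (rule invariant_prob_perturb[OF Q_bounded Q_bounded constants(4) less_imp_le[OF T] Q_lipschitz
            invariant invariant order_trans[OF ergodic[OF T] half] S_nonempty])
    then have "(\<Sum>\<^sub>\<infinity>j\<in>S. \<bar>\<pi> x j - \<pi> y j\<bar>) * K2 \<le> 2 * exp (2 * C * T) * (K3 * norm (x - y)) * K2"
      using constants by (intro mult_right_mono)
    moreover have "\<bar>\<Sum>\<^sub>\<infinity>j\<in>S. (\<pi> x j - \<pi> y j) * b y j $ a\<bar> \<le> (\<Sum>\<^sub>\<infinity>j\<in>S. \<bar>\<pi> x j - \<pi> y j\<bar>) * K2"
      by (rule wsum_bound(3)[OF abs_summable_diff[OF inv_summable(1) inv_summable(1)] b_comp_bounded])
    moreover have "\<bar>\<Sum>\<^sub>\<infinity>j\<in>S. \<pi> x j * (b x j $ a - b y j $ a)\<bar> \<le> (\<Sum>\<^sub>\<infinity>j\<in>S. \<bar>\<pi> x j\<bar>) * (K1 * norm (x - y))"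
      by (rule wsum_bound(3)[OF inv_summable(1) b_comp_lipschitz])
    moreover have "mean_drift x $ a - mean_drift y $ a =
        (\<Sum>\<^sub>\<infinity>j\<in>S. \<pi> x j * (b x j $ a - b y j $ a)) + (\<Sum>\<^sub>\<infinity>j\<in>S. (\<pi> x j - \<pi> y j) * b y j $ a)"
      unfolding mean_drift_comp
      by (rule wsum_diff[OF inv_summable(1) inv_summable(1) b_comp_bounded b_comp_bounded])
    ultimately show ?thesis
      unfolding R_def inv_summable(2) distrib_right by (simp add: mult_ac)
  qed
  have "norm (mean_drift x - mean_drift y) \<le> (real CARD('d) * R) * norm (x - y)" for x y
  proof -
    have "norm (mean_drift x - mean_drift y) \<le> (\<Sum>a\<in>UNIV. \<bar>(mean_drift x - mean_drift y) $ a\<bar>)"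
      by (rule norm_le_l1_cart)
    also have "\<dots> \<le> (\<Sum>a\<in>(UNIV::'d set). R * norm (x - y))"
      using comp by (intro sum_mono) simp
    finally show ?thesis by simp
  qed
  then show ?thesis using R by (intro exI[of _ "real CARD('d) * R"]) auto
qed

definition corrector :: "real \<Rightarrow> 'd \<Rightarrow> real^'d \<Rightarrow> nat \<Rightarrow> real" where
  "corrector T a x = poisson S (Q x) T (\<lambda>j. b x j $ a)"

lemma corrector_bounded:
  assumes "0 \<le> T" "i \<in> S"
  shows "\<bar>corrector T a x i\<bar> \<le> exp (C * T) * K2"
  unfolding corrector_def
  by (rule poisson_bound[OF Q_bounded constants(4) assms(1) b_comp_bounded assms(2)])

lemma corrector_lipschitz:
  assumes "0 \<le> T" "i \<in> S"
  shows "\<bar>corrector T a x i - corrector T a y i\<bar> \<le> exp (2 * C * T) * (K1 + K3 * K2) * norm (x - y)"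
proof -
  have "\<bar>corrector T a x i - corrector T a y i\<bar> \<le> exp (2 * C * T) * (K1 * norm (x - y) + K3 * norm (x - y) * K2)"
    unfolding corrector_def
    by (rule poisson_perturb[OF Q_bounded Q_bounded constants(4) assms(1) b_comp_bounded b_comp_bounded
          Q_lipschitz b_comp_lipschitz assms(2)])
  then show ?thesis by (simp add: algebra_simps)
qed

lemma corrector_equation:
  assumes T: "0 < T" and i: "i \<in> S"
  shows "\<bar>b x i $ a - mean_drift x $ a + kapply S (Q x) (corrector T a y) i\<bar>
    \<le> c1 * exp (- lam * T) * K2 + C * (exp (2 * C * T) * (K1 + K3 * K2)) * norm (x - y)"
proof -
  have T0: "0 \<le> T" using T by simp
  have bd: "\<bar>b x j $ a\<bar> \<le> K2" if "j \<in> S" for j using b_comp_bounded[OF that] .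
  note P = row_boundedD(1)[OF semigroup_kernel(1)[OF Q_bounded T0] i]
  have eq: "kapply S (Q x) (corrector T a x) i = kapply S (ctmc_semigroup S (Q x) T) (\<lambda>j. b x j $ a) i - b x i $ a"
    unfolding corrector_def by (rule kapply_poisson[OF Q_bounded constants(4) T0 bd i])
  have "kapply S (ctmc_semigroup S (Q x) T) (\<lambda>j. b x j $ a) i - mean_drift x $ a =
      (\<Sum>\<^sub>\<infinity>j\<in>S. (ctmc_semigroup S (Q x) T i j - \<pi> x j) * b x j $ a)"
    unfolding kapply_def mean_drift_comp
    using wsum_diff[OF P inv_summable(1) bd bd] by simp
  also have "\<bar>\<dots>\<bar> \<le> (\<Sum>\<^sub>\<infinity>j\<in>S. \<bar>ctmc_semigroup S (Q x) T i j - \<pi> x j\<bar>) * K2"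
    by (rule wsum_bound(3)[OF abs_summable_diff[OF P inv_summable(1)] bd])
  also have "\<dots> \<le> c1 * exp (- lam * T) * K2"
    using ergodic[OF T i, of x] constants(2) by (rule mult_right_mono)
  finally have 1: "\<bar>kapply S (ctmc_semigroup S (Q x) T) (\<lambda>j. b x j $ a) i - mean_drift x $ a\<bar>
    \<le> c1 * exp (- lam * T) * K2" .
  have cb: "\<bar>corrector T a z j\<bar> \<le> exp (C * T) * K2" if "j \<in> S" for z j
    by (rule corrector_bounded[OF T0 that])
  have *: "\<bar>kapply S (Q x) (\<lambda>j. corrector T a y j - corrector T a x j) i\<bar>
      \<le> C * (exp (2 * C * T) * (K1 + K3 * K2) * norm (y - x))"
    by (rule kapply_bound[OF Q_bounded i corrector_lipschitz[OF T0]])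
  have 2: "\<bar>kapply S (Q x) (corrector T a y) i - kapply S (Q x) (corrector T a x) i\<bar>
      \<le> C * (exp (2 * C * T) * (K1 + K3 * K2)) * norm (x - y)"
  proof -
    have "kapply S (Q x) (\<lambda>j. corrector T a y j - corrector T a x j) i =
        kapply S (Q x) (corrector T a y) i - kapply S (Q x) (corrector T a x) i"
      by (rule kapply_diff[OF Q_bounded i cb cb])
    with * show ?thesis by (simp add: mult.assoc norm_minus_commute)
  qed
  show ?thesis using 1 2 eq by linarith
qed

end

section \<open>Martingale increments of the switching component\<close>

text \<open>Sums over the state space are unordered, while measurability and dominated convergence
  need sequences. Cutting off at \<open>n\<close> also leaves finite sums, for which the martingale
  property is available.\<close>

lemma partial_sums_tendsto_infsum:
  fixes w :: "nat \<Rightarrow> real"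
  assumes "w summable_on S"
  shows "(\<lambda>n. \<Sum>j\<in>S \<inter> {..<n}. w j) \<longlonglongrightarrow> infsum w S"
proof -
  have "((\<lambda>j. if j \<in> S then w j else 0) has_sum infsum w S) UNIV"
    using has_sum_infsum[OF assms] has_sum_cong_neutral[of S UNIV w "\<lambda>j. if j \<in> S then w j else 0"] by auto
  then have "(\<lambda>n. \<Sum>j<n. if j \<in> S then w j else 0) \<longlonglongrightarrow> infsum w S"
    using has_sum_imp_sums unfolding sums_def by blast
  moreover have "(\<Sum>j<n. if j \<in> S then w j else 0) = (\<Sum>j\<in>S \<inter> {..<n}. w j)" for n
    by (simp add: sum.inter_restrict[symmetric] Int_commute)
  ultimately show ?thesis by simp
qed

text \<open>The composition is glued from the countably many maps with the discrete coordinate held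
  fixed; indexing by \<open>S\<close> restricts the continuity requirement to actual states.\<close>

lemma measurable_compose_switching:
  fixes \<phi> :: "'x::topological_space \<Rightarrow> nat \<Rightarrow> 'b::topological_space"
  assumes \<phi>: "\<And>i. i \<in> S \<Longrightarrow> continuous_on UNIV (\<lambda>x. \<phi> x i)"
    and x: "x \<in> borel_measurable N" and y: "y \<in> measurable N (count_space UNIV)"
    and yS: "\<And>w. w \<in> space N \<Longrightarrow> y w \<in> S"
  shows "(\<lambda>w. \<phi> (x w) (y w)) \<in> borel_measurable N"
proof (rule measurable_compose_countable'[where f="\<lambda>i w. \<phi> (x w) i" and I=S])
  show "y \<in> measurable N (count_space S)"
    using y yS by (auto simp: measurable_def)
  show "(\<lambda>w. \<phi> (x w) i) \<in> borel_measurable N" if "i \<in> S" for i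
    using measurable_compose[OF x borel_measurable_continuous_onI[OF \<phi>[OF that]]] by simp
qed auto

lemma lipschitz_continuous_on:
  fixes f :: "'x::real_normed_vector \<Rightarrow> 'y::real_normed_vector"
  assumes "\<And>x y. norm (f x - f y) \<le> L * norm (x - y)"
  shows "continuous_on UNIV f"
proof -
  \<comment> \<open>Lipschitz constants are nonnegative by definition, whereas the sign of
    \<open>L\<close> is open here.\<close>
  have "(max L 0)-lipschitz_on UNIV f"
  proof (rule lipschitz_onI)
    fix x y :: 'x
    have "L * norm (x - y) \<le> max L 0 * norm (x - y)" by (intro mult_right_mono) auto
    then show "dist (f x) (f y) \<le> max L 0 * dist x y"
      using assms[of x y] by (simp add: dist_norm)
  qed simp
  then show ?thesis by (rule lipschitz_on_continuous_on)
qed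

lemma abs_summable_term_le:
  fixes w :: "nat \<Rightarrow> real"
  assumes "w abs_summable_on S" "j \<in> S"
  shows "\<bar>w j\<bar> \<le> (\<Sum>\<^sub>\<infinity>j\<in>S. \<bar>w j\<bar>)"
  using finite_sum_le_infsum[of "\<lambda>j. \<bar>w j\<bar>" S "{j}"] assms by simp

locale switching_diffusion =
  averaging_coefficients S b \<sigma> Q \<pi> K1 K2 K3 C c1 lam + filtered_brownian_motion M F W
  for S :: "nat set" and b :: "real^'d \<Rightarrow> nat \<Rightarrow> real^'d" and \<sigma> :: "real^'d \<Rightarrow> nat \<Rightarrow> real^'m^'d"
    and Q :: "real^'d \<Rightarrow> nat \<Rightarrow> nat \<Rightarrow> real" and \<pi> :: "real^'d \<Rightarrow> nat \<Rightarrow> real"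
    and K1 K2 K3 C c1 lam :: real
    and M :: "'a measure" and F :: "real \<Rightarrow> 'a measure" and W :: "real \<Rightarrow> 'a \<Rightarrow> real^'m" +
  fixes X :: "real \<Rightarrow> 'a \<Rightarrow> real^'d" and Y :: "real \<Rightarrow> 'a \<Rightarrow> nat" and x0 :: "real^'d" and i0 :: nat
    and \<epsilon> \<alpha> :: real
  assumes \<epsilon>_pos: "0 < \<epsilon>" and \<alpha>_pos: "0 < \<alpha>"
    and solution: "sde_solution M F W X Y S b \<sigma> Q x0 i0 \<epsilon> \<alpha>"
begin

lemma X_adapted: "0 \<le> t \<Longrightarrow> X t \<in> borel_measurable (F t)"
  using solution[unfolded sde_solution_def, THEN conjunct2, THEN conjunct2, THEN conjunct2,
     THEN conjunct1] by simp

lemma Y_adapted: "0 \<le> t \<Longrightarrow> Y t \<in> measurable (F t) (count_space UNIV)"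
  using solution[unfolded sde_solution_def, THEN conjunct2, THEN conjunct2, THEN conjunct2,
     THEN conjunct1] by simp

lemma X_continuous: "\<omega> \<in> space M \<Longrightarrow> continuous_on {0..} (\<lambda>t. X t \<omega>)"
  using solution[unfolded sde_solution_def, THEN conjunct2, THEN conjunct2, THEN conjunct2,
     THEN conjunct2, THEN conjunct1] by simp

lemma Y_in_S: "\<omega> \<in> space M \<Longrightarrow> 0 \<le> t \<Longrightarrow> Y t \<omega> \<in> S"
  using solution[unfolded sde_solution_def, THEN conjunct2, THEN conjunct2, THEN conjunct2,
     THEN conjunct2, THEN conjunct1] by simp

lemma Y_cadlag: "\<omega> \<in> space M \<Longrightarrow> cadlag_discrete (\<lambda>t. Y t \<omega>)"
  using solution[unfolded sde_solution_def, THEN conjunct2, THEN conjunct2, THEN conjunct2,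
     THEN conjunct2, THEN conjunct1] by simp

lemma ito_equation: "0 \<le> t \<Longrightarrow> \<exists>I. ito_integral_is M (\<lambda>s \<omega>. \<sigma> (X s \<omega>) (Y s \<omega>)) W t I \<and>
    (AE \<omega> in M. X t \<omega> = x0 + integral {0..t} (\<lambda>s. b (X s \<omega>) (Y s \<omega>)) + sqrt \<epsilon> *\<^sub>R I \<omega>)"
  by (rule solution[unfolded sde_solution_def, THEN conjunct2, THEN conjunct2, THEN conjunct2,
     THEN conjunct2, THEN conjunct2, THEN conjunct1, rule_format])

lemma jump_rule: "j \<in> S \<Longrightarrow> martingale_wrt M F
    (\<lambda>t \<omega>. (if Y t \<omega> = j then 1 else 0) - integral {0..t} (\<lambda>s. Q (X s \<omega>) (Y s \<omega>) j / \<alpha>))"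
  by (rule solution[unfolded sde_solution_def, THEN conjunct2, THEN conjunct2, THEN conjunct2,
     THEN conjunct2, THEN conjunct2, THEN conjunct2, rule_format])

lemma b_continuous: "i \<in> S \<Longrightarrow> continuous_on UNIV (\<lambda>x. b x i)"
  by (rule lipschitz_continuous_on[OF b_lipschitz])

lemma \<sigma>_continuous: "i \<in> S \<Longrightarrow> continuous_on UNIV (\<lambda>x. \<sigma> x i)"
  by (rule lipschitz_continuous_on[OF \<sigma>_lipschitz])

lemma Q_continuous:
  assumes "i \<in> S" "j \<in> S"
  shows "continuous_on UNIV (\<lambda>x. Q x i j)"
proof (rule lipschitz_continuous_on)
  fix x y
  show "norm (Q x i j - Q y i j) \<le> K3 * norm (x - y)"
    using abs_summable_term_le[OF row_boundedD(1)[OF Q_lipschitz assms(1)] assms(2), of x y]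
      row_boundedD(2)[OF Q_lipschitz assms(1), of x y] by simp
qed

lemma Q_entry_bounded:
  assumes "i \<in> S" "j \<in> S"
  shows "\<bar>Q x i j\<bar> \<le> C"
  using abs_summable_term_le[OF row_boundedD(1)[OF Q_bounded assms(1)] assms(2), of x]
      row_boundedD(2)[OF Q_bounded assms(1), of x] by simp

lemma mean_drift_continuous: "continuous_on UNIV mean_drift"
  using mean_drift_lipschitz lipschitz_continuous_on[of mean_drift] by auto

lemma X_joint: "jointly_measurable M X"
proof (rule jointly_measurable_right_continuous)
  fix r :: real and \<omega> assume r: "0 \<le> r" and \<omega>: "\<omega> \<in> space M"
  have "((\<lambda>u. X u \<omega>) \<longlongrightarrow> X r \<omega>) (at r within {0..})"
    using X_continuous[OF \<omega>] r by (simp add: continuous_on)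
  then show "((\<lambda>u. X u \<omega>) \<longlongrightarrow> X r \<omega>) (at_right r)"
    by (rule tendsto_within_subset) (use r in auto)
qed (rule measurable_F_M[OF X_adapted])

text \<open>Embedding the states into the reals makes the approximation of right-continuous
  processes applicable, since the paths are locally constant to the right; rounding down recovers
  the discrete sigma-algebra.\<close>

lemma Y_joint:
  "(\<lambda>p. Y (max 0 (fst p)) (snd p)) \<in> measurable (borel \<Otimes>\<^sub>M M) (count_space UNIV)"
proof -
  have "jointly_measurable M (\<lambda>r \<omega>. real (Y r \<omega>))"
  proof (rule jointly_measurable_right_continuous)
    fix r :: real and \<omega> assume r: "0 \<le> r" and \<omega>: "\<omega> \<in> space M"
    obtain d where d: "0 < d" "\<And>u. r \<le> u \<Longrightarrow> u < r + d \<Longrightarrow> Y u \<omega> = Y r \<omega>"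
      using Y_cadlag[OF \<omega>] r unfolding cadlag_discrete_def by blast
    have "eventually (\<lambda>u. real (Y u \<omega>) = real (Y r \<omega>)) (at_right r)"
      unfolding eventually_at_right_field
    proof (intro exI[of _ "r + d"] conjI allI impI)
      fix u assume "r < u" "u < r + d"
      then show "real (Y u \<omega>) = real (Y r \<omega>)" using d(2)[of u] by simp
    qed (use d(1) in simp)
    then show "((\<lambda>u. real (Y u \<omega>)) \<longlongrightarrow> real (Y r \<omega>)) (at_right r)"
      by (rule tendsto_eventually)
  next
    show "(\<lambda>\<omega>. real (Y r \<omega>)) \<in> borel_measurable M" if "0 \<le> r" for r
      using measurable_compose[OF measurable_F_M[OF Y_adapted[OF that] that], of real borel] by simp
  qed
  then have "(\<lambda>p. real (Y (max 0 (fst p)) (snd p))) \<in> borel_measurable (borel \<Otimes>\<^sub>M M)"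
    by (simp add: jointly_measurable_def case_prod_unfold)
  then have "(\<lambda>p. nat \<lfloor>real (Y (max 0 (fst p)) (snd p))\<rfloor>) \<in> measurable (borel \<Otimes>\<^sub>M M) (count_space UNIV)"
    by measurable
  then show ?thesis by simp
qed

lemma switching_joint:
  fixes \<phi> :: "real^'d \<Rightarrow> nat \<Rightarrow> 'b::topological_space"
  assumes "\<And>i. i \<in> S \<Longrightarrow> continuous_on UNIV (\<lambda>x. \<phi> x i)"
  shows "jointly_measurable M (\<lambda>r \<omega>. \<phi> (X r \<omega>) (Y r \<omega>))"
  unfolding jointly_measurable_def case_prod_unfold
  by (rule measurable_compose_switching[OF assms _ Y_joint])
    (use X_joint in \<open>auto simp: jointly_measurable_def case_prod_unfold space_pair_measure intro: Y_in_S\<close>)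

lemma switching_adapted:
  fixes \<phi> :: "real^'d \<Rightarrow> nat \<Rightarrow> 'b::topological_space"
  assumes "\<And>i. i \<in> S \<Longrightarrow> continuous_on UNIV (\<lambda>x. \<phi> x i)" and r: "0 \<le> r"
  shows "(\<lambda>\<omega>. \<phi> (X r \<omega>) (Y r \<omega>)) \<in> borel_measurable (F r)"
  by (rule measurable_compose_switching[OF assms(1) X_adapted[OF r] Y_adapted[OF r]])
    (use r space_F[OF r] in \<open>auto intro: Y_in_S\<close>)

text \<open>The increment over [s, u] of the Dynkin martingale of the function \<open>G\<close>.
  This function may be random as long as it is known at time s, as for the corrector at
  \<open>X s\<close>.\<close>

definition increment :: "(nat \<Rightarrow> 'a \<Rightarrow> real) \<Rightarrow> real \<Rightarrow> real \<Rightarrow> 'a \<Rightarrow> real" where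
  "increment G s u \<omega> = G (Y u \<omega>) \<omega> - G (Y s \<omega>) \<omega>
     - integral {s..u} (\<lambda>r. kapply S (Q (X r \<omega>)) (\<lambda>j. G j \<omega>) (Y r \<omega>)) / \<alpha>"

context
  fixes G :: "nat \<Rightarrow> 'a \<Rightarrow> real" and s u B :: real
  assumes G: "\<And>j. j \<in> S \<Longrightarrow> G j \<in> borel_measurable (F s)"
    and G_bounded: "\<And>j \<omega>. j \<in> S \<Longrightarrow> \<omega> \<in> space M \<Longrightarrow> \<bar>G j \<omega>\<bar> \<le> B"
    and s: "0 \<le> s" and su: "s \<le> u"
begin

lemma B_nonneg: "0 \<le> B"
proof -
  obtain i where "i \<in> S" using S_nonempty by auto
  moreover obtain \<omega> where "\<omega> \<in> space M" using not_empty by auto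
  ultimately show ?thesis using G_bounded[of i \<omega>] by linarith
qed

lemma partial_kapply:
  assumes "i \<in> S" "\<omega> \<in> space M"
  shows "\<bar>\<Sum>j\<in>S \<inter> {..<n}. Q x i j * G j \<omega>\<bar> \<le> C * B"
    and "(\<lambda>n. \<Sum>j\<in>S \<inter> {..<n}. Q x i j * G j \<omega>) \<longlonglongrightarrow> kapply S (Q x) (\<lambda>j. G j \<omega>) i"
proof -
  have f: "\<bar>G j \<omega>\<bar> \<le> B" if "j \<in> S" for j using G_bounded[OF that assms(2)] .
  note as = kapply_summable[OF Q_bounded assms(1) f]
  have "\<bar>\<Sum>j\<in>S \<inter> {..<n}. Q x i j * G j \<omega>\<bar> \<le> (\<Sum>j\<in>S \<inter> {..<n}. \<bar>Q x i j * G j \<omega>\<bar>)" by (rule sum_abs)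
  also have "\<dots> \<le> (\<Sum>\<^sub>\<infinity>j\<in>S. \<bar>Q x i j * G j \<omega>\<bar>)"
    using as by (intro finite_sum_le_infsum) auto
  also have "\<dots> \<le> (\<Sum>\<^sub>\<infinity>j\<in>S. \<bar>Q x i j\<bar>) * B"
    by (rule wsum_bound(2)[OF row_boundedD(1)[OF Q_bounded assms(1)] f])
  also have "\<dots> \<le> C * B"
    by (rule mult_right_mono[OF row_boundedD(2)[OF Q_bounded assms(1)] B_nonneg])
  finally show "\<bar>\<Sum>j\<in>S \<inter> {..<n}. Q x i j * G j \<omega>\<bar> \<le> C * B" .
  show "(\<lambda>n. \<Sum>j\<in>S \<inter> {..<n}. Q x i j * G j \<omega>) \<longlonglongrightarrow> kapply S (Q x) (\<lambda>j. G j \<omega>) i"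
    unfolding kapply_def by (rule partial_sums_tendsto_infsum[OF abs_summable_summable[OF as]])
qed

lemma G_measurable_M: "j \<in> S \<Longrightarrow> G j \<in> borel_measurable M"
  by (rule measurable_F_M[OF G s])

lemma kapply_joint:
  "jointly_measurable M (\<lambda>r \<omega>. kapply S (Q (X r \<omega>)) (\<lambda>j. G j \<omega>) (Y r \<omega>))"
  unfolding jointly_measurable_def case_prod_unfold
proof (rule borel_measurable_LIMSEQ_real)
  let ?x = "\<lambda>p. X (max 0 (fst p)) (snd p)" and ?y = "\<lambda>p. Y (max 0 (fst p)) (snd p)"
  show "(\<lambda>p. \<Sum>j\<in>S \<inter> {..<n}. Q (?x p) (?y p) j * G j (snd p))
      \<in> borel_measurable (borel \<Otimes>\<^sub>M M)" for n
  proof (intro borel_measurable_sum borel_measurable_times)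
    fix j assume j: "j \<in> S \<inter> {..<n}"
    show "(\<lambda>p. Q (?x p) (?y p) j) \<in> borel_measurable (borel \<Otimes>\<^sub>M M)"
      using switching_joint[of "\<lambda>x i. Q x i j"] Q_continuous j
      by (simp add: jointly_measurable_def case_prod_unfold)
    show "(\<lambda>p. G j (snd p)) \<in> borel_measurable (borel \<Otimes>\<^sub>M M)"
      by (rule measurable_compose[OF measurable_snd G_measurable_M]) (use j in simp)
  qed
  show "(\<lambda>n. \<Sum>j\<in>S \<inter> {..<n}. Q (?x p) (?y p) j * G j (snd p))
      \<longlonglongrightarrow> kapply S (Q (?x p)) (\<lambda>j. G j (snd p)) (?y p)"
    if "p \<in> space (borel \<Otimes>\<^sub>M M)" for p :: "real \<times> 'a"
    using that by (intro partial_kapply(2) Y_in_S) (auto simp: space_pair_measure)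
qed

lemma kapply_path_bounded:
  assumes "0 \<le> r" "\<omega> \<in> space M"
  shows "\<bar>kapply S (Q (X r \<omega>)) (\<lambda>j. G j \<omega>) (Y r \<omega>)\<bar> \<le> C * B"
  using kapply_bound[OF Q_bounded Y_in_S[OF assms(2,1)], of "\<lambda>j. G j \<omega>"] G_bounded assms by blast

definition jump_mart :: "nat \<Rightarrow> real \<Rightarrow> 'a \<Rightarrow> real" where
  "jump_mart j t \<omega> = (if Y t \<omega> = j then 1 else 0) - integral {0..t} (\<lambda>r. Q (X r \<omega>) (Y r \<omega>) j / \<alpha>)"

lemma Q_path:
  assumes "j \<in> S" "\<omega> \<in> space M" "0 \<le> v"
  shows "(\<lambda>r. Q (X r \<omega>) (Y r \<omega>) j) integrable_on {v..w}"
proof (rule path_integral(1)[OF switching_joint[of "\<lambda>x i. Q x i j"] _ assms(2,3)])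
  show "norm (Q (X r \<omega>) (Y r \<omega>) j) \<le> C" if "0 \<le> r" for r
    using Q_entry_bounded[OF Y_in_S[OF assms(2) that] assms(1)] by simp
qed (use Q_continuous assms in auto)

lemma jump_mart_diff:
  assumes j: "j \<in> S" and \<omega>: "\<omega> \<in> space M"
  shows "jump_mart j u \<omega> - jump_mart j s \<omega> =
    (if Y u \<omega> = j then 1 else 0) - (if Y s \<omega> = j then 1 else 0)
      - integral {s..u} (\<lambda>r. Q (X r \<omega>) (Y r \<omega>) j) / \<alpha>"
proof -
  have "integral {0..s} (\<lambda>r. Q (X r \<omega>) (Y r \<omega>) j / \<alpha>) + integral {s..u} (\<lambda>r. Q (X r \<omega>) (Y r \<omega>) j / \<alpha>)
      = integral {0..u} (\<lambda>r. Q (X r \<omega>) (Y r \<omega>) j / \<alpha>)"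
    by (rule Henstock_Kurzweil_Integration.integral_combine[OF s su])
      (intro integrable_on_divide Q_path j \<omega>, simp)
  then show ?thesis by (simp add: jump_mart_def)
qed

text \<open>A finite martingale transform: \<open>G\<close> is expanded in indicators of states,
  each contributing its compensated jump martingale with a coefficient fixed at time
  \<open>s\<close>.\<close>

definition partial_incr :: "nat \<Rightarrow> 'a \<Rightarrow> real" where
  "partial_incr n \<omega> = (\<Sum>j\<in>S \<inter> {..<n}. G j \<omega> * (jump_mart j u \<omega> - jump_mart j s \<omega>))"

lemma partial_incr_eq:
  assumes \<omega>: "\<omega> \<in> space M"
  shows "partial_incr n \<omega> = (if Y u \<omega> < n then G (Y u \<omega>) \<omega> else 0) - (if Y s \<omega> < n then G (Y s \<omega>) \<omega> else 0)
      - integral {s..u} (\<lambda>r. \<Sum>j\<in>S \<inter> {..<n}. Q (X r \<omega>) (Y r \<omega>) j * G j \<omega>) / \<alpha>"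
proof -
  have one: "(\<Sum>j\<in>S \<inter> {..<n}. G j \<omega> * (if Y v \<omega> = j then 1 else 0)) = (if Y v \<omega> < n then G (Y v \<omega>) \<omega> else 0)"
    if "0 \<le> v" for v
  proof -
    have "(\<Sum>j\<in>S \<inter> {..<n}. G j \<omega> * (if Y v \<omega> = j then 1 else 0))
        = (\<Sum>j\<in>S \<inter> {..<n}. if Y v \<omega> = j then G j \<omega> else 0)"
      by (intro sum.cong) auto
    then show ?thesis using Y_in_S[OF \<omega> that] by (simp add: sum.delta')
  qed
  have int: "integral {s..u} (\<lambda>r. \<Sum>j\<in>S \<inter> {..<n}. Q (X r \<omega>) (Y r \<omega>) j * G j \<omega>)
     = (\<Sum>j\<in>S \<inter> {..<n}. integral {s..u} (\<lambda>r. Q (X r \<omega>) (Y r \<omega>) j) * G j \<omega>)"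
    by (subst Henstock_Kurzweil_Integration.integral_sum)
      (auto intro!: integrable_on_mult_left Q_path \<omega> s)
  have "partial_incr n \<omega> = (\<Sum>j\<in>S \<inter> {..<n}. G j \<omega> * (if Y u \<omega> = j then 1 else 0)
      - G j \<omega> * (if Y s \<omega> = j then 1 else 0) - integral {s..u} (\<lambda>r. Q (X r \<omega>) (Y r \<omega>) j) * G j \<omega> / \<alpha>)"
    unfolding partial_incr_def
  proof (rule sum.cong[OF refl])
    fix j assume "j \<in> S \<inter> {..<n}"
    then have "j \<in> S" by simp
    show "G j \<omega> * (jump_mart j u \<omega> - jump_mart j s \<omega>) = G j \<omega> * (if Y u \<omega> = j then 1 else 0)
      - G j \<omega> * (if Y s \<omega> = j then 1 else 0) - integral {s..u} (\<lambda>r. Q (X r \<omega>) (Y r \<omega>) j) * G j \<omega> / \<alpha>"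
      unfolding jump_mart_diff[OF \<open>j \<in> S\<close> \<omega>] by (simp add: right_diff_distrib)
  qed
  also have "\<dots> = (\<Sum>j\<in>S \<inter> {..<n}. G j \<omega> * (if Y u \<omega> = j then 1 else 0))
      - (\<Sum>j\<in>S \<inter> {..<n}. G j \<omega> * (if Y s \<omega> = j then 1 else 0))
      - (\<Sum>j\<in>S \<inter> {..<n}. integral {s..u} (\<lambda>r. Q (X r \<omega>) (Y r \<omega>) j) * G j \<omega>) / \<alpha>"
    by (simp only: sum_subtractf sum_divide_distrib)
  finally show ?thesis using one[of u] one[of s] s su int by simp
qed

lemma partial_kapply_path:
  assumes "\<omega> \<in> space M"
  shows "(\<lambda>r. \<Sum>j\<in>S \<inter> {..<n}. Q (X r \<omega>) (Y r \<omega>) j * G j \<omega>) integrable_on {s..u}"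
  using assms s by (intro integrable_sum integrable_on_mult_left Q_path) auto

text \<open>The two boundary terms are eventually constant in \<open>n\<close>, and
  \<open>C * B\<close> dominates the integrand, so only the time integral calls for a convergence
  theorem.\<close>

lemma partial_incr_tendsto:
  assumes \<omega>: "\<omega> \<in> space M"
  shows "(\<lambda>n. partial_incr n \<omega>) \<longlonglongrightarrow> increment G s u \<omega>"
proof -
  have ev: "(\<lambda>n. if i < n then c else (0::real)) \<longlonglongrightarrow> c" for i :: nat and c
    by (rule tendsto_eventually, rule eventually_sequentiallyI[of "Suc i"]) simp
  have "(\<lambda>n. integral {s..u} (\<lambda>r. \<Sum>j\<in>S \<inter> {..<n}. Q (X r \<omega>) (Y r \<omega>) j * G j \<omega>)) \<longlonglongrightarrow>
     integral {s..u} (\<lambda>r. kapply S (Q (X r \<omega>)) (\<lambda>j. G j \<omega>) (Y r \<omega>))"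
  proof (rule dominated_convergence(2)[OF partial_kapply_path[OF \<omega>] integrable_const_ivl])
    show "norm (\<Sum>j\<in>S \<inter> {..<n}. Q (X r \<omega>) (Y r \<omega>) j * G j \<omega>) \<le> C * B" if "r \<in> {s..u}" for n r
      using partial_kapply(1)[OF Y_in_S[OF \<omega>] \<omega>, of r] that s by simp
    show "(\<lambda>n. \<Sum>j\<in>S \<inter> {..<n}. Q (X r \<omega>) (Y r \<omega>) j * G j \<omega>) \<longlonglongrightarrow> kapply S (Q (X r \<omega>)) (\<lambda>j. G j \<omega>) (Y r \<omega>)"
      if "r \<in> {s..u}" for r
      using partial_kapply(2)[OF Y_in_S[OF \<omega>] \<omega>, of r] that s by simp
  qed
  then show ?thesis
    unfolding partial_incr_eq[OF \<omega>] increment_def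
    by (intro tendsto_diff ev tendsto_divide tendsto_const) (use \<alpha>_pos in auto)
qed

text \<open>Uniform in the truncation, this is both the majorant for dominated convergence and, in
  the limit, the bound for \<open>increment\<close>. For intervals of length at most \<alpha> it
  does not depend on \<alpha>.\<close>

lemma partial_incr_bounded:
  assumes \<omega>: "\<omega> \<in> space M"
  shows "\<bar>partial_incr n \<omega>\<bar> \<le> 2 * B + C * B * (u - s) / \<alpha>"
proof -
  have 1: "\<bar>if Y v \<omega> < n then G (Y v \<omega>) \<omega> else 0\<bar> \<le> B" if "0 \<le> v" for v
    using G_bounded[OF Y_in_S[OF \<omega> that] \<omega>] B_nonneg by simp
  have "norm (integral {s..u} (\<lambda>r. \<Sum>j\<in>S \<inter> {..<n}. Q (X r \<omega>) (Y r \<omega>) j * G j \<omega>)) \<le> integral {s..u} (\<lambda>r. C * B)"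
    using partial_kapply(1)[OF Y_in_S[OF \<omega>] \<omega>] s
    by (intro integral_norm_bound_integral partial_kapply_path[OF \<omega>]) auto
  also have "\<dots> = C * B * (u - s)" using su by simp
  finally have "\<bar>integral {s..u} (\<lambda>r. \<Sum>j\<in>S \<inter> {..<n}. Q (X r \<omega>) (Y r \<omega>) j * G j \<omega>) / \<alpha>\<bar> \<le> C * B * (u - s) / \<alpha>"
    using \<alpha>_pos by (simp add: divide_right_mono)
  then show ?thesis
    unfolding partial_incr_eq[OF \<omega>] using 1[of u] 1[of s] s su by linarith
qed

lemma increment_le:
  assumes "\<omega> \<in> space M"
  shows "\<bar>increment G s u \<omega>\<bar> \<le> 2 * B + C * B * (u - s) / \<alpha>"
  by (rule LIMSEQ_le_const2[OF tendsto_rabs[OF partial_incr_tendsto[OF assms]]])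
    (use partial_incr_bounded[OF assms] in auto)

lemma jump_mart_adapted:
  assumes "j \<in> S" "0 \<le> t"
  shows "jump_mart j t \<in> borel_measurable (F t)" "integrable M (jump_mart j t)"
  using jump_rule[OF assms(1)] assms(2) unfolding martingale_wrt_def jump_mart_def[abs_def] by auto

lemma partial_incr_measurable: "partial_incr n \<in> borel_measurable (F u)"
  unfolding partial_incr_def[abs_def]
proof (intro borel_measurable_sum borel_measurable_times borel_measurable_diff)
  fix j assume "j \<in> S \<inter> {..<n}"
  then have j: "j \<in> S" by simp
  show "G j \<in> borel_measurable (F u)" by (rule measurable_F_mono[OF G[OF j] s su])
  show "jump_mart j u \<in> borel_measurable (F u)" by (rule jump_mart_adapted(1)[OF j]) (use s su in simp)
  show "jump_mart j s \<in> borel_measurable (F u)" by (rule measurable_F_mono[OF jump_mart_adapted(1)[OF j s] s su])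
qed

lemma increment_adapted: "increment G s u \<in> borel_measurable (F u)"
  by (rule borel_measurable_LIMSEQ_real[OF partial_incr_tendsto partial_incr_measurable])
    (use space_F[of u] s su in simp)

text \<open>Truncated, this is a sum of martingale increments with bounded coefficients known at
  time \<open>s\<close>, so each expectation vanishes; dominated convergence removes the truncation.
  The intended \<open>U\<close> is an increment over an earlier interval, which is bounded.\<close>

lemma increment_orthogonal_past:
  assumes U: "U \<in> borel_measurable (F s)" and Ub: "\<And>\<omega>. \<omega> \<in> space M \<Longrightarrow> \<bar>U \<omega>\<bar> \<le> K"
  shows "expectation (\<lambda>\<omega>. U \<omega> * increment G s u \<omega>) = 0"
proof -
  have u: "0 \<le> u" using s su by simp
  have UM: "U \<in> borel_measurable M" by (rule measurable_F_M[OF U s])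
  have term0: "integrable M (\<lambda>\<omega>. U \<omega> * G j \<omega> * (jump_mart j u \<omega> - jump_mart j s \<omega>)) \<and>
      expectation (\<lambda>\<omega>. U \<omega> * G j \<omega> * (jump_mart j u \<omega> - jump_mart j s \<omega>)) = 0" if j: "j \<in> S" for j
  proof -
    let ?f = "\<lambda>\<omega>. jump_mart j u \<omega> - jump_mart j s \<omega>"
    have f: "integrable M ?f" using jump_mart_adapted(2)[OF j] s u by simp
    have V: "(\<lambda>\<omega>. U \<omega> * G j \<omega>) \<in> borel_measurable (F s)" using U G[OF j] by simp
    have Vf: "integrable M (\<lambda>\<omega>. U \<omega> * G j \<omega> * ?f \<omega>)"
    proof (rule Bochner_Integration.integrable_bound[of M "\<lambda>\<omega>. (K * B) * ?f \<omega>"])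
      show "integrable M (\<lambda>\<omega>. (K * B) * ?f \<omega>)" using f by simp
      show "(\<lambda>\<omega>. U \<omega> * G j \<omega> * ?f \<omega>) \<in> borel_measurable M"
        using borel_measurable_times[OF measurable_F_M[OF V s] borel_measurable_integrable[OF f]] .
      show "AE \<omega> in M. norm (U \<omega> * G j \<omega> * ?f \<omega>) \<le> norm ((K * B) * ?f \<omega>)"
      proof (rule AE_I2)
        fix \<omega> assume \<omega>: "\<omega> \<in> space M"
        have "\<bar>U \<omega>\<bar> * \<bar>G j \<omega>\<bar> \<le> K * B"
          using Ub[OF \<omega>] G_bounded[OF j \<omega>] B_nonneg by (intro mult_mono) auto
        then have "\<bar>U \<omega>\<bar> * \<bar>G j \<omega>\<bar> * \<bar>?f \<omega>\<bar> \<le> \<bar>K * B\<bar> * \<bar>?f \<omega>\<bar>" by (intro mult_right_mono) auto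
        then show "norm (U \<omega> * G j \<omega> * ?f \<omega>) \<le> norm ((K * B) * ?f \<omega>)" by (simp add: abs_mult)
      qed
    qed
    have "expectation (\<lambda>\<omega>. U \<omega> * G j \<omega> * ?f \<omega>) = 0"
    proof (rule expectation_mult_eq_0[OF subalg[OF s] f _ V Vf])
      fix A assume A: "A \<in> sets (F s)"
      have AM: "A \<in> sets M" using subalg[OF s] A by (auto simp: subalgebra_def)
      have "set_lebesgue_integral M A (jump_mart j u) = set_lebesgue_integral M A (jump_mart j s)"
        using jump_rule[OF j] A s su unfolding martingale_wrt_def jump_mart_def[abs_def] by blast
      then show "set_lebesgue_integral M A ?f = 0"
        using set_integral_diff(2)[of M A "jump_mart j u" "jump_mart j s"]
          integrable_mult_indicator[OF AM jump_mart_adapted(2)[OF j s]]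
          integrable_mult_indicator[OF AM jump_mart_adapted(2)[OF j u]]
        by (simp add: set_integrable_def)
    qed
    with Vf show ?thesis by simp
  qed
  have eq: "U \<omega> * partial_incr n \<omega> = (\<Sum>j\<in>S \<inter> {..<n}. U \<omega> * G j \<omega> * (jump_mart j u \<omega> - jump_mart j s \<omega>))" for n \<omega>
    by (simp add: partial_incr_def sum_distrib_left mult.assoc)
  have zero: "expectation (\<lambda>\<omega>. U \<omega> * partial_incr n \<omega>) = 0" for n
    unfolding eq using term0 by (subst Bochner_Integration.integral_sum) auto
  have "(\<lambda>n. expectation (\<lambda>\<omega>. U \<omega> * partial_incr n \<omega>)) \<longlonglongrightarrow> expectation (\<lambda>\<omega>. U \<omega> * increment G s u \<omega>)"
  proof (rule integral_dominated_convergence[where w="\<lambda>_. K * (2 * B + C * B * (u - s) / \<alpha>)"])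
    show "(\<lambda>\<omega>. U \<omega> * increment G s u \<omega>) \<in> borel_measurable M"
      using UM measurable_F_M[OF increment_adapted u] by simp
    show "(\<lambda>\<omega>. U \<omega> * partial_incr n \<omega>) \<in> borel_measurable M" for n
      using UM measurable_F_M[OF partial_incr_measurable u] by simp
    show "AE \<omega> in M. (\<lambda>n. U \<omega> * partial_incr n \<omega>) \<longlonglongrightarrow> U \<omega> * increment G s u \<omega>"
      by (intro AE_I2 tendsto_mult_left partial_incr_tendsto)
    show "AE \<omega> in M. norm (U \<omega> * partial_incr n \<omega>) \<le> K * (2 * B + C * B * (u - s) / \<alpha>)" for n
    proof (rule AE_I2)
      fix \<omega> assume \<omega>: "\<omega> \<in> space M"
      show "norm (U \<omega> * partial_incr n \<omega>) \<le> K * (2 * B + C * B * (u - s) / \<alpha>)"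
        unfolding real_norm_def abs_mult
        using Ub[OF \<omega>] by (intro mult_mono partial_incr_bounded[OF \<omega>]) auto
    qed
  qed simp
  then have "(\<lambda>n::nat. 0) \<longlonglongrightarrow> expectation (\<lambda>\<omega>. U \<omega> * increment G s u \<omega>)" unfolding zero .
  from LIMSEQ_unique[OF this tendsto_const] show ?thesis .
qed

end

end

section \<open>The averaging estimate\<close>

context switching_diffusion begin

text \<open>The bound of \<open>ito_integral_bound\<close> with K = K2. It increases with time, so
  its value at the final time serves the whole interval.\<close>

definition noise :: "real \<Rightarrow> real" where
  "noise t = real CARD('d) * (1 + K2\<^sup>2 * var_rate * t)"

lemma noise_nonneg: "0 \<le> t \<Longrightarrow> 0 \<le> noise t"
  by (simp add: noise_def var_rate_nonneg)

text \<open>The absolutely continuous part of X. Its paths are Lipschitz with the deterministic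
  constant \<open>K2\<close>, and at each fixed time it differs from X almost surely by the
  stochastic integral, of order \<open>sqrt \<epsilon>\<close> in mean.\<close>

definition drift :: "real \<Rightarrow> 'a \<Rightarrow> real^'d" where
  "drift r \<omega> = x0 + integral {0..r} (\<lambda>v. b (X v \<omega>) (Y v \<omega>))"

lemma b_joint: "jointly_measurable M (\<lambda>r \<omega>. b (X r \<omega>) (Y r \<omega>))"
  by (rule switching_joint[OF b_continuous])

lemma b_comp_joint: "jointly_measurable M (\<lambda>r \<omega>. b (X r \<omega>) (Y r \<omega>) $ a)"
  by (rule switching_joint)
    (rule bounded_linear.continuous_on[OF bounded_linear_vec_nth b_continuous])

lemma b_path:
  assumes "\<omega> \<in> space M" "0 \<le> s"
  shows "(\<lambda>v. b (X v \<omega>) (Y v \<omega>)) integrable_on {s..r}"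
    and "s \<le> r \<Longrightarrow> norm (integral {s..r} (\<lambda>v. b (X v \<omega>) (Y v \<omega>))) \<le> K2 * (r - s)"
  by (rule path_integral[OF b_joint b_bounded[OF Y_in_S[OF assms(1)]] assms], assumption)+

lemma drift_path_lipschitz:
  assumes "\<omega> \<in> space M" "0 \<le> s" "s \<le> r"
  shows "norm (drift r \<omega> - drift s \<omega>) \<le> K2 * (r - s)"
proof -
  have "drift r \<omega> - drift s \<omega> = integral {s..r} (\<lambda>v. b (X v \<omega>) (Y v \<omega>))"
    using Henstock_Kurzweil_Integration.integral_combine[OF assms(2,3) b_path(1)[OF assms(1) order_refl]]
    by (simp add: drift_def algebra_simps)
  then show ?thesis using b_path(2)[OF assms] by simp
qed

lemma drift_path_measurable:
  assumes r: "0 \<le> r"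
  shows "drift r \<in> borel_measurable M"
proof (subst borel_measurable_euclidean_space, intro ballI)
  fix i :: "real^'d" assume "i \<in> Basis"
  then obtain a where i: "i = axis a 1" by (auto simp: Basis_vec_def)
  have "integrable M (\<lambda>\<omega>. integral {0..r} (\<lambda>v. b (X v \<omega>) (Y v \<omega>) $ a))"
    by (rule expectation_path(1)[OF b_comp_joint b_comp_bounded[OF Y_in_S] order_refl r])
  then have "(\<lambda>\<omega>. x0 $ a + integral {0..r} (\<lambda>v. b (X v \<omega>) (Y v \<omega>) $ a)) \<in> borel_measurable M"
    by (intro borel_measurable_add) auto
  moreover have "drift r \<omega> \<bullet> i = x0 $ a + integral {0..r} (\<lambda>v. b (X v \<omega>) (Y v \<omega>) $ a)" if "\<omega> \<in> space M" for \<omega>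
    using integral_component_eq_cart[OF b_path(1)[OF that order_refl, of r], of a]
    by (simp add: drift_def i inner_axis)
  ultimately show "(\<lambda>\<omega>. drift r \<omega> \<bullet> i) \<in> borel_measurable M"
    by (simp cong: measurable_cong)
qed

lemma X_measurable: "0 \<le> r \<Longrightarrow> X r \<in> borel_measurable M"
  by (rule measurable_F_M[OF X_adapted])

lemma noise_bound:
  assumes r: "0 \<le> r" "r \<le> t"
  shows "integrable M (\<lambda>\<omega>. norm (X r \<omega> - drift r \<omega>))"
    and "expectation (\<lambda>\<omega>. norm (X r \<omega> - drift r \<omega>)) \<le> sqrt \<epsilon> * noise t"
proof -
  obtain I where I: "ito_integral_is M (\<lambda>s \<omega>. \<sigma> (X s \<omega>) (Y s \<omega>)) W r I"
    and eq: "AE \<omega> in M. X r \<omega> = drift r \<omega> + sqrt \<epsilon> *\<^sub>R I \<omega>"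
    using ito_equation[OF r(1)] unfolding drift_def by blast
  have Im: "I \<in> borel_measurable M" using I by (simp add: ito_integral_is_def)
  note ib = ito_integral_bound[OF switching_adapted[OF \<sigma>_continuous] \<sigma>_bounded[OF Y_in_S] I r(1)]
  have ae: "AE \<omega> in M. norm (X r \<omega> - drift r \<omega>) = sqrt \<epsilon> * norm (I \<omega>)"
    using eq by eventually_elim (use \<epsilon>_pos in simp)
  have m: "(\<lambda>\<omega>. norm (X r \<omega> - drift r \<omega>)) \<in> borel_measurable M"
    using X_measurable[OF r(1)] drift_path_measurable[OF r(1)] by simp
  have m': "(\<lambda>\<omega>. sqrt \<epsilon> * norm (I \<omega>)) \<in> borel_measurable M" using Im by simp
  show "integrable M (\<lambda>\<omega>. norm (X r \<omega> - drift r \<omega>))"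
    using integrable_cong_AE[OF m m' ae] ib(1) by simp
  have "expectation (\<lambda>\<omega>. norm (X r \<omega> - drift r \<omega>)) = sqrt \<epsilon> * expectation (\<lambda>\<omega>. norm (I \<omega>))"
    using integral_cong_AE[OF m m' ae] by simp
  also have "\<dots> \<le> sqrt \<epsilon> * noise t"
  proof (rule mult_left_mono)
    have "K2\<^sup>2 * var_rate * r \<le> K2\<^sup>2 * var_rate * t"
      using r var_rate_nonneg by (intro mult_left_mono) auto
    then have "real CARD('d) * (1 + K2\<^sup>2 * var_rate * r) \<le> noise t"
      unfolding noise_def by (intro mult_left_mono) auto
    then show "expectation (\<lambda>\<omega>. norm (I \<omega>)) \<le> noise t" using ib(2) by linarith
  qed (use \<epsilon>_pos in simp)
  finally show "expectation (\<lambda>\<omega>. norm (X r \<omega> - drift r \<omega>)) \<le> sqrt \<epsilon> * noise t" .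
qed

text \<open>The stochastic part is bounded at both times separately, so its share does not shrink
  with \<open>r - s\<close>. It is still of order \<open>sqrt \<epsilon>\<close>, and this suffices
  because below such terms are added over n intervals with weight \<alpha>, where n \<alpha> stays
  bounded.\<close>

lemma X_displacement:
  assumes "0 \<le> s" "s \<le> r" "r \<le> t"
  shows "integrable M (\<lambda>\<omega>. norm (X r \<omega> - X s \<omega>))"
    and "expectation (\<lambda>\<omega>. norm (X r \<omega> - X s \<omega>)) \<le> K2 * (r - s) + 2 * (sqrt \<epsilon> * noise t)"
proof -
  have r: "0 \<le> r" and st: "s \<le> t" using assms by auto
  let ?g = "\<lambda>\<omega>. K2 * (r - s) + (norm (X r \<omega> - drift r \<omega>) + norm (X s \<omega> - drift s \<omega>))"
  have gi: "integrable M ?g"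
    using noise_bound(1)[OF r assms(3)] noise_bound(1)[OF assms(1) st] by simp
  have le: "norm (X r \<omega> - X s \<omega>) \<le> ?g \<omega>" if "\<omega> \<in> space M" for \<omega>
  proof -
    have "norm (X r \<omega> - X s \<omega>) =
        norm ((X r \<omega> - drift r \<omega>) - (X s \<omega> - drift s \<omega>) + (drift r \<omega> - drift s \<omega>))"
      by simp
    also have "\<dots> \<le> norm (X r \<omega> - drift r \<omega>) + norm (X s \<omega> - drift s \<omega>)
        + norm (drift r \<omega> - drift s \<omega>)"
      by (rule order_trans[OF norm_triangle_ineq add_right_mono[OF norm_triangle_ineq4]])
    finally show ?thesis using drift_path_lipschitz[OF that assms(1,2)] by linarith
  qed
  show i: "integrable M (\<lambda>\<omega>. norm (X r \<omega> - X s \<omega>))"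
  proof (rule Bochner_Integration.integrable_bound[OF gi])
    show "(\<lambda>\<omega>. norm (X r \<omega> - X s \<omega>)) \<in> borel_measurable M"
      using X_measurable[OF r] X_measurable[OF assms(1)] by simp
    show "AE \<omega> in M. norm (norm (X r \<omega> - X s \<omega>)) \<le> norm (?g \<omega>)"
      using le by (intro AE_I2) (simp add: order_trans[OF _ abs_ge_self])
  qed
  have "expectation (\<lambda>\<omega>. norm (X r \<omega> - X s \<omega>)) \<le> expectation ?g"
    by (rule integral_mono[OF i gi le])
  also have "\<dots> = K2 * (r - s) + (expectation (\<lambda>\<omega>. norm (X r \<omega> - drift r \<omega>))
      + expectation (\<lambda>\<omega>. norm (X s \<omega> - drift s \<omega>)))"
    using noise_bound(1)[OF r assms(3)] noise_bound(1)[OF assms(1) st] by (simp add: prob_space)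
  also have "\<dots> \<le> K2 * (r - s) + 2 * (sqrt \<epsilon> * noise t)"
    using noise_bound(2)[OF r assms(3)] noise_bound(2)[OF assms(1) st] by linarith
  finally show "expectation (\<lambda>\<omega>. norm (X r \<omega> - X s \<omega>)) \<le> K2 * (r - s) + 2 * (sqrt \<epsilon> * noise t)" .
qed

section \<open>The corrector frozen at the left end point of an interval\<close>

definition frozen :: "real \<Rightarrow> 'd \<Rightarrow> real \<Rightarrow> nat \<Rightarrow> 'a \<Rightarrow> real" where
  "frozen T a s j \<omega> = corrector T a (X s \<omega>) j"

context
  fixes T :: real and a :: 'd
  assumes T: "0 < T"
begin

lemma frozen_measurable:
  assumes "0 \<le> s" "j \<in> S"
  shows "frozen T a s j \<in> borel_measurable (F s)"
proof -
  have "continuous_on UNIV (\<lambda>x. corrector T a x j)"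
    by (rule lipschitz_continuous_on) (use corrector_lipschitz[OF less_imp_le[OF T] assms(2)] in \<open>simp only: real_norm_def\<close>)
  from measurable_compose[OF X_adapted[OF assms(1)] borel_measurable_continuous_onI[OF this]]
  show ?thesis unfolding frozen_def[abs_def] .
qed

lemma frozen_bounded: "j \<in> S \<Longrightarrow> \<bar>frozen T a s j \<omega>\<bar> \<le> exp (C * T) * K2"
  unfolding frozen_def using T by (intro corrector_bounded) auto

lemmas fc = frozen_measurable frozen_bounded

definition fluct :: "real \<Rightarrow> 'a \<Rightarrow> real" where
  "fluct r \<omega> = b (X r \<omega>) (Y r \<omega>) $ a - mean_drift (X r \<omega>) $ a"

lemma fluct_joint: "jointly_measurable M fluct"
  unfolding fluct_def[abs_def]
  by (rule switching_joint)
    (intro continuous_on_diff bounded_linear.continuous_on[OF bounded_linear_vec_nth]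
      b_continuous mean_drift_continuous)

lemma fluct_bounded: "\<omega> \<in> space M \<Longrightarrow> 0 \<le> r \<Longrightarrow> \<bar>fluct r \<omega>\<bar> \<le> 2 * K2"
  unfolding fluct_def
  using b_comp_bounded[OF Y_in_S, of \<omega> r "X r \<omega>" a] mean_drift_bounded[of "X r \<omega>"]
    component_le_norm_cart[of "mean_drift (X r \<omega>)" a] by linarith

definition residual :: "real \<Rightarrow> real \<Rightarrow> 'a \<Rightarrow> real" where
  "residual s r \<omega> = fluct r \<omega> + kapply S (Q (X r \<omega>)) (\<lambda>j. frozen T a s j \<omega>) (Y r \<omega>)"

text \<open>\<open>bias\<close> is the ergodic error, the only constant that decays as T grows;
  \<open>lip\<close> and \<open>bnd\<close> are the Lipschitz constant and the supremum bound of the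
  corrector.\<close>

definition bias :: real where "bias = c1 * exp (- lam * T) * K2"
definition lip :: real where "lip = exp (2 * C * T) * (K1 + K3 * K2)"
definition bnd :: real where "bnd = exp (C * T) * K2"

lemma const_nonneg: "0 \<le> bias" "0 \<le> lip" "0 \<le> bnd"
  using constants by (auto simp: bias_def lip_def bnd_def)

lemma residual_le:
  assumes "\<omega> \<in> space M" "0 \<le> r"
  shows "\<bar>residual s r \<omega>\<bar> \<le> bias + C * lip * norm (X r \<omega> - X s \<omega>)"
  unfolding residual_def fluct_def bias_def lip_def frozen_def
  by (rule corrector_equation[OF T Y_in_S[OF assms]])

lemma frozen_kapply_joint:
  assumes "0 \<le> s"
  shows "jointly_measurable M (\<lambda>r \<omega>. kapply S (Q (X r \<omega>)) (\<lambda>j. frozen T a s j \<omega>) (Y r \<omega>))"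
  by (rule kapply_joint[OF fc(1)[OF assms] fc(2) assms order_refl])

lemma frozen_kapply_bounded:
  assumes "\<omega> \<in> space M" "0 \<le> s" "0 \<le> r"
  shows "\<bar>kapply S (Q (X r \<omega>)) (\<lambda>j. frozen T a s j \<omega>) (Y r \<omega>)\<bar> \<le> C * bnd"
  unfolding bnd_def
  by (rule kapply_path_bounded[OF fc(1)[OF assms(2)] fc(2) assms(2) order_refl assms(3,1)])

lemma residual_joint:
  assumes "0 \<le> s"
  shows "jointly_measurable M (residual s)"
  using fluct_joint frozen_kapply_joint[OF assms]
  unfolding residual_def[abs_def] jointly_measurable_def case_prod_unfold by (rule borel_measurable_add)

lemma residual_int:
  assumes "0 \<le> s" "s \<le> u" "u \<le> t"
  shows "integrable M (\<lambda>\<omega>. integral {s..u} (\<lambda>r. residual s r \<omega>))"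
    and "expectation (\<lambda>\<omega>. \<bar>integral {s..u} (\<lambda>r. residual s r \<omega>)\<bar>)
      \<le> (bias + C * lip * (K2 * (u - s) + 2 * (sqrt \<epsilon> * noise t))) * (u - s)"
proof -
  have bd: "\<bar>residual s r \<omega>\<bar> \<le> 2 * K2 + C * bnd" if "0 \<le> r" "\<omega> \<in> space M" for r \<omega>
    unfolding residual_def
    using fluct_bounded[OF that(2,1)] frozen_kapply_bounded[OF that(2) assms(1) that(1)] by linarith
  note jm = residual_joint[OF assms(1)]
  show "integrable M (\<lambda>\<omega>. integral {s..u} (\<lambda>r. residual s r \<omega>))"
    by (rule expectation_path(1)[OF jm bd assms(1,2)])
  show "expectation (\<lambda>\<omega>. \<bar>integral {s..u} (\<lambda>r. residual s r \<omega>)\<bar>)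
      \<le> (bias + C * lip * (K2 * (u - s) + 2 * (sqrt \<epsilon> * noise t))) * (u - s)"
  proof (rule expectation_abs_path_integral_le[OF jm bd assms(1,2)])
    fix r assume r: "s \<le> r" "r \<le> u"
    then have r0: "0 \<le> r" and rt: "r \<le> t" using assms by auto
    note di = X_displacement[OF assms(1) r(1) rt]
    have rm: "residual s r \<in> borel_measurable M"
      by (rule jointly_measurable_section[OF jm r0])
    have "integrable M (\<lambda>\<omega>. \<bar>residual s r \<omega>\<bar>)"
      by (rule integrable_abs, rule integrable_const_bound[where B="2 * K2 + C * bnd"])
        (use bd[OF r0] rm in auto)
    then have "expectation (\<lambda>\<omega>. \<bar>residual s r \<omega>\<bar>) \<le> expectation (\<lambda>\<omega>. bias + C * lip * norm (X r \<omega> - X s \<omega>))"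
      using di(1) residual_le[OF _ r0] by (intro integral_mono) auto
    also have "\<dots> = bias + C * lip * expectation (\<lambda>\<omega>. norm (X r \<omega> - X s \<omega>))"
      using di(1) by (simp add: prob_space)
    also have "\<dots> \<le> bias + C * lip * (K2 * (u - s) + 2 * (sqrt \<epsilon> * noise t))"
    proof (intro add_left_mono mult_left_mono)
      have "K2 * (r - s) \<le> K2 * (u - s)" using r constants by (intro mult_left_mono) auto
      then show "expectation (\<lambda>\<omega>. norm (X r \<omega> - X s \<omega>)) \<le> K2 * (u - s) + 2 * (sqrt \<epsilon> * noise t)"
        using di(2) by linarith
    qed (use constants const_nonneg in auto)
    finally show "expectation (\<lambda>\<omega>. \<bar>residual s r \<omega>\<bar>) \<le> bias + C * lip * (K2 * (u - s) + 2 * (sqrt \<epsilon> * noise t))" .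
  qed
qed

lemma fluct_integral_split:
  assumes \<omega>: "\<omega> \<in> space M" and s: "0 \<le> s" "s \<le> u"
  shows "integral {s..u} (\<lambda>r. fluct r \<omega>) = integral {s..u} (\<lambda>r. residual s r \<omega>)
    - \<alpha> * (frozen T a s (Y u \<omega>) \<omega> - frozen T a s (Y s \<omega>) \<omega>)
    + \<alpha> * increment (frozen T a s) s u \<omega>"
proof -
  let ?k = "\<lambda>r. kapply S (Q (X r \<omega>)) (\<lambda>j. frozen T a s j \<omega>) (Y r \<omega>)"
  have 1: "(\<lambda>r. fluct r \<omega>) integrable_on {s..u}"
    by (rule path_integral(1)[OF fluct_joint _ \<omega> s(1), where B="2 * K2"])
      (simp add: fluct_bounded[OF \<omega>])
  have 2: "?k integrable_on {s..u}"
    by (rule path_integral(1)[OF frozen_kapply_joint[OF s(1)] _ \<omega> s(1), where B="C * bnd"])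
      (simp add: frozen_kapply_bounded[OF \<omega> s(1)])
  have "integral {s..u} (\<lambda>r. residual s r \<omega>) = integral {s..u} (\<lambda>r. fluct r \<omega>) + integral {s..u} ?k"
    unfolding residual_def by (rule Henstock_Kurzweil_Integration.integral_add[OF 1 2])
  then show ?thesis using \<alpha>_pos by (simp add: increment_def field_simps)
qed

end

end

context switching_diffusion begin

context
  fixes T :: real and a :: 'd
  assumes T: "0 < T"
begin

lemma increment_sum_square:
  fixes \<tau> :: "nat \<Rightarrow> real"
  assumes \<tau>: "0 \<le> \<tau> 0" "\<And>k. \<tau> k \<le> \<tau> (Suc k)" "\<And>k. \<tau> (Suc k) - \<tau> k \<le> \<alpha>"
  defines "D \<equiv> \<lambda>k. increment (frozen T a (\<tau> k)) (\<tau> k) (\<tau> (Suc k))"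
  shows "integrable M (\<lambda>\<omega>. (\<Sum>k<n. D k \<omega>)\<^sup>2)"
    and "expectation (\<lambda>\<omega>. (\<Sum>k<n. D k \<omega>)\<^sup>2) \<le> real n * ((2 + C) * bnd T)\<^sup>2"
proof -
  have D_eq: "D k = increment (frozen T a (\<tau> k)) (\<tau> k) (\<tau> (Suc k))" for k by (simp add: D_def)
  have \<tau>_mono: "\<tau> k \<le> \<tau> l" if "k \<le> l" for k l
    by (rule lift_Suc_mono_le[of \<tau>, OF \<tau>(2) that])
  have \<tau>0: "0 \<le> \<tau> k" for k using \<tau>(1) \<tau>_mono[of 0 k] by simp
  note fm = frozen_measurable[OF T \<tau>0] and fb = frozen_bounded[OF T]
  have DF: "D k \<in> borel_measurable (F (\<tau> (Suc k)))" for k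
    unfolding D_eq by (rule increment_adapted[OF fm fb \<tau>0 \<tau>(2)])
  have DM: "D k \<in> borel_measurable M" for k by (rule measurable_F_M[OF DF \<tau>0])
  have D_le: "\<bar>D k \<omega>\<bar> \<le> (2 + C) * bnd T" if "\<omega> \<in> space M" for k \<omega>
  proof -
    have "\<bar>D k \<omega>\<bar> \<le> 2 * bnd T + C * bnd T * (\<tau> (Suc k) - \<tau> k) / \<alpha>"
      unfolding D_eq bnd_def[OF T] by (rule increment_le[OF fm fb \<tau>0 \<tau>(2) that])
    \<comment> \<open>The interval length, at most \<alpha>, cancels the jump rate
      1/\<alpha>.\<close>
    also have "C * bnd T * (\<tau> (Suc k) - \<tau> k) / \<alpha> \<le> C * bnd T * \<alpha> / \<alpha>"
      using \<tau>(3)[of k] const_nonneg(3)[OF T] constants \<alpha>_pos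
      by (intro divide_right_mono mult_left_mono) auto
    also have "\<dots> = C * bnd T" using \<alpha>_pos by simp
    finally show ?thesis by (simp add: algebra_simps)
  qed
  have D2_le: "(D k \<omega>)\<^sup>2 \<le> ((2 + C) * bnd T)\<^sup>2" if "\<omega> \<in> space M" for k \<omega>
    using power_mono[OF D_le[OF that, of k], of 2] by simp
  have D2: "integrable M (\<lambda>\<omega>. (D k \<omega>)\<^sup>2)" for k
    by (rule integrable_const_bound[where B="((2 + C) * bnd T)\<^sup>2"]) (use D2_le DM in auto)
  have orth: "expectation (\<lambda>\<omega>. D k \<omega> * D l \<omega>) = 0" if kl: "k < l" for k l
    unfolding D_eq[of l]
  proof (rule increment_orthogonal_past[OF fm fb \<tau>0 \<tau>(2)])
    show "D k \<in> borel_measurable (F (\<tau> l))"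
      by (rule measurable_F_mono[OF DF \<tau>0 \<tau>_mono]) (use kl in simp)
    show "\<bar>D k \<omega>\<bar> \<le> (2 + C) * bnd T" if "\<omega> \<in> space M" for \<omega> using D_le[OF that] .
  qed
  note sq = orthogonal_sum_square[of n D, OF DM D2 orth]
  show "integrable M (\<lambda>\<omega>. (\<Sum>k<n. D k \<omega>)\<^sup>2)" by (rule sq(1))
  have "expectation (\<lambda>\<omega>. (D k \<omega>)\<^sup>2) \<le> ((2 + C) * bnd T)\<^sup>2" for k
    using D2_le by (intro integral_le_const D2 AE_I2)
  then have "(\<Sum>k<n. expectation (\<lambda>\<omega>. (D k \<omega>)\<^sup>2)) \<le> (\<Sum>k<n. ((2 + C) * bnd T)\<^sup>2)"
    by (rule sum_mono)
  then show "expectation (\<lambda>\<omega>. (\<Sum>k<n. D k \<omega>)\<^sup>2) \<le> real n * ((2 + C) * bnd T)\<^sup>2"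
    using sq(2) by simp
qed

text \<open>The corrector is frozen at the left end point of each of the roughly \<open>s / \<alpha>\<close> subintervals.
  Its boundary terms telescope up to a displacement of \<open>X\<close>, and the martingale increments are
  bounded and orthogonal, so that after multiplication by \<open>\<alpha>\<close> their sum is of order \<open>sqrt \<alpha>\<close>.\<close>

definition avg_const :: "real \<Rightarrow> real" where
  "avg_const t = (t * C * lip T + lip T * (t + 1)) * (K2 + 2 * noise t) + 2 * bnd T + 1
    + (t + 1) * ((2 + C) * bnd T)\<^sup>2"

lemma averaging_estimate:
  assumes s: "0 \<le> s" "s \<le> t" and \<alpha>1: "\<alpha> \<le> 1"
  shows "expectation (\<lambda>\<omega>. \<bar>integral {0..s} (\<lambda>r. fluct a r \<omega>)\<bar>)
    \<le> t * bias T + avg_const t * (sqrt \<alpha> + sqrt \<epsilon>)"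
proof -
  \<comment> \<open>Rounding s/\<alpha> up in this way makes the mesh \<delta> at most \<alpha>
    while n \<alpha> stays at most s + \<alpha>, and n is positive even for s = 0.\<close>
  define n where "n = Suc (nat \<lfloor>s / \<alpha>\<rfloor>)"
  define \<delta> where "\<delta> = s / real n"
  define \<tau> where "\<tau> k = real k * \<delta>" for k
  have n: "0 < n" by (simp add: n_def)
  have sa: "0 \<le> s / \<alpha>" using s \<alpha>_pos by simp
  have "real n = of_int \<lfloor>s / \<alpha>\<rfloor> + 1" using sa by (simp add: n_def)
  then have n_bounds: "s / \<alpha> \<le> real n" "real n \<le> s / \<alpha> + 1" by linarith+
  have n\<alpha>: "s \<le> real n * \<alpha>" "real n * \<alpha> \<le> s + \<alpha>"
    using n_bounds \<alpha>_pos by (simp_all add: field_simps)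
  have \<delta>: "0 \<le> \<delta>" "\<delta> \<le> \<alpha>" "real n * \<delta> = s"
    using s n n\<alpha>(1) by (auto simp: \<delta>_def field_simps)
  have \<tau>Suc: "\<tau> (Suc k) - \<tau> k = \<delta>" for k by (simp add: \<tau>_def algebra_simps)
  have \<tau>_le: "\<tau> k \<le> \<tau> (Suc k)" for k using \<tau>Suc[of k] \<delta> by linarith
  have \<tau>_mono: "\<tau> k \<le> \<tau> l" if "k \<le> l" for k l
    by (rule lift_Suc_mono_le[of \<tau>, OF \<tau>_le that])
  have \<tau>0: "0 \<le> \<tau> k" for k using \<delta> by (simp add: \<tau>_def)
  have \<tau>n: "\<tau> n = s" using \<delta> by (simp add: \<tau>_def)
  have \<tau>t: "\<tau> (Suc k) \<le> t" if "k < n" for k using \<tau>_mono[of "Suc k" n] that \<tau>n s by simp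
  define R where "R k \<omega> = integral {\<tau> k..\<tau> (Suc k)} (\<lambda>r. residual T a (\<tau> k) r \<omega>)" for k \<omega>
  define D where "D k = increment (frozen T a (\<tau> k)) (\<tau> k) (\<tau> (Suc k))" for k
  define V where "V k \<omega> = norm (X (\<tau> (Suc k)) \<omega> - X (\<tau> k) \<omega>)" for k \<omega>
  define c where "c k \<omega> = corrector T a (X (\<tau> k) \<omega>) (Y (\<tau> k) \<omega>)" for k \<omega>
  define E where "E k \<omega> = corrector T a (X (\<tau> k) \<omega>) (Y (\<tau> (Suc k)) \<omega>) - c k \<omega>" for k \<omega>
  let ?e = "K2 * \<delta> + 2 * (sqrt \<epsilon> * noise t)"
  let ?D2 = "((2 + C) * bnd T)\<^sup>2"
  have path: "integral {0..s} (\<lambda>r. fluct a r \<omega>) =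
      (\<Sum>k<n. R k \<omega>) - \<alpha> * (\<Sum>k<n. E k \<omega>) + \<alpha> * (\<Sum>k<n. D k \<omega>)"
    if \<omega>: "\<omega> \<in> space M" for \<omega>
  proof -
    have int: "(\<lambda>r. fluct a r \<omega>) integrable_on {0..v}" for v
      by (rule path_integral(1)[OF fluct_joint[OF T] _ \<omega> order_refl, where B="2 * K2"])
        (simp add: fluct_bounded[OF T \<omega>])
    have "integral {0..\<tau> m} (\<lambda>r. fluct a r \<omega>) = (\<Sum>k<m. integral {\<tau> k..\<tau> (Suc k)} (\<lambda>r. fluct a r \<omega>))" for m
    proof (induction m)
      case 0
      then show ?case by (simp add: \<tau>_def)
    next
      case (Suc m)
      then show ?case
        using Henstock_Kurzweil_Integration.integral_combine[OF \<tau>0 \<tau>_le int, of m] by simp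
    qed
    from this[of n] have "integral {0..s} (\<lambda>r. fluct a r \<omega>) =
        (\<Sum>k<n. R k \<omega> - \<alpha> * E k \<omega> + \<alpha> * D k \<omega>)"
      unfolding \<tau>n fluct_integral_split[OF T \<omega> \<tau>0 \<tau>_le] R_def D_def E_def c_def frozen_def .
    then show ?thesis by (simp add: sum.distrib sum_subtractf sum_distrib_left)
  qed
  have cb: "\<bar>c k \<omega>\<bar> \<le> bnd T" if "\<omega> \<in> space M" for k \<omega>
    unfolding c_def bnd_def[OF T] by (rule corrector_bounded[OF less_imp_le[OF T] Y_in_S[OF that \<tau>0]])
  \<comment> \<open>In \<open>E k\<close> the state has moved on while the slow argument lags
    behind. Updating the slow argument costs \<open>lip T * V k\<close>; what remains telescopes to
    two corrector values.\<close>
  have tel: "\<bar>\<Sum>k<n. E k \<omega>\<bar> \<le> 2 * bnd T + lip T * (\<Sum>k<n. V k \<omega>)"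
    if \<omega>: "\<omega> \<in> space M" for \<omega>
  proof -
    have "(\<Sum>k<n. E k \<omega>) =
        (\<Sum>k<n. corrector T a (X (\<tau> k) \<omega>) (Y (\<tau> (Suc k)) \<omega>) - c (Suc k) \<omega>) + (\<Sum>k<n. c (Suc k) \<omega> - c k \<omega>)"
      by (simp add: E_def flip: sum.distrib)
    also have "(\<Sum>k<n. c (Suc k) \<omega> - c k \<omega>) = c n \<omega> - c 0 \<omega>" by (rule sum_lessThan_telescope)
    finally have eq: "(\<Sum>k<n. E k \<omega>) =
        (\<Sum>k<n. corrector T a (X (\<tau> k) \<omega>) (Y (\<tau> (Suc k)) \<omega>) - c (Suc k) \<omega>) + (c n \<omega> - c 0 \<omega>)" .
    have "\<bar>\<Sum>k<n. corrector T a (X (\<tau> k) \<omega>) (Y (\<tau> (Suc k)) \<omega>) - c (Suc k) \<omega>\<bar> \<le> (\<Sum>k<n. lip T * V k \<omega>)"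
    proof (rule order_trans[OF sum_abs sum_mono])
      fix k
      show "\<bar>corrector T a (X (\<tau> k) \<omega>) (Y (\<tau> (Suc k)) \<omega>) - c (Suc k) \<omega>\<bar> \<le> lip T * V k \<omega>"
        unfolding c_def V_def lip_def[OF T]
        using corrector_lipschitz[OF less_imp_le[OF T] Y_in_S[OF \<omega> \<tau>0]] by (simp add: norm_minus_commute)
    qed
    then show ?thesis
      unfolding eq using cb[OF \<omega>, of n] cb[OF \<omega>, of 0] by (simp add: sum_distrib_left)
  qed
  \<comment> \<open>Young's inequality with weight \<open>sqrt \<alpha>\<close>. For the martingale
    sum x, whose second moment is of order 1/\<alpha>, both summands have order
    \<open>sqrt \<alpha>\<close>.\<close>
  have mart: "\<alpha> * \<bar>x\<bar> \<le> sqrt \<alpha> + \<alpha> * sqrt \<alpha> * x\<^sup>2" for x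
  proof -
    have "0 \<le> (sqrt \<alpha> * \<bar>x\<bar> - 1/2)\<^sup>2" by simp
    then have "sqrt \<alpha> * \<bar>x\<bar> \<le> 1 + \<alpha> * x\<^sup>2"
      using \<alpha>_pos by (simp add: power2_diff power_mult_distrib power_one_over)
    then have "sqrt \<alpha> * (sqrt \<alpha> * \<bar>x\<bar>) \<le> sqrt \<alpha> * (1 + \<alpha> * x\<^sup>2)"
      using \<alpha>_pos by (intro mult_left_mono) auto
    moreover have "sqrt \<alpha> * (sqrt \<alpha> * \<bar>x\<bar>) = \<alpha> * \<bar>x\<bar>"
      using \<alpha>_pos by (simp flip: mult.assoc)
    ultimately show ?thesis using \<alpha>_pos by (simp add: algebra_simps)
  qed
  let ?g = "\<lambda>\<omega>. (\<Sum>k<n. \<bar>R k \<omega>\<bar>) + \<alpha> * (2 * bnd T + lip T * (\<Sum>k<n. V k \<omega>))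
      + (sqrt \<alpha> + \<alpha> * sqrt \<alpha> * (\<Sum>k<n. D k \<omega>)\<^sup>2)"
  have le: "\<bar>integral {0..s} (\<lambda>r. fluct a r \<omega>)\<bar> \<le> ?g \<omega>" if \<omega>: "\<omega> \<in> space M" for \<omega>
  proof -
    have "\<bar>integral {0..s} (\<lambda>r. fluct a r \<omega>)\<bar> \<le> \<bar>\<Sum>k<n. R k \<omega>\<bar>
        + \<alpha> * \<bar>\<Sum>k<n. E k \<omega>\<bar> + \<alpha> * \<bar>\<Sum>k<n. D k \<omega>\<bar>"
    proof -
      have "\<bar>x - \<alpha> * y + \<alpha> * z\<bar> \<le> \<bar>x\<bar> + \<bar>\<alpha> * y\<bar> + \<bar>\<alpha> * z\<bar>" for x y z by linarith
      then show ?thesis unfolding path[OF \<omega>] using \<alpha>_pos by (simp add: abs_mult)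
    qed
    moreover have "\<bar>\<Sum>k<n. R k \<omega>\<bar> \<le> (\<Sum>k<n. \<bar>R k \<omega>\<bar>)" by (rule sum_abs)
    moreover have "\<alpha> * \<bar>\<Sum>k<n. E k \<omega>\<bar>
        \<le> \<alpha> * (2 * bnd T + lip T * (\<Sum>k<n. V k \<omega>))"
      using \<alpha>_pos by (intro mult_left_mono tel \<omega>) simp
    ultimately show ?thesis using mart[of "\<Sum>k<n. D k \<omega>"] by linarith
  qed
  have Ri: "integrable M (R k)" and RE: "expectation (\<lambda>\<omega>. \<bar>R k \<omega>\<bar>) \<le> (bias T + C * lip T * ?e) * \<delta>" if "k < n" for k
    using residual_int[OF T \<tau>0 \<tau>_le \<tau>t[OF that], of a] unfolding R_def[abs_def] \<tau>Suc by auto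
  have Vi: "integrable M (V k)" and VE: "expectation (V k) \<le> ?e" if "k < n" for k
    using X_displacement[OF \<tau>0 \<tau>_le \<tau>t[OF that]] unfolding V_def[abs_def] \<tau>Suc by auto
  have \<tau>d: "\<tau> (Suc k) - \<tau> k \<le> \<alpha>" for k unfolding \<tau>Suc by (rule \<delta>(2))
  note Dsq = increment_sum_square[of \<tau> n, OF \<tau>0 \<tau>_le \<tau>d, folded D_def]
  have gi: "integrable M ?g"
    using Ri Vi Dsq(1) by (intro Bochner_Integration.integrable_add integrable_mult_right
      Bochner_Integration.integrable_sum integrable_abs integrable_const) auto
  have fi: "integrable M (\<lambda>\<omega>. \<bar>integral {0..s} (\<lambda>r. fluct a r \<omega>)\<bar>)"
    by (intro integrable_abs expectation_path(1)[OF fluct_joint[OF T] _ order_refl s(1)])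
      (rule fluct_bounded[OF T])
  have "expectation (\<lambda>\<omega>. \<bar>integral {0..s} (\<lambda>r. fluct a r \<omega>)\<bar>) \<le> expectation ?g"
    by (rule integral_mono[OF fi gi le])
  also have "\<dots> = (\<Sum>k<n. expectation (\<lambda>\<omega>. \<bar>R k \<omega>\<bar>)) + \<alpha> * (2 * bnd T + lip T * (\<Sum>k<n. expectation (V k)))
      + (sqrt \<alpha> + \<alpha> * sqrt \<alpha> * expectation (\<lambda>\<omega>. (\<Sum>k<n. D k \<omega>)\<^sup>2))"
  proof -
    have "expectation (\<lambda>\<omega>. \<Sum>k<n. \<bar>R k \<omega>\<bar>) = (\<Sum>k<n. expectation (\<lambda>\<omega>. \<bar>R k \<omega>\<bar>))"
      using Ri by (intro Bochner_Integration.integral_sum) auto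
    moreover have "expectation (\<lambda>\<omega>. \<Sum>k<n. V k \<omega>) = (\<Sum>k<n. expectation (V k))"
      using Vi by (intro Bochner_Integration.integral_sum) auto
    moreover have "integrable M (\<lambda>\<omega>. \<Sum>k<n. \<bar>R k \<omega>\<bar>)" "integrable M (\<lambda>\<omega>. \<Sum>k<n. V k \<omega>)"
      using Ri Vi by (auto intro!: Bochner_Integration.integrable_sum)
    ultimately show ?thesis using Dsq(1) by (simp add: prob_space)
  qed
  also have "\<dots> \<le> (\<Sum>k<n. (bias T + C * lip T * ?e) * \<delta>) + \<alpha> * (2 * bnd T + lip T * (\<Sum>k<n. ?e))
      + (sqrt \<alpha> + \<alpha> * sqrt \<alpha> * (real n * ?D2))"
    using RE VE Dsq(2) \<alpha>_pos const_nonneg[OF T]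
    by (intro add_mono sum_mono mult_left_mono order_refl) auto
  also have "\<dots> = s * (bias T + C * lip T * ?e) + 2 * bnd T * \<alpha> + lip T * ((real n * \<alpha>) * ?e)
      + sqrt \<alpha> + (real n * \<alpha>) * (sqrt \<alpha> * ?D2)"
  proof -
    have "(\<Sum>k<n. x * \<delta>) = s * x" for x
      using arg_cong[OF \<delta>(3), of "\<lambda>y. y * x"] by (simp add: mult_ac)
    then show ?thesis by (simp only: sum_constant card_lessThan) (simp add: algebra_simps)
  qed
  also have "\<dots> \<le> t * bias T + avg_const t * (sqrt \<alpha> + sqrt \<epsilon>)"
  proof -
    let ?h = "sqrt \<alpha> + sqrt \<epsilon>"
    have nc: "0 \<le> noise t" using noise_nonneg s by simp
    have \<alpha>_sqrt: "\<alpha> \<le> sqrt \<alpha>"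
    proof -
      have "sqrt \<alpha> * sqrt \<alpha> \<le> sqrt \<alpha> * 1" using \<alpha>1 \<alpha>_pos by (intro mult_left_mono) auto
      then show ?thesis using \<alpha>_pos by simp
    qed
    have sq: "0 \<le> sqrt \<epsilon>" "0 \<le> sqrt \<alpha>" using \<epsilon>_pos \<alpha>_pos by auto
    have h: "\<delta> \<le> ?h" "\<alpha> \<le> ?h" "sqrt \<alpha> \<le> ?h" "sqrt \<epsilon> \<le> ?h" "0 \<le> ?h"
      using \<delta> \<alpha>_sqrt sq by linarith+
    have e: "?e \<le> (K2 + 2 * noise t) * ?h"
    proof -
      have "K2 * \<delta> \<le> K2 * ?h" by (rule mult_left_mono[OF h(1) constants(2)])
      moreover have "sqrt \<epsilon> * noise t \<le> ?h * noise t" by (rule mult_right_mono[OF h(4) nc])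
      ultimately show ?thesis by (simp add: algebra_simps)
    qed
    have e0: "0 \<le> ?e" using mult_nonneg_nonneg[OF constants(2) \<delta>(1)] mult_nonneg_nonneg[OF sq(1) nc] by linarith
    have n1: "real n * \<alpha> \<le> t + 1" using n\<alpha> s \<alpha>1 by linarith
    have t0: "0 \<le> t" "0 \<le> t + 1" using s by auto
    have CL: "0 \<le> C * lip T" using constants const_nonneg[OF T] by simp
    have 1: "s * (bias T + C * lip T * ?e) \<le> t * (bias T + C * lip T * ((K2 + 2 * noise t) * ?h))"
      by (rule mult_mono[OF s(2) add_left_mono[OF mult_left_mono[OF e CL]] t0(1)
            add_nonneg_nonneg[OF const_nonneg(1)[OF T] mult_nonneg_nonneg[OF CL e0]]])
    have 2: "2 * bnd T * \<alpha> \<le> 2 * bnd T * ?h"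
      by (rule mult_left_mono[OF h(2)]) (use const_nonneg[OF T] in simp)
    have 3: "lip T * ((real n * \<alpha>) * ?e) \<le> lip T * ((t + 1) * ((K2 + 2 * noise t) * ?h))"
      by (rule mult_left_mono[OF mult_mono[OF n1 e t0(2) e0] const_nonneg(2)[OF T]])
    have 4: "(real n * \<alpha>) * (sqrt \<alpha> * ?D2) \<le> (t + 1) * (?h * ?D2)"
      by (rule mult_mono[OF n1 mult_right_mono[OF h(3)] t0(2)]) (use sq in auto)
    have "s * (bias T + C * lip T * ?e) + 2 * bnd T * \<alpha> + lip T * ((real n * \<alpha>) * ?e)
      + sqrt \<alpha> + (real n * \<alpha>) * (sqrt \<alpha> * ?D2) \<le>
      t * (bias T + C * lip T * ((K2 + 2 * noise t) * ?h)) + 2 * bnd T * ?h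
      + lip T * ((t + 1) * ((K2 + 2 * noise t) * ?h)) + ?h + (t + 1) * (?h * ?D2)"
      using 1 2 3 4 h(3) by linarith
    \<comment> \<open>The summands of \<open>avg_const\<close> by origin: the residuals give
      \<open>t * C * lip T\<close>, the lagging slow arguments \<open>lip T * (t + 1)\<close>, the
      ends of the telescoping sum \<open>2 * bnd T\<close>, and the martingale sum the remaining
      two.\<close>
    also have "\<dots> = t * bias T + avg_const t * ?h"
      unfolding avg_const_def by (simp only: distrib_left distrib_right mult_ac mult_1_left mult_1_right add_ac)
    finally show ?thesis .
  qed
  finally show ?thesis .
qed

end

end

section \<open>Gronwall's inequality and the averaging principle\<close>

text \<open>The integrating factor exp(-L s) makes the right-hand side of \<open>le\<close>
  nonincreasing: the derivative of the product is exp(-L s) times L times the difference of the two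
  sides of \<open>le\<close>.\<close>

lemma gronwall:
  fixes u :: "real \<Rightarrow> real"
  assumes cont: "continuous_on {0..t} u" and L: "0 \<le> L" and t: "0 \<le> t"
    and le: "\<And>s. 0 \<le> s \<Longrightarrow> s \<le> t \<Longrightarrow> u s \<le> c + L * integral {0..s} u"
  shows "u t \<le> c * exp (L * t)"
proof -
  define w where "w s = exp (- L * s) * (c + L * integral {0..s} u)" for s
  have int: "u integrable_on {0..t}" using cont by (rule integrable_continuous_real)
  have icont: "continuous_on {0..t} (\<lambda>s. integral {0..s} u)"
    by (rule indefinite_integral_continuous_1[OF int])
  have wcont: "continuous_on {0..t} w"
    unfolding w_def by (intro continuous_intros icont)
  have der: "\<exists>y. DERIV w s :> y \<and> y \<le> 0" if s: "0 < s" "s < t" for s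
  proof (intro exI conjI)
    have "((\<lambda>s. integral {0..s} u) has_real_derivative u s) (at s within {0..t})"
      by (rule integral_has_real_derivative[OF cont]) (use s in auto)
    then have d: "((\<lambda>s. integral {0..s} u) has_real_derivative u s) (at s)"
      using s by (simp add: at_within_Icc_at)
    show "DERIV w s :> exp (- L * s) * (L * (u s - (c + L * integral {0..s} u)))"
      unfolding w_def by (auto intro!: derivative_eq_intros d simp: algebra_simps)
    show "exp (- L * s) * (L * (u s - (c + L * integral {0..s} u))) \<le> 0"
      using le[of s] s L by (intro mult_nonneg_nonpos) auto
  qed
  have "w t \<le> w 0"
  proof (cases "t = 0")
    case False
    then show ?thesis using DERIV_nonpos_imp_decreasing_open[of 0 t w, OF _ der wcont] t by simp
  qed simp
  then have "exp (- L * t) * (c + L * integral {0..t} u) \<le> c" by (simp add: w_def)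
  then have le': "exp (L * t) * (exp (- L * t) * (c + L * integral {0..t} u)) \<le> exp (L * t) * c"
    by (rule mult_left_mono) simp
  have "exp (L * t) * (exp (- L * t) * x) = x" for x
    by (simp flip: mult.assoc exp_add)
  from le'[unfolded this] have "c + L * integral {0..t} u \<le> c * exp (L * t)" by (simp add: mult.commute)
  then show ?thesis using le[OF t order_refl] by linarith
qed

text \<open>Here \<open>v\<close> is the second moment of the standard Gaussian measure and \<open>L\<close> the Lipschitz constant of
  the averaged drift.\<close>

definition error_const :: "real \<Rightarrow> real \<Rightarrow> real \<Rightarrow> real \<Rightarrow> real \<Rightarrow> real \<Rightarrow> real \<Rightarrow> real \<Rightarrow> real \<Rightarrow> real" where
  "error_const d K1 K2 K3 C v L t T =
    (let nc = d * (1 + K2\<^sup>2 * v * t); k = exp (2 * C * T) * (K1 + K3 * K2); g = exp (C * T) * K2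
     in (d * ((t * C * k + k * (t + 1)) * (K2 + 2 * nc) + 2 * g + 1 + (t + 1) * ((2 + C) * g)\<^sup>2) + L * t * nc)
         * exp (L * t) + nc)"

context switching_diffusion begin

text \<open>The ergodic error stands apart because it alone stays when \<epsilon> and \<alpha>
  vanish with T fixed. The other constant is written out in global parameters, so that it is visibly
  the same for all the probability spaces.\<close>

lemma averaging_bound:
  fixes Xbar :: "real \<Rightarrow> real^'d"
  assumes L: "0 \<le> L" "\<And>x y. norm (mean_drift x - mean_drift y) \<le> L * norm (x - y)"
    and T: "0 < T" and \<alpha>1: "\<alpha> \<le> 1" and t: "0 \<le> t"
    and Xbar0: "Xbar 0 = x0"
    and ode: "\<And>s. 0 \<le> s \<Longrightarrow> (Xbar has_vector_derivative mean_drift (Xbar s)) (at s within {0..})"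
  shows "expectation (\<lambda>\<omega>. norm (X t \<omega> - Xbar t)) \<le>
    real CARD('d) * t * (c1 * exp (- lam * T) * K2) * exp (L * t)
    + error_const (real CARD('d)) K1 K2 K3 C (\<integral>v. (norm (v::real^'m))\<^sup>2 \<partial>gauss_measure 1) L t T * (sqrt \<alpha> + sqrt \<epsilon>)"
proof -
  have Xc: "continuous_on {0..} Xbar"
    using ode by (auto simp: continuous_on_eq_continuous_within intro: has_vector_derivative_continuous)
  have Xint: "((\<lambda>r. mean_drift (Xbar r)) has_integral Xbar s - Xbar r) {r..s}" if "0 \<le> r" "r \<le> s" for r s
    by (rule fundamental_theorem_of_calculus[OF that(2)])
      (use that in \<open>auto intro!: has_vector_derivative_within_subset[OF ode]\<close>)
  have Xlip: "norm (Xbar s - Xbar r) \<le> K2 * (s - r)" if "0 \<le> r" "r \<le> s" for r s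
    using has_integral_bound[OF constants(2) Xint[OF that, unfolded cbox_interval[symmetric]]] mean_drift_bounded that
    by simp
  \<comment> \<open>The error is measured with \<open>drift\<close> in place of \<open>X\<close>:
    the pathwise Lipschitz bound makes \<open>u\<close> continuous, as Gronwall's inequality
    requires, and returning to \<open>X\<close> costs \<open>sqrt \<epsilon> * noise t\<close> at
    each time.\<close>
  define u where "u s = expectation (\<lambda>\<omega>. norm (drift s \<omega> - Xbar s))" for s
  have path_le: "norm (drift s \<omega> - Xbar s) \<le> 2 * K2 * s" if "0 \<le> s" "\<omega> \<in> space M" for s \<omega>
  proof -
    have "norm (drift s \<omega> - Xbar s) = norm ((drift s \<omega> - drift 0 \<omega>) - (Xbar s - Xbar 0))"
      by (simp add: drift_def Xbar0 algebra_simps)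
    also have "\<dots> \<le> norm (drift s \<omega> - drift 0 \<omega>) + norm (Xbar s - Xbar 0)" by (rule norm_triangle_ineq4)
    finally show ?thesis using drift_path_lipschitz[OF that(2) order_refl that(1)] Xlip[OF order_refl that(1)] by simp
  qed
  have ui: "integrable M (\<lambda>\<omega>. norm (drift s \<omega> - Xbar s))" if "0 \<le> s" for s
    by (rule integrable_const_bound[where B="2 * K2 * s"])
      (use path_le[OF that] drift_path_measurable[OF that] in auto)
  have u_lip: "\<bar>u s - u r\<bar> \<le> 2 * K2 * (s - r)" if rs: "0 \<le> r" "r \<le> s" for r s
  proof -
    have s0: "0 \<le> s" using rs by simp
    have pw: "\<bar>norm (drift s \<omega> - Xbar s) - norm (drift r \<omega> - Xbar r)\<bar> \<le> 2 * K2 * (s - r)"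
      if \<omega>: "\<omega> \<in> space M" for \<omega>
    proof -
      have "\<bar>norm (drift s \<omega> - Xbar s) - norm (drift r \<omega> - Xbar r)\<bar>
          \<le> norm ((drift s \<omega> - Xbar s) - (drift r \<omega> - Xbar r))" by (rule norm_triangle_ineq3)
      also have "\<dots> = norm ((drift s \<omega> - drift r \<omega>) - (Xbar s - Xbar r))"
        by (simp add: algebra_simps)
      also have "\<dots> \<le> norm (drift s \<omega> - drift r \<omega>) + norm (Xbar s - Xbar r)" by (rule norm_triangle_ineq4)
      finally show ?thesis using drift_path_lipschitz[OF \<omega> rs] Xlip[OF rs] by simp
    qed
    have "u s - u r = expectation (\<lambda>\<omega>. norm (drift s \<omega> - Xbar s) - norm (drift r \<omega> - Xbar r))"
      unfolding u_def using ui[OF s0] ui[OF rs(1)] by simp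
    also have "\<bar>\<dots>\<bar> \<le> expectation (\<lambda>\<omega>. \<bar>norm (drift s \<omega> - Xbar s) - norm (drift r \<omega> - Xbar r)\<bar>)"
      by (rule integral_abs_bound)
    also have "\<dots> \<le> 2 * K2 * (s - r)"
      using ui[OF s0] ui[OF rs(1)] pw by (intro integral_le_const AE_I2) auto
    finally show ?thesis .
  qed
  have ucont: "continuous_on {0..t} u"
  proof -
    have "(2 * K2)-lipschitz_on {0..t} u"
    proof (rule lipschitz_onI)
      fix r s assume "r \<in> {0..t}" "s \<in> {0..t}"
      then show "dist (u r) (u s) \<le> 2 * K2 * dist r s"
        using u_lip[of r s] u_lip[of s r] by (cases "r \<le> s") (auto simp: dist_real_def abs_minus_commute)
    qed (use constants in simp)
    then show ?thesis by (rule lipschitz_on_continuous_on)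
  qed
  define h where "h r \<omega> = norm (mean_drift (X r \<omega>) - mean_drift (Xbar r))" for r \<omega>
  have hb: "\<bar>h r \<omega>\<bar> \<le> 2 * K2" for r \<omega>
    unfolding h_def using norm_triangle_ineq4[of "mean_drift (X r \<omega>)" "mean_drift (Xbar r)"]
      mean_drift_bounded[of "X r \<omega>"] mean_drift_bounded[of "Xbar r"] by simp
  have md_jm: "jointly_measurable M (\<lambda>r \<omega>. mean_drift (X r \<omega>) - mean_drift (Xbar r))"
  proof (rule jointly_measurable_right_continuous)
    show "(\<lambda>\<omega>. mean_drift (X r \<omega>) - mean_drift (Xbar r)) \<in> borel_measurable M" if "0 \<le> r" for r
      using measurable_compose[OF X_measurable[OF that] borel_measurable_continuous_onI[OF mean_drift_continuous]]
      by simp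
    fix r :: real and \<omega> assume r: "0 \<le> r" and \<omega>: "\<omega> \<in> space M"
    have md: "isCont mean_drift x" for x
      using mean_drift_continuous by (simp add: continuous_on_eq_continuous_at)
    have "((\<lambda>v. mean_drift (X v \<omega>) - mean_drift (Xbar v)) \<longlongrightarrow> mean_drift (X r \<omega>) - mean_drift (Xbar r)) (at r within {0..})"
      using X_continuous[OF \<omega>] Xc r by (intro tendsto_diff isCont_tendsto_compose[OF md]) (auto simp: continuous_on)
    then show "((\<lambda>v. mean_drift (X v \<omega>) - mean_drift (Xbar v)) \<longlongrightarrow> mean_drift (X r \<omega>) - mean_drift (Xbar r)) (at_right r)"
      by (rule tendsto_within_subset) (use r in auto)
  qed
  have h_jm: "jointly_measurable M h"
    using md_jm unfolding jointly_measurable_def case_prod_unfold h_def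
    by (rule measurable_compose[OF _ borel_measurable_norm])
  have X_dist: "integrable M (\<lambda>\<omega>. norm (X r \<omega> - Xbar r)) \<and>
      expectation (\<lambda>\<omega>. norm (X r \<omega> - Xbar r)) \<le> u r + sqrt \<epsilon> * noise t" if r: "0 \<le> r" "r \<le> t" for r
  proof -
    let ?g = "\<lambda>\<omega>. norm (drift r \<omega> - Xbar r) + norm (X r \<omega> - drift r \<omega>)"
    have gi: "integrable M ?g" using ui[OF r(1)] noise_bound(1)[OF r] by simp
    have le: "norm (X r \<omega> - Xbar r) \<le> ?g \<omega>" for \<omega>
      using norm_triangle_ineq[of "drift r \<omega> - Xbar r" "X r \<omega> - drift r \<omega>"] by simp
    have i: "integrable M (\<lambda>\<omega>. norm (X r \<omega> - Xbar r))"
    proof (rule Bochner_Integration.integrable_bound[OF gi])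
      show "(\<lambda>\<omega>. norm (X r \<omega> - Xbar r)) \<in> borel_measurable M" using X_measurable[OF r(1)] by simp
      show "AE \<omega> in M. norm (norm (X r \<omega> - Xbar r)) \<le> norm (?g \<omega>)" using le by (intro AE_I2) simp
    qed
    have "expectation (\<lambda>\<omega>. norm (X r \<omega> - Xbar r)) \<le> expectation ?g" by (rule integral_mono[OF i gi le])
    also have "\<dots> = u r + expectation (\<lambda>\<omega>. norm (X r \<omega> - drift r \<omega>))"
      unfolding u_def by (rule Bochner_Integration.integral_add[OF ui[OF r(1)] noise_bound(1)[OF r]])
    finally show ?thesis using i noise_bound(2)[OF r] by simp
  qed
  \<comment> \<open>The last summand pays for replacing \<open>X\<close> by \<open>drift\<close> in
    the Lipschitz estimate of the averaged drift.\<close>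
  define c where "c = real CARD('d) * (t * bias T + avg_const T t * (sqrt \<alpha> + sqrt \<epsilon>)) + L * t * (sqrt \<epsilon> * noise t)"
  have main: "u s \<le> c + L * integral {0..s} u" if s: "0 \<le> s" "s \<le> t" for s
  proof -
    let ?f = "\<lambda>a \<omega>. integral {0..s} (\<lambda>r. fluct a r \<omega>)"
    have fi: "integrable M (?f a)" for a
      by (rule expectation_path(1)[OF fluct_joint[OF T] _ order_refl s(1)])
        (rule fluct_bounded[OF T])
    note hE = expectation_path[OF h_jm hb order_refl s(1)]
    \<comment> \<open>The difference of the drifts is split at \<open>mean_drift (X r)\<close>. One
      part is the fluctuation of the averaging estimate, the other is the Lipschitz term that feeds
      Gronwall's inequality.\<close>
    have pw: "norm (drift s \<omega> - Xbar s) \<le> (\<Sum>a\<in>UNIV. \<bar>?f a \<omega>\<bar>) + integral {0..s} (\<lambda>r. h r \<omega>)"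
      if \<omega>: "\<omega> \<in> space M" for \<omega>
    proof -
      let ?m = "\<lambda>r. mean_drift (X r \<omega>) - mean_drift (Xbar r)"
      have mi: "?m integrable_on {0..s}"
        by (rule path_integral(1)[OF md_jm _ \<omega> order_refl, where B="2 * K2"]) (use hb in \<open>simp add: h_def\<close>)
      have hi: "(\<lambda>r. h r \<omega>) integrable_on {0..s}"
        by (rule path_integral(1)[OF h_jm _ \<omega> order_refl, where B="2 * K2"]) (use hb in simp)
      have Xi: "(\<lambda>r. mean_drift (Xbar r)) integrable_on {0..s}" using Xint[OF order_refl s(1)] by blast
      note bi = b_path(1)[OF \<omega> order_refl, of s]
      have Fi: "(\<lambda>r. b (X r \<omega>) (Y r \<omega>) - mean_drift (X r \<omega>)) integrable_on {0..s}"
        using integrable_diff[OF integrable_diff[OF bi Xi] mi] by (simp add: algebra_simps)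
      have "drift s \<omega> - Xbar s = integral {0..s} (\<lambda>r. b (X r \<omega>) (Y r \<omega>)) - integral {0..s} (\<lambda>r. mean_drift (Xbar r))"
        using integral_unique[OF Xint[OF order_refl s(1)]] by (simp add: drift_def Xbar0)
      also have "\<dots> = integral {0..s} (\<lambda>r. b (X r \<omega>) (Y r \<omega>) - mean_drift (Xbar r))"
        by (rule Henstock_Kurzweil_Integration.integral_diff[OF bi Xi, symmetric])
      also have "\<dots> = integral {0..s} (\<lambda>r. (b (X r \<omega>) (Y r \<omega>) - mean_drift (X r \<omega>)) + ?m r)"
        by simp
      also have "\<dots> = integral {0..s} (\<lambda>r. b (X r \<omega>) (Y r \<omega>) - mean_drift (X r \<omega>)) + integral {0..s} ?m"
        by (rule Henstock_Kurzweil_Integration.integral_add[OF Fi mi])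
      finally have eq: "drift s \<omega> - Xbar s =
          integral {0..s} (\<lambda>r. b (X r \<omega>) (Y r \<omega>) - mean_drift (X r \<omega>)) + integral {0..s} ?m" .
      have 1: "norm (integral {0..s} (\<lambda>r. b (X r \<omega>) (Y r \<omega>) - mean_drift (X r \<omega>))) \<le> (\<Sum>a\<in>UNIV. \<bar>?f a \<omega>\<bar>)"
      proof -
        have "?f a \<omega> = integral {0..s} (\<lambda>r. b (X r \<omega>) (Y r \<omega>) - mean_drift (X r \<omega>)) $ a" for a
          using integral_component_eq_cart[OF Fi, of a] by (simp add: fluct_def[OF T])
        then show ?thesis
          using norm_le_l1_cart[of "integral {0..s} (\<lambda>r. b (X r \<omega>) (Y r \<omega>) - mean_drift (X r \<omega>))"] by simp
      qed
      have 2: "norm (integral {0..s} ?m) \<le> integral {0..s} (\<lambda>r. h r \<omega>)"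
        by (rule integral_norm_bound_integral[OF mi hi]) (simp add: h_def)
      show ?thesis unfolding eq by (rule order_trans[OF norm_triangle_ineq add_mono[OF 1 2]])
    qed
    have si: "integrable M (\<lambda>\<omega>. \<Sum>a\<in>UNIV. \<bar>?f a \<omega>\<bar>)"
      using fi by (intro Bochner_Integration.integrable_sum integrable_abs)
    have "u s \<le> expectation (\<lambda>\<omega>. (\<Sum>a\<in>UNIV. \<bar>?f a \<omega>\<bar>) + integral {0..s} (\<lambda>r. h r \<omega>))"
      unfolding u_def by (rule integral_mono[OF ui[OF s(1)] Bochner_Integration.integrable_add[OF si hE(1)] pw])
    also have "\<dots> = (\<Sum>a\<in>UNIV. expectation (\<lambda>\<omega>. \<bar>?f a \<omega>\<bar>)) + integral {0..s} (\<lambda>r. expectation (h r))"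
      using fi hE(3) Bochner_Integration.integral_add[OF si hE(1)] by (simp add: Bochner_Integration.integral_sum)
    also have "(\<Sum>a\<in>UNIV. expectation (\<lambda>\<omega>. \<bar>?f a \<omega>\<bar>)) \<le>
        (\<Sum>a\<in>(UNIV::'d set). t * bias T + avg_const T t * (sqrt \<alpha> + sqrt \<epsilon>))"
      by (intro sum_mono averaging_estimate[OF T s \<alpha>1])
    also have "integral {0..s} (\<lambda>r. expectation (h r)) \<le> integral {0..s} (\<lambda>r. L * u r + L * (sqrt \<epsilon> * noise t))"
    proof (rule integral_le[OF hE(2)])
      have "continuous_on {0..s} u" using continuous_on_subset[OF ucont] s by simp
      then show "(\<lambda>r. L * u r + L * (sqrt \<epsilon> * noise t)) integrable_on {0..s}"
        by (intro integrable_continuous_real continuous_intros)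
      fix r assume r: "r \<in> {0..s}"
      then have r0: "0 \<le> r" and rt: "r \<le> t" using s by auto
      have "integrable M (h r)"
        by (rule integrable_const_bound[where B="2 * K2"]) (use hb jointly_measurable_section[OF h_jm r0] in auto)
      then have "expectation (h r) \<le> expectation (\<lambda>\<omega>. L * norm (X r \<omega> - Xbar r))"
        using X_dist[OF r0 rt] L(2) by (intro integral_mono) (auto simp: h_def)
      also have "\<dots> = L * expectation (\<lambda>\<omega>. norm (X r \<omega> - Xbar r))" by simp
      also have "\<dots> \<le> L * (u r + sqrt \<epsilon> * noise t)"
        using X_dist[OF r0 rt] L(1) by (intro mult_left_mono) auto
      finally show "expectation (h r) \<le> L * u r + L * (sqrt \<epsilon> * noise t)" by (simp add: distrib_left)
    qed
    also have "\<dots> = L * integral {0..s} u + L * (sqrt \<epsilon> * noise t) * s"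
    proof -
      have ius: "u integrable_on {0..s}"
        using integrable_continuous_real[OF continuous_on_subset[OF ucont]] s by simp
      have "integral {0..s} (\<lambda>r. L * u r + L * (sqrt \<epsilon> * noise t)) =
          integral {0..s} (\<lambda>r. L * u r) + integral {0..s} (\<lambda>r. L * (sqrt \<epsilon> * noise t))"
        by (rule Henstock_Kurzweil_Integration.integral_add[OF integrable_on_mult_right[OF ius] integrable_const_ivl])
      then show ?thesis using s by simp
    qed
    also have "L * (sqrt \<epsilon> * noise t) * s \<le> L * (sqrt \<epsilon> * noise t) * t"
      using s L noise_nonneg[OF t] \<epsilon>_pos by (intro mult_left_mono) auto
    finally show ?thesis unfolding c_def by (simp add: mult_ac)
  qed
  have "u t \<le> c * exp (L * t)" by (rule gronwall[OF ucont L(1) t main])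
  then have "expectation (\<lambda>\<omega>. norm (X t \<omega> - Xbar t)) \<le> c * exp (L * t) + sqrt \<epsilon> * noise t"
    using X_dist[OF t order_refl] by linarith
  also have "\<dots> \<le> real CARD('d) * t * bias T * exp (L * t) +
      ((real CARD('d) * avg_const T t + L * t * noise t) * exp (L * t) + noise t) * (sqrt \<alpha> + sqrt \<epsilon>)"
  proof -
    let ?h = "sqrt \<alpha> + sqrt \<epsilon>"
    have e: "sqrt \<epsilon> * noise t \<le> ?h * noise t"
      using noise_nonneg[OF t] \<alpha>_pos by (intro mult_right_mono) auto
    have "L * t * (sqrt \<epsilon> * noise t) \<le> L * t * (?h * noise t)"
      using e L t by (intro mult_left_mono) auto
    then have "c \<le> real CARD('d) * t * bias T + (real CARD('d) * avg_const T t + L * t * noise t) * ?h"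
      unfolding c_def by (simp add: algebra_simps)
    then have "c * exp (L * t) \<le>
        (real CARD('d) * t * bias T + (real CARD('d) * avg_const T t + L * t * noise t) * ?h) * exp (L * t)"
      by (intro mult_right_mono) auto
    with e show ?thesis by (simp add: algebra_simps)
  qed
  finally show ?thesis
    unfolding error_const_def Let_def avg_const_def[OF T] noise_def var_rate_def
      bias_def[OF T] lip_def[OF T] bnd_def[OF T] .
qed

end

text \<open>The diagonal rate is determined by the off-diagonal ones, so it costs at most a factor two.\<close>

lemma zero_sum_abs_bound:
  fixes w :: "nat \<Rightarrow> real"
  assumes w: "(w has_sum 0) S" and i: "i \<in> S"
  shows "w abs_summable_on S" and "(\<Sum>\<^sub>\<infinity>j\<in>S. \<bar>w j\<bar>) \<le> 2 * (\<Sum>\<^sub>\<infinity>j\<in>S - {i}. \<bar>w j\<bar>)"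
proof -
  have ws: "w summable_on S" using w by (rule has_sum_imp_summable)
  show as: "w abs_summable_on S" using ws summable_on_iff_abs_summable_on_real[of w S] by simp
  have as': "w abs_summable_on (S - {i})" by (rule summable_on_subset_banach[OF as]) auto
  have S: "insert i (S - {i}) = S" using i by auto
  have "infsum w S = w i + infsum w (S - {i})"
    using infsum_insert[OF abs_summable_summable[OF as'], of i] S by simp
  then have "\<bar>w i\<bar> \<le> (\<Sum>\<^sub>\<infinity>j\<in>S - {i}. \<bar>w j\<bar>)"
    using infsumI[OF w] norm_infsum_bound[OF as'] by simp
  moreover have "(\<Sum>\<^sub>\<infinity>j\<in>S. \<bar>w j\<bar>) = \<bar>w i\<bar> + (\<Sum>\<^sub>\<infinity>j\<in>S - {i}. \<bar>w j\<bar>)"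
    using infsum_insert[of "\<lambda>j. \<bar>w j\<bar>" "S - {i}" i] as' S by simp
  ultimately show "(\<Sum>\<^sub>\<infinity>j\<in>S. \<bar>w j\<bar>) \<le> 2 * (\<Sum>\<^sub>\<infinity>j\<in>S - {i}. \<bar>w j\<bar>)" by simp
qed

theorem theorem2p4:
  fixes N :: enat and S :: "nat set"
    and b :: "real^'d \<Rightarrow> nat \<Rightarrow> real^'d"
    and \<sigma> :: "real^'d \<Rightarrow> nat \<Rightarrow> real^'m^'d"
    and Q :: "real^'d \<Rightarrow> nat \<Rightarrow> nat \<Rightarrow> real"
    and \<pi> :: "real^'d \<Rightarrow> nat \<Rightarrow> real"
    and x0 :: "real^'d" and i0 :: nat
    and M :: "real \<Rightarrow> real \<Rightarrow> 'a measure"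
    and F :: "real \<Rightarrow> real \<Rightarrow> real \<Rightarrow> 'a measure"
    and W :: "real \<Rightarrow> real \<Rightarrow> real \<Rightarrow> 'a \<Rightarrow> real^'m"
    and X :: "real \<Rightarrow> real \<Rightarrow> real \<Rightarrow> 'a \<Rightarrow> real^'d"
    and Y :: "real \<Rightarrow> real \<Rightarrow> real \<Rightarrow> 'a \<Rightarrow> nat"
    and Xbar :: "real \<Rightarrow> real^'d"
    and t :: real
  assumes N: "N \<ge> 1"
    and S_def: "S = state_space N"
    and A1: "\<exists>K1>0. \<exists>K2>0. \<forall>x y. \<forall>i\<in>S.
               norm (b x i - b y i) + norm (\<sigma> x i - \<sigma> y i) \<le> K1 * norm (x - y) \<and>
               norm (b x i) + norm (\<sigma> x i) \<le> K2"
    and A2_cons: "\<forall>x. conservative S (Q x)"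
    and A2_irr: "\<forall>x. irreducible_rates S (Q x)"
    and A2_bd: "\<exists>C. \<forall>i\<in>S. \<exists>g. (\<forall>j\<in>S - {i}. \<forall>x. Q x i j \<le> g j) \<and>
               g summable_on (S - {i}) \<and> (\<Sum>\<^sub>\<infinity>j\<in>S - {i}. g j) \<le> C"
    and A3: "\<exists>K3>0. \<forall>x y. \<forall>i\<in>S.
               (\<Sum>\<^sub>\<infinity>j\<in>S - {i}. \<bar>Q x i j - Q y i j\<bar>) \<le> K3 * norm (x - y)"
    and A4_inv: "\<forall>x. invariant_prob S (Q x) (\<pi> x)"
    and A4_erg: "\<exists>c1>0. \<exists>lam1>0. \<forall>s>0. \<forall>x. \<forall>i\<in>S.
               (\<Sum>\<^sub>\<infinity>j\<in>S. \<bar>ctmc_semigroup S (Q x) s i j - \<pi> x j\<bar>) \<le> c1 * exp (- lam1 * s)"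
    and i0: "i0 \<in> S"
    and sol: "\<And>\<epsilon> \<alpha>. \<epsilon> > 0 \<Longrightarrow> \<alpha> > 0 \<Longrightarrow>
               sde_solution (M \<epsilon> \<alpha>) (F \<epsilon> \<alpha>) (W \<epsilon> \<alpha>) (X \<epsilon> \<alpha>) (Y \<epsilon> \<alpha>) S b \<sigma> Q x0 i0 \<epsilon> \<alpha>"
    and ode0: "Xbar 0 = x0"
    and ode: "\<And>s. s \<ge> 0 \<Longrightarrow>
               (Xbar has_vector_derivative (\<Sum>\<^sub>\<infinity>i\<in>S. \<pi> (Xbar s) i *\<^sub>R b (Xbar s) i))
                 (at s within {0..})"
    and t: "t > 0"
  shows "((\<lambda>(\<epsilon>, \<alpha>). integral\<^sup>L (M \<epsilon> \<alpha>) (\<lambda>\<omega>. norm (X \<epsilon> \<alpha> t \<omega> - Xbar t))) \<longlongrightarrow> 0)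
           (at (0, 0) within {0<..} \<times> {0<..})"
proof -
  from A1 obtain K1 K2 where K: "0 < K1" "0 < K2"
    and b\<sigma>: "\<And>x y i. i \<in> S \<Longrightarrow> norm (b x i - b y i) + norm (\<sigma> x i - \<sigma> y i) \<le> K1 * norm (x - y)"
      "\<And>x i. i \<in> S \<Longrightarrow> norm (b x i) + norm (\<sigma> x i) \<le> K2"
    by blast
  from A3 obtain K3 where K3: "0 < K3"
    and Ql: "\<And>x y i. i \<in> S \<Longrightarrow> (\<Sum>\<^sub>\<infinity>j\<in>S - {i}. \<bar>Q x i j - Q y i j\<bar>) \<le> K3 * norm (x - y)"
    by blast
  from A4_erg obtain c1 lam where cl: "0 < c1" "0 < lam"
    and erg: "\<And>s x i. 0 < s \<Longrightarrow> i \<in> S \<Longrightarrow>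
      (\<Sum>\<^sub>\<infinity>j\<in>S. \<bar>ctmc_semigroup S (Q x) s i j - \<pi> x j\<bar>) \<le> c1 * exp (- lam * s)"
    by blast
  from A2_bd obtain C0 where C0: "\<And>i. i \<in> S \<Longrightarrow> \<exists>g. (\<forall>j\<in>S - {i}. \<forall>x. Q x i j \<le> g j) \<and>
               g summable_on (S - {i}) \<and> (\<Sum>\<^sub>\<infinity>j\<in>S - {i}. g j) \<le> C0"
    by blast
  \<comment> \<open>The factor 2 accounts for the diagonal entries, \<open>max 1\<close> for the
    normalization in the locale.\<close>
  define C where "C = max 1 (2 * C0)"
  have Q0: "(Q x i has_sum 0) S" if "i \<in> S" for x i
    using A2_cons that unfolding conservative_def by simp
  have rb: "row_bounded S (Q x) C" for x
    unfolding row_bounded_def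
  proof
    fix i assume i: "i \<in> S"
    note z = zero_sum_abs_bound[OF Q0[OF i, of x] i]
    obtain g where g: "\<forall>j\<in>S - {i}. \<forall>x. Q x i j \<le> g j" "g summable_on (S - {i})" "(\<Sum>\<^sub>\<infinity>j\<in>S - {i}. g j) \<le> C0"
      using C0[OF i] by blast
    have "(\<Sum>\<^sub>\<infinity>j\<in>S - {i}. \<bar>Q x i j\<bar>) \<le> (\<Sum>\<^sub>\<infinity>j\<in>S - {i}. g j)"
    proof (rule infsum_mono[OF _ g(2)])
      show "(\<lambda>j. \<bar>Q x i j\<bar>) summable_on (S - {i})"
        using summable_on_subset_banach[OF z(1), of "S - {i}"] by auto
      fix j assume j: "j \<in> S - {i}"
      then have "0 \<le> Q x i j" using A2_cons i unfolding conservative_def by auto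
      then show "\<bar>Q x i j\<bar> \<le> g j" using g(1) j by simp
    qed
    then show "Q x i abs_summable_on S \<and> (\<Sum>\<^sub>\<infinity>j\<in>S. \<bar>Q x i j\<bar>) \<le> C"
      using z g(3) by (simp add: C_def)
  qed
  \<comment> \<open>Rows of a difference of conservative matrices again sum to zero, so the diagonal
    costs another factor 2, now on \<open>K3\<close>.\<close>
  have rl: "row_bounded S (\<lambda>i j. Q x i j - Q y i j) (2 * K3 * norm (x - y))" for x y
    unfolding row_bounded_def
  proof
    fix i assume i: "i \<in> S"
    have "((\<lambda>j. Q x i j - Q y i j) has_sum 0) S"
      using has_sum_add[OF Q0[OF i, of x] has_sum_uminusI[OF Q0[OF i, of y]]] by simp
    from zero_sum_abs_bound[OF this i]
    show "(\<lambda>j. Q x i j - Q y i j) abs_summable_on S \<and> (\<Sum>\<^sub>\<infinity>j\<in>S. \<bar>Q x i j - Q y i j\<bar>) \<le> 2 * K3 * norm (x - y)"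
      using Ql[OF i, of x y] by simp
  qed
  interpret A: averaging_coefficients S b \<sigma> Q \<pi> K1 K2 "2 * K3" C c1 lam
  proof
    show "S \<noteq> {}" using i0 by auto
    fix x y :: "real^'d" and i assume i: "i \<in> S"
    show "norm (b x i - b y i) \<le> K1 * norm (x - y)" "norm (\<sigma> x i - \<sigma> y i) \<le> K1 * norm (x - y)"
      using b\<sigma>(1)[OF i, of x y] norm_ge_zero[of "b x i - b y i"] norm_ge_zero[of "\<sigma> x i - \<sigma> y i"] by linarith+
    show "norm (b x i) \<le> K2" "norm (\<sigma> x i) \<le> K2"
      using b\<sigma>(2)[OF i, of x] norm_ge_zero[of "b x i"] norm_ge_zero[of "\<sigma> x i"] by linarith+
  qed (use K K3 cl rb rl erg A4_inv in \<open>auto simp: C_def\<close>)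
  obtain L where L: "0 \<le> L" "\<And>x y. norm (A.mean_drift x - A.mean_drift y) \<le> L * norm (x - y)"
    using A.mean_drift_lipschitz by blast
  define D where "D = real CARD('d) * t * (c1 * K2) * exp (L * t)"
  define E where "E T = error_const (real CARD('d)) K1 K2 (2 * K3) C (\<integral>v. (norm (v::real^'m))\<^sup>2 \<partial>gauss_measure 1) L t T" for T
  \<comment> \<open>Each pair of parameters is treated on its own probability space;
    \<open>D\<close> and \<open>E T\<close> are fixed beforehand, and T is still free.\<close>
  have bound: "integral\<^sup>L (M \<epsilon> \<alpha>) (\<lambda>\<omega>. norm (X \<epsilon> \<alpha> t \<omega> - Xbar t)) \<le> D * exp (- lam * T) + E T * (sqrt \<alpha> + sqrt \<epsilon>)"
    if "0 < \<epsilon>" "0 < \<alpha>" "\<alpha> \<le> 1" "0 < T" for \<epsilon> \<alpha> T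
  proof -
    note s = sol[OF that(1,2)]
    note s' = s[unfolded sde_solution_def]
    note ps = s'[THEN conjunct1] and fl = s'[THEN conjunct2, THEN conjunct1]
      and bm = s'[THEN conjunct2, THEN conjunct2, THEN conjunct1]
    interpret P: prob_space "M \<epsilon> \<alpha>" by (rule ps)
    interpret SD: switching_diffusion S b \<sigma> Q \<pi> K1 K2 "2 * K3" C c1 lam "M \<epsilon> \<alpha>" "F \<epsilon> \<alpha>" "W \<epsilon> \<alpha>" "X \<epsilon> \<alpha>" "Y \<epsilon> \<alpha>" x0 i0 \<epsilon> \<alpha>
      by unfold_locales (fact fl bm that(1,2) s)+
    have "integral\<^sup>L (M \<epsilon> \<alpha>) (\<lambda>\<omega>. norm (X \<epsilon> \<alpha> t \<omega> - Xbar t)) \<le>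
        real CARD('d) * t * (c1 * exp (- lam * T) * K2) * exp (L * t) + E T * (sqrt \<alpha> + sqrt \<epsilon>)"
      unfolding E_def
      by (rule SD.averaging_bound[where Xbar=Xbar, OF L that(4,3) less_imp_le[OF t] ode0]) (unfold A.mean_drift_def, rule ode)
    then show ?thesis by (simp add: D_def mult_ac)
  qed
  show ?thesis
  proof (rule tendstoI)
    fix e :: real assume e: "0 < e"
    have D: "0 \<le> D" using t cl K by (simp add: D_def)
    \<comment> \<open>Chosen so that exp(lam T) is at least 2 D / e + 1, which puts the ergodic
      error strictly below e / 2. The outer 1 makes T positive even where the logarithm is
      zero.\<close>
    define T where "T = (ln (2 * D / e + 1) + 1) / lam"
    have pos: "0 < 2 * D / e + 1" using D e by (simp add: add_nonneg_pos)
    have T: "0 < T" using D e cl by (auto simp: T_def intro!: divide_pos_pos add_nonneg_pos)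
    have "D * exp (- lam * T) < e / 2"
    proof -
      have "2 * D / e + 1 = exp (ln (2 * D / e + 1))" using pos by simp
      also have "\<dots> \<le> exp (lam * T)" using cl by (simp add: T_def)
      finally have "2 * D < exp (lam * T) * e" using e by (simp add: field_simps)
      then show ?thesis by (simp add: exp_minus field_simps)
    qed
    note T = T this
    \<comment> \<open>With T fixed, \<open>E T\<close> is a constant, so the remaining error
      vanishes as the two parameters tend to 0 jointly, whatever their relative speed.\<close>
    have "((\<lambda>p. E T * (sqrt (snd p) + sqrt (fst p))) \<longlongrightarrow> E T * (sqrt 0 + sqrt 0))
        (at (0, 0) within {0<..} \<times> {0<..})"
      by (intro tendsto_intros tendsto_eq_intros) auto
    then have ev: "eventually (\<lambda>p. E T * (sqrt (snd p) + sqrt (fst p)) < e / 2) (at (0, 0) within {0<..} \<times> {0<..})"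
      using e by (intro order_tendstoD(2)) auto
    have "(snd \<longlongrightarrow> snd (0::real, 0::real)) (at (0::real, 0::real) within {0<..} \<times> {0<..})"
      by (rule tendsto_snd[OF tendsto_ident_at])
    then have ev1: "eventually (\<lambda>p. snd p < (1::real)) (at ((0::real), 0) within {0<..} \<times> {0<..})"
      by (rule order_tendstoD(2)) simp
    have ev2: "eventually (\<lambda>p. p \<in> {0<..} \<times> {0<..}) (at ((0::real), (0::real)) within {0<..} \<times> {0<..})"
      by (simp add: eventually_at_filter)
    from ev ev1 ev2 show "\<forall>\<^sub>F p in at (0, 0) within {0<..} \<times> {0<..}.
        dist (case p of (\<epsilon>, \<alpha>) \<Rightarrow> integral\<^sup>L (M \<epsilon> \<alpha>) (\<lambda>\<omega>. norm (X \<epsilon> \<alpha> t \<omega> - Xbar t))) 0 < e"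
    proof eventually_elim
      case (elim p)
      obtain \<epsilon> \<alpha> where p: "p = (\<epsilon>, \<alpha>)" by (cases p)
      have "integral\<^sup>L (M \<epsilon> \<alpha>) (\<lambda>\<omega>. norm (X \<epsilon> \<alpha> t \<omega> - Xbar t)) < e"
        using bound[of \<epsilon> \<alpha> T] elim T p by auto
      moreover have "0 \<le> integral\<^sup>L (M \<epsilon> \<alpha>) (\<lambda>\<omega>. norm (X \<epsilon> \<alpha> t \<omega> - Xbar t))" by simp
      ultimately show ?case by (simp add: p)
    qed
  qed
qed

end
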